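(* Let $SO(4)\times SU(3)$ act on $G_2$ by $((h,k),x)\mapsto hxk^{-1}$, where $SO(4),SU(3)\subset G_2$ are the subgroups specified in the context, and let $G_2$ carry the bi-invariant metric specified there. Then there exists exactly one minimal principal orbit of this action, and this minimal principal orbit is neither austere nor weakly reflective.
   Context: Octonions: $\mathbb{O}=\sum_{i=0}^7\mathbb{R}e_i$ with unit $e_0=1$, $e_i^2=-1$ and $e_ie_j=-e_je_i$ for $1\le i\ne j\le7$, and $e_ie_j=e_k$, $e_je_k=e_i$, $e_ke_i=e_j$ for each triple $(i,j,k)\in\{(1,2,3),(1,4,5),(1,6,7),(2,5,7),(2,6,4),(3,4,7),(3,5,6)\}$. $G_2=\mathrm{Aut}(\mathbb{O})$ is the group of algebra automorphisms of $\mathbb{O}$, with Lie algebra $\mathfrak{g}_2$. Subgroups of $G_2$: $SU(3)=\{g\in G_2: g(e_1)=e_1\}$. Let $\sigma\in G_2$ be defined by $\sigma(e_i)=e_i$ for $i=0,1,2,3$ and $\sigma(e_j)=-e_j$ for $j=4,5,6,7$; then $SO(4)=\{g\in G_2:\sigma g=g\sigma\}$. Metric: $\langle X,Y\rangle=-\frac18B_{\mathfrak{g}_2}(X,Y)$ on $\mathfrak{g}_2$, where $B_{\mathfrak g_2}$ is the Killing form; the induced bi-invariant Riemannian metric on $G_2$ is used. Principal orbits are the orbits of maximal dimension (here of codimension one). For a submanifold $M$ of a Riemannian manifold $N$ and a normal vector $\xi$, $A^\xi$ denotes the shape operator. $M$ is austere if for every $x\in M$ and $\xi\in T_x^\perp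 M$ the set of eigenvalues of $A^\xi$ with multiplicities is invariant under multiplication by $-1$. $M$ is weakly reflective if for every $x\in M$ and $\xi\in T_x^\perp M$ there is an isometry $\sigma_\xi$ of $N$ with $\sigma_\xi(x)=x$, $d\sigma_\xi(\xi)=-\xi$, $\sigma_\xi(M)\subset M$. *)

theory Defs
  imports "HOL-Analysis.Analysis"
begin

section \<open>Smooth maps\<close>

fun Ck_on :: "nat \<Rightarrow> 'a::real_normed_vector set \<Rightarrow> ('a \<Rightarrow> 'b::real_normed_vector) \<Rightarrow> bool" where
  "Ck_on 0 S f \<longleftrightarrow> continuous_on S f"
| "Ck_on (Suc k) S f \<longleftrightarrow>
     (\<exists>f'. (\<forall>x\<in>S. (f has_derivative f' x) (at x)) \<and> (\<forall>v. Ck_on k S (\<lambda>x. f' x v)))"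

text \<open>Intended for open subsets \<open>S\<close> of a Euclidean space.\<close>

definition smooth_on :: "'a::real_normed_vector set \<Rightarrow> ('a \<Rightarrow> 'b::real_normed_vector) \<Rightarrow> bool" where
  "smooth_on S f \<longleftrightarrow> (\<forall>k. Ck_on k S f)"


section \<open>Submanifolds of a Euclidean space carrying a Riemannian metric\<close>

text \<open>
  A manifold is given as a (smoothly embedded) subset \<open>N\<close> of a Euclidean space \<open>'a\<close>. A Riemannian
  metric on \<open>N\<close> is a function \<open>g\<close> such that \<open>g x\<close> is an inner product on the tangent space of \<open>N\<close>
  at \<open>x\<close>; it need not be the one induced by \<open>'a\<close>. The values of \<open>g\<close>, and of functions and vector
  fields, are only meaningful at points of \<open>N\<close> and on tangent vectors.
\<close>

definition smooth_map :: "'a::euclidean_space set \<Rightarrow> ('a \<Rightarrow> 'b::real_normed_vector) \<Rightarrow> bool" where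
  "smooth_map N f \<longleftrightarrow>
     (\<forall>x\<in>N. \<exists>U F. open U \<and> x \<in> U \<and> smooth_on U F \<and> (\<forall>y\<in>N \<inter> U. F y = f y))"

definition tangent_space :: "'a::euclidean_space set \<Rightarrow> 'a \<Rightarrow> 'a set" where
  "tangent_space N x =
     {v. \<exists>(\<gamma> :: real \<Rightarrow> 'a) \<epsilon>. \<epsilon> > 0 \<and> smooth_on {-\<epsilon><..<\<epsilon>} \<gamma> \<and> (\<forall>t\<in>{-\<epsilon><..<\<epsilon>}. \<gamma> t \<in> N)
           \<and> \<gamma> 0 = x \<and> (\<gamma> has_vector_derivative v) (at 0)}"

text \<open>
  A derivative within \<open>N\<close> at a point \<open>x\<close> is in general not unique as a linear map on \<open>'a\<close>, but by
  the chain rule along curves in \<open>N\<close> it is unique on \<open>tangent_space N x\<close>, where alone it is used.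
\<close>

abbreviation differential ::
    "'a::euclidean_space set \<Rightarrow> ('a \<Rightarrow> 'b::real_normed_vector) \<Rightarrow> 'a \<Rightarrow> 'a \<Rightarrow> 'b" where
  "differential N f x v \<equiv> frechet_derivative f (at x within N) v"

definition vector_fields :: "'a::euclidean_space set \<Rightarrow> ('a \<Rightarrow> 'a) set" where
  "vector_fields N = {X. smooth_map N X \<and> (\<forall>x\<in>N. X x \<in> tangent_space N x)}"

definition lie_bracket ::
    "'a::euclidean_space set \<Rightarrow> ('a \<Rightarrow> 'a) \<Rightarrow> ('a \<Rightarrow> 'a) \<Rightarrow> 'a \<Rightarrow> 'a" where
  "lie_bracket N X Y x = differential N Y x (X x) - differential N X x (Y x)"

definition is_levi_civita ::
    "'a::euclidean_space set \<Rightarrow> ('a \<Rightarrow> 'a \<Rightarrow> 'a \<Rightarrow> real)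
      \<Rightarrow> (('a \<Rightarrow> 'a) \<Rightarrow> ('a \<Rightarrow> 'a) \<Rightarrow> 'a \<Rightarrow> 'a) \<Rightarrow> bool" where
  "is_levi_civita N g D \<longleftrightarrow>
     (\<forall>X\<in>vector_fields N. \<forall>Y\<in>vector_fields N. D X Y \<in> vector_fields N) \<and>
     (\<forall>X\<in>vector_fields N. \<forall>Y\<in>vector_fields N. \<forall>Z\<in>vector_fields N. \<forall>x\<in>N.
        D (\<lambda>y. X y + Y y) Z x = D X Z x + D Y Z x \<and>
        D X (\<lambda>y. Y y + Z y) x = D X Y x + D X Z x) \<and>
     (\<forall>f::'a \<Rightarrow> real. smooth_map N f \<longrightarrow>
        (\<forall>X\<in>vector_fields N. \<forall>Y\<in>vector_fields N. \<forall>x\<in>N.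
           D (\<lambda>y. f y *\<^sub>R X y) Y x = f x *\<^sub>R D X Y x \<and>
           D X (\<lambda>y. f y *\<^sub>R Y y) x = f x *\<^sub>R D X Y x + differential N f x (X x) *\<^sub>R Y x)) \<and>
     (\<forall>X\<in>vector_fields N. \<forall>Y\<in>vector_fields N. \<forall>x\<in>N.
        D X Y x - D Y X x = lie_bracket N X Y x) \<and>
     (\<forall>X\<in>vector_fields N. \<forall>Y\<in>vector_fields N. \<forall>Z\<in>vector_fields N. \<forall>x\<in>N.
        differential N (\<lambda>y. g y (Y y) (Z y)) x (X x) = g x (D X Y x) (Z x) + g x (Y x) (D X Z x))"

text \<open>
  On vector fields and at points of \<open>N\<close>, the Levi-Civita connection is unique; the choice
  operator only fixes irrelevant values.
\<close>

definition levi_civita ::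
    "'a::euclidean_space set \<Rightarrow> ('a \<Rightarrow> 'a \<Rightarrow> 'a \<Rightarrow> real)
      \<Rightarrow> ('a \<Rightarrow> 'a) \<Rightarrow> ('a \<Rightarrow> 'a) \<Rightarrow> 'a \<Rightarrow> 'a" where
  "levi_civita N g = (SOME D. is_levi_civita N g D)"

definition is_isometry ::
    "'a::euclidean_space set \<Rightarrow> ('a \<Rightarrow> 'a \<Rightarrow> 'a \<Rightarrow> real) \<Rightarrow> ('a \<Rightarrow> 'a) \<Rightarrow> bool" where
  "is_isometry N g \<phi> \<longleftrightarrow>
     bij_betw \<phi> N N \<and> smooth_map N \<phi> \<and> smooth_map N (inv_into N \<phi>) \<and>
     (\<forall>x\<in>N. \<forall>u\<in>tangent_space N x. \<forall>v\<in>tangent_space N x.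
        g (\<phi> x) (differential N \<phi> x u) (differential N \<phi> x v) = g x u v)"


section \<open>Submanifold geometry\<close>

text \<open>Here \<open>M\<close> is a submanifold of the Riemannian manifold \<open>(N, g)\<close>.\<close>

definition normal_space ::
    "'a::euclidean_space set \<Rightarrow> ('a \<Rightarrow> 'a \<Rightarrow> 'a \<Rightarrow> real) \<Rightarrow> 'a set \<Rightarrow> 'a \<Rightarrow> 'a set" where
  "normal_space N g M x = {\<xi> \<in> tangent_space N x. \<forall>v\<in>tangent_space M x. g x v \<xi> = 0}"

definition tangential_part ::
    "'a::euclidean_space set \<Rightarrow> ('a \<Rightarrow> 'a \<Rightarrow> 'a \<Rightarrow> real) \<Rightarrow> 'a set \<Rightarrow> 'a \<Rightarrow> 'a \<Rightarrow> 'a" where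
  "tangential_part N g M x w =
     (THE u. u \<in> tangent_space M x \<and> w - u \<in> normal_space N g M x)"

text \<open>
  Weingarten's formula: \<open>A\<^sup>\<xi> v\<close> is minus the tangential part of the covariant derivative in
  direction \<open>v\<close> of any normal field \<open>\<eta>\<close> of \<open>M\<close> near \<open>x\<close> with \<open>\<eta> x = \<xi>\<close>, where \<open>\<eta>\<close> and \<open>v\<close> are extended
  to vector fields on \<open>N\<close>. The value does not depend on the extensions.
\<close>

definition shape_operator ::
    "'a::euclidean_space set \<Rightarrow> ('a \<Rightarrow> 'a \<Rightarrow> 'a \<Rightarrow> real) \<Rightarrow> 'a set \<Rightarrow> 'a \<Rightarrow> 'a \<Rightarrow> 'a \<Rightarrow> 'a" where
  "shape_operator N g M x \<xi> v =
     (THE w. \<exists>X\<in>vector_fields N. \<exists>\<eta>\<in>vector_fields N. \<exists>U.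
        X x = v \<and> \<eta> x = \<xi> \<and> open U \<and> x \<in> U \<and> (\<forall>y\<in>M \<inter> U. \<eta> y \<in> normal_space N g M y) \<and>
        w = - tangential_part N g M x (levi_civita N g X \<eta> x))"

text \<open>The trace of a linear endomorphism \<open>A\<close> of a subspace \<open>V\<close>; it is independent of the basis.\<close>

definition trace_on :: "'a::euclidean_space set \<Rightarrow> ('a \<Rightarrow> 'a) \<Rightarrow> real" where
  "trace_on V A =
     (let B = (SOME B. B \<subseteq> V \<and> independent B \<and> span B = V)
      in \<Sum>b\<in>B. representation B (A b) b)"

definition minimal_submanifold ::
    "'a::euclidean_space set \<Rightarrow> ('a \<Rightarrow> 'a \<Rightarrow> 'a \<Rightarrow> real) \<Rightarrow> 'a set \<Rightarrow> bool" where
  "minimal_submanifold N g M \<longleftrightarrow>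
     (\<forall>x\<in>M. \<forall>\<xi>\<in>normal_space N g M x.
        trace_on (tangent_space M x) (shape_operator N g M x \<xi>) = 0)"

text \<open>
  Shape operators are self-adjoint, so the multiplicity of an eigenvalue \<open>c\<close> is the dimension of its eigenspace.
\<close>

definition eigenvalue_multiplicity ::
    "'a::euclidean_space set \<Rightarrow> ('a \<Rightarrow> 'a) \<Rightarrow> real \<Rightarrow> nat" where
  "eigenvalue_multiplicity V A c = dim {v\<in>V. A v = c *\<^sub>R v}"

definition austere ::
    "'a::euclidean_space set \<Rightarrow> ('a \<Rightarrow> 'a \<Rightarrow> 'a \<Rightarrow> real) \<Rightarrow> 'a set \<Rightarrow> bool" where
  "austere N g M \<longleftrightarrow>
     (\<forall>x\<in>M. \<forall>\<xi>\<in>normal_space N g M x. \<forall>c.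
        eigenvalue_multiplicity (tangent_space M x) (shape_operator N g M x \<xi>) (- c) =
        eigenvalue_multiplicity (tangent_space M x) (shape_operator N g M x \<xi>) c)"

definition weakly_reflective ::
    "'a::euclidean_space set \<Rightarrow> ('a \<Rightarrow> 'a \<Rightarrow> 'a \<Rightarrow> real) \<Rightarrow> 'a set \<Rightarrow> bool" where
  "weakly_reflective N g M \<longleftrightarrow>
     (\<forall>x\<in>M. \<forall>\<xi>\<in>normal_space N g M x. \<exists>\<phi>.
        is_isometry N g \<phi> \<and> \<phi> x = x \<and> differential N \<phi> x \<xi> = - \<xi> \<and> \<phi> ` M \<subseteq> M)"


section \<open>Octonions and \<open>G\<^sub>2\<close>\<close>

text \<open>
  The octonions are \<open>real^8\<close> with \<open>e\<^sub>i = axis i 1\<close>, where \<open>i\<close> ranges over \<open>0, \<dots>, 7\<close> in the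
  numeral type \<open>8\<close>. (The built-in product on \<open>real^8\<close> is componentwise and is not used.)
\<close>

type_synonym octonion = "real^8"

definition oct_e :: "8 \<Rightarrow> octonion" where
  "oct_e i = axis i 1"

definition oct_triples :: "(8 \<times> 8 \<times> 8) set" where
  "oct_triples = {(1,2,3), (1,4,5), (1,6,7), (2,5,7), (2,6,4), (3,4,7), (3,5,6)}"

definition oct_cyclic :: "8 \<Rightarrow> 8 \<Rightarrow> 8 \<Rightarrow> bool" where
  "oct_cyclic i j k \<longleftrightarrow>
     (i,j,k) \<in> oct_triples \<or> (j,k,i) \<in> oct_triples \<or> (k,i,j) \<in> oct_triples"

text \<open>The coefficient of \<open>e\<^sub>k\<close> in the product \<open>e\<^sub>i e\<^sub>j\<close>.\<close>

definition oct_coeff :: "8 \<Rightarrow> 8 \<Rightarrow> 8 \<Rightarrow> real" where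
  "oct_coeff i j k =
     (if i = 0 then (if k = j then 1 else 0)
      else if j = 0 then (if k = i then 1 else 0)
      else if i = j then (if k = 0 then - 1 else 0)
      else if oct_cyclic i j k then 1
      else if oct_cyclic j i k then - 1
      else 0)"

definition oct_mult :: "octonion \<Rightarrow> octonion \<Rightarrow> octonion" where
  "oct_mult x y = (\<chi> k. \<Sum>i\<in>UNIV. \<Sum>j\<in>UNIV. oct_coeff i j k * x $ i * y $ j)"

definition G2 :: "(real^8^8) set" where
  "G2 = {A. invertible A \<and> (\<forall>x y. A *v oct_mult x y = oct_mult (A *v x) (A *v y))}"

definition SU3 :: "(real^8^8) set" where
  "SU3 = {A\<in>G2. A *v oct_e 1 = oct_e 1}"

definition oct_sigma :: "real^8^8" where
  "oct_sigma = (\<chi> i j. if i = j then (if i \<in> {0,1,2,3} then 1 else - 1) else 0)"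

definition SO4 :: "(real^8^8) set" where
  "SO4 = {A\<in>G2. oct_sigma ** A = A ** oct_sigma}"

definition lie_g2 :: "(real^8^8) set" where
  "lie_g2 = tangent_space G2 (mat 1)"

definition commutator :: "real^8^8 \<Rightarrow> real^8^8 \<Rightarrow> real^8^8" where
  "commutator X Y = X ** Y - Y ** X"

definition killing_g2 :: "real^8^8 \<Rightarrow> real^8^8 \<Rightarrow> real" where
  "killing_g2 X Y = trace_on lie_g2 (\<lambda>Z. commutator X (commutator Y Z))"

text \<open>The left-invariant (hence bi-invariant) extension of \<open>- B / 8\<close> to \<open>G\<^sub>2\<close>.\<close>

definition metric_G2 :: "real^8^8 \<Rightarrow> real^8^8 \<Rightarrow> real^8^8 \<Rightarrow> real" where
  "metric_G2 x u v = - (1/8) * killing_g2 (matrix_inv x ** u) (matrix_inv x ** v)"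


section \<open>Orbits\<close>

definition orbit_G2 :: "real^8^8 \<Rightarrow> (real^8^8) set" where
  "orbit_G2 x = {h ** x ** matrix_inv k | h k. h \<in> SO4 \<and> k \<in> SU3}"

text \<open>
  An orbit is a homogeneous submanifold, so its dimension is that of any of its tangent spaces.
\<close>

definition principal_orbit :: "(real^8^8) set \<Rightarrow> bool" where
  "principal_orbit M \<longleftrightarrow>
     (\<exists>x\<in>G2. M = orbit_G2 x) \<and>
     (\<forall>x\<in>M. \<forall>y\<in>G2. dim (tangent_space (orbit_G2 y) y) \<le> dim (tangent_space M x))"

end

theory Submission
  imports Defs
begin

text \<open>
  \<open>SU(3)\<close> is the stabiliser of \<open>e\<^sub>1\<close>, so the orbits correspond to the \<open>SO(4)\<close>-orbits on \<open>S\<^sup>6 = G\<^sub>2/SU(3)\<close>. They are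
  the level sets of the height \<open>F x = \<langle>x e\<^sub>1, \<sigma> x e\<^sub>1\<rangle>\<close>, the principal ones being those with \<open>\<bar>F\<bar> < 1\<close>.

  The Killing form of \<open>\<gg>\<^sub>2\<close> is \<open>4 tr(XY)\<close>, and automorphisms are orthogonal matrices, so the metric is half of the
  Euclidean one induced from \<open>8 \<times> 8\<close> matrices; its Levi-Civita connection is the tangential part of the
  ambient derivative. Differentiating the gradient of \<open>F\<close> along an orbit gives a shape operator on
  derivations whose trace is a multiple of \<open>1 + 5F\<close>. Hence \<open>F = - 1/5\<close> on the only minimal principal orbit.

  On that orbit the shape operator has a principal curvature whose negative is not one, so the orbit is not
  austere. An isometry \<open>\<phi>\<close> that fixes \<open>x\<close>, preserves the orbit and reverses the normal \<open>\<xi>\<close> satisfies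
  \<open>A\<^sup>\<xi> d\<phi> = - d\<phi> A\<^sup>\<xi>\<close>, because isometries preserve the connection; this would again make the principal
  curvatures symmetric about zero.
\<close>

section \<open>Smooth maps and symmetry of second derivatives\<close>

text \<open>Tangent vectors are velocities of curves, and the connection and the shape operator are
  given by choice and description operators, so each geometric object has to be identified before it
  can be computed. Left translation reduces tangent spaces to the derivations of the octonions,
  which have fourteen free matrix entries. The fourteen generators satisfy
  \<open>b ** b ** b = - b\<close>; their one-parameter groups are therefore trigonometric
  polynomials, and products of such curves realise every derivation, also inside \<open>SU3\<close>
  and \<open>SO4\<close>. Equivariance reduces an orbit to one point of the curve
  \<open>model_point\<close>, where the height is cos 2t. The gradient of the height serves as
  normal field without being normalised: its length is constant on an orbit, so its covariant
  derivative along the orbit is already tangent. A reflecting isometry lives on the group only; the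
  connection is compared through a local extension to the space of matrices, where symmetry of
  second derivatives takes the place of torsion-freeness. This is why Schwarz's theorem opens the
  proof.\<close>

lemma Ck_on_cong:
  assumes "open S" "\<And>x. x \<in> S \<Longrightarrow> f x = g x" "Ck_on k S f"
  shows "Ck_on k S g"
proof (cases k)
  case 0
  then show ?thesis using assms continuous_on_cong[of S S f g] by simp
next
  case (Suc l)
  then obtain f' where f': "\<And>x. x \<in> S \<Longrightarrow> (f has_derivative f' x) (at x)" "\<And>v. Ck_on l S (\<lambda>x. f' x v)"
    using assms(3) by auto
  have "(g has_derivative f' x) (at x)" if "x \<in> S" for x
    using has_derivative_transform_within_open[OF f'(1)[OF that] assms(1) that] assms(2) by auto
  then show ?thesis using f'(2) Suc by auto
qed

lemma Ck_on_subset: "Ck_on k S f \<Longrightarrow> T \<subseteq> S \<Longrightarrow> Ck_on k T f"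
proof (induction k arbitrary: f)
  case 0
  then show ?case by (auto intro: continuous_on_subset)
next
  case (Suc k)
  then obtain f' where "\<And>x. x \<in> S \<Longrightarrow> (f has_derivative f' x) (at x)" "\<And>v. Ck_on k S (\<lambda>x. f' x v)"
    by auto
  then show ?case using Suc by (auto intro!: exI[of _ f'])
qed

lemma Ck_on_Suc_D: "Ck_on (Suc k) S f \<Longrightarrow> Ck_on k S f"
proof (induction k arbitrary: f)
  case 0
  then show ?case
    by (metis Ck_on.simps(1) Ck_on.simps(2) continuous_at_imp_continuous_on has_derivative_continuous)
next
  case (Suc k)
  from Suc.prems obtain f' where
    "\<And>x. x \<in> S \<Longrightarrow> (f has_derivative f' x) (at x)" "\<And>v. Ck_on (Suc k) S (\<lambda>x. f' x v)"
    by (metis Ck_on.simps(2))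
  then show ?case using Suc.IH Ck_on.simps(2) by metis
qed

lemma Ck_on_const: "Ck_on k S (\<lambda>x. c)"
proof (induction k arbitrary: c)
  case (Suc k)
  then show ?case by (auto intro!: exI[of _ "\<lambda>x v. 0"])
qed simp

lemma Ck_on_linear: "bounded_linear L \<Longrightarrow> Ck_on k S L"
proof (cases k)
  case (Suc l)
  assume "bounded_linear L"
  then show ?thesis
    using Suc by (auto intro!: exI[of _ "\<lambda>x. L"] bounded_linear_imp_has_derivative Ck_on_const)
qed (auto intro: linear_continuous_on)

lemma Ck_on_add: "Ck_on k S f \<Longrightarrow> Ck_on k S g \<Longrightarrow> Ck_on k S (\<lambda>x. f x + g x)"
proof (induction k arbitrary: f g)
  case 0
  then show ?case by (auto intro: continuous_on_add)
next
  case (Suc k)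
  from Suc.prems(1) obtain f' where
    "\<And>x. x \<in> S \<Longrightarrow> (f has_derivative f' x) (at x)" "\<And>v. Ck_on k S (\<lambda>x. f' x v)"
    by auto
  moreover from Suc.prems(2) obtain g' where
    "\<And>x. x \<in> S \<Longrightarrow> (g has_derivative g' x) (at x)" "\<And>v. Ck_on k S (\<lambda>x. g' x v)"
    by auto
  ultimately show ?case
    using Suc.IH by (auto intro!: exI[of _ "\<lambda>x v. f' x v + g' x v"] has_derivative_add)
qed

lemma Ck_on_bounded_linear:
  assumes L: "bounded_linear L"
  shows "Ck_on k S f \<Longrightarrow> Ck_on k S (\<lambda>x. L (f x))"
proof (induction k arbitrary: f)
  case 0
  then show ?case using bounded_linear.continuous_on[OF L] by auto
next
  case (Suc k)
  from Suc.prems obtain f' where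
    "\<And>x. x \<in> S \<Longrightarrow> (f has_derivative f' x) (at x)" "\<And>v. Ck_on k S (\<lambda>x. f' x v)"
    by auto
  then show ?case
    using Suc.IH by (auto intro!: exI[of _ "\<lambda>x v. L (f' x v)"] bounded_linear.has_derivative[OF L])
qed

lemma Ck_on_bilinear:
  assumes B: "bounded_bilinear B"
  shows "Ck_on k S f \<Longrightarrow> Ck_on k S g \<Longrightarrow> Ck_on k S (\<lambda>x. B (f x) (g x))"
proof (induction k arbitrary: f g)
  case 0
  then show ?case using bounded_bilinear.continuous_on[OF B] by auto
next
  case (Suc k)
  from Suc.prems(1) obtain f' where
    f': "\<And>x. x \<in> S \<Longrightarrow> (f has_derivative f' x) (at x)" "\<And>v. Ck_on k S (\<lambda>x. f' x v)"
    by auto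
  from Suc.prems(2) obtain g' where
    g': "\<And>x. x \<in> S \<Longrightarrow> (g has_derivative g' x) (at x)" "\<And>v. Ck_on k S (\<lambda>x. g' x v)"
    by auto
  have "\<forall>x\<in>S. ((\<lambda>x. B (f x) (g x)) has_derivative (\<lambda>h. B (f x) (g' x h) + B (f' x h) (g x))) (at x)"
    using bounded_bilinear.FDERIV[OF B f'(1) g'(1)] by blast
  moreover have "\<forall>v. Ck_on k S (\<lambda>x. B (f x) (g' x v) + B (f' x v) (g x))"
    by (intro allI Ck_on_add Suc.IH f' g' Ck_on_Suc_D[OF Suc.prems(1)] Ck_on_Suc_D[OF Suc.prems(2)])
  ultimately show ?case by (auto intro!: exI[of _ "\<lambda>x v. B (f x) (g' x v) + B (f' x v) (g x)"])
qed

lemma smooth_on_cong: "open S \<Longrightarrow> smooth_on S f \<Longrightarrow> (\<And>x. x \<in> S \<Longrightarrow> f x = g x) \<Longrightarrow> smooth_on S g"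
  unfolding smooth_on_def using Ck_on_cong by blast

lemma smooth_on_subset: "smooth_on S f \<Longrightarrow> T \<subseteq> S \<Longrightarrow> smooth_on T f"
  unfolding smooth_on_def using Ck_on_subset by blast

lemma smooth_on_const [simp]: "smooth_on S (\<lambda>x. c)"
  by (simp add: smooth_on_def Ck_on_const)

lemma smooth_on_linear: "bounded_linear L \<Longrightarrow> smooth_on S L"
  by (simp add: smooth_on_def Ck_on_linear)

lemma smooth_on_id [simp]: "smooth_on S (\<lambda>x. x)"
  by (rule smooth_on_linear) (rule bounded_linear_ident)

lemma smooth_on_add: "smooth_on S f \<Longrightarrow> smooth_on S g \<Longrightarrow> smooth_on S (\<lambda>x. f x + g x)"
  by (simp add: smooth_on_def Ck_on_add)

lemma smooth_on_bounded_linear: "bounded_linear L \<Longrightarrow> smooth_on S f \<Longrightarrow> smooth_on S (\<lambda>x. L (f x))"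
  by (simp add: smooth_on_def Ck_on_bounded_linear)

lemma smooth_on_bilinear:
  "bounded_bilinear B \<Longrightarrow> smooth_on S f \<Longrightarrow> smooth_on S g \<Longrightarrow> smooth_on S (\<lambda>x. B (f x) (g x))"
  by (simp add: smooth_on_def Ck_on_bilinear)

lemma smooth_on_sum:
  assumes "\<And>i. i \<in> I \<Longrightarrow> smooth_on S (f i)"
  shows "smooth_on S (\<lambda>x. \<Sum>i\<in>I. f i x)"
  using assms by (induction I rule: infinite_finite_induct) (auto intro: smooth_on_add)

lemma smooth_on_has_derivative:
  assumes "smooth_on S f" "x \<in> S"
  shows "(f has_derivative frechet_derivative f (at x)) (at x)"
proof -
  have "Ck_on (Suc 0) S f" using assms by (simp add: smooth_on_def del: Ck_on.simps)
  then show ?thesis using assms(2) frechet_derivative_works differentiableI by (metis Ck_on.simps(2))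
qed

text \<open>The definition of \<open>Ck_on\<close> supplies a possibly different derivative for each
  order \<open>k\<close>. Uniqueness of derivatives identifies them all with
  \<open>frechet_derivative\<close>, which thus has every order at once.\<close>

lemma smooth_on_frechet_derivative:
  assumes S: "open S" and f: "smooth_on S f"
  shows "smooth_on S (\<lambda>x. frechet_derivative f (at x) v)"
  unfolding smooth_on_def
proof
  fix k
  have "Ck_on (Suc k) S f" using f by (simp add: smooth_on_def del: Ck_on.simps)
  then obtain f' where f': "\<And>x. x \<in> S \<Longrightarrow> (f has_derivative f' x) (at x)" "\<And>v. Ck_on k S (\<lambda>x. f' x v)"
    by auto
  then have "f' x v = frechet_derivative f (at x) v" if "x \<in> S" for x
    using frechet_derivative_at that by metis
  then show "Ck_on k S (\<lambda>x. frechet_derivative f (at x) v)"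
    using Ck_on_cong[OF S _ f'(2)[of v]] by simp
qed

lemma linear_basis_expansion:
  fixes w :: "'a::euclidean_space"
  assumes "linear L"
  shows "L w = (\<Sum>b\<in>Basis. (w \<bullet> b) *\<^sub>R L b)"
proof -
  have "L w = L (\<Sum>b\<in>Basis. (w \<bullet> b) *\<^sub>R b)" by (simp add: euclidean_representation)
  then show ?thesis by (simp add: linear_sum[OF assms] linear_scale[OF assms])
qed

text \<open>Smoothness of the derivative is available for a fixed direction; expanding the moving
  direction in the basis reduces to that case.\<close>

lemma smooth_on_frechet_derivative_apply:
  fixes f :: "'a::euclidean_space \<Rightarrow> 'b::real_normed_vector"
  assumes S: "open S" and f: "smooth_on S f" and g: "smooth_on S g"
  shows "smooth_on S (\<lambda>x. frechet_derivative f (at x) (g x))"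
proof (rule smooth_on_cong[OF S])
  show "smooth_on S (\<lambda>x. \<Sum>b\<in>Basis. (g x \<bullet> b) *\<^sub>R frechet_derivative f (at x) b)"
    by (intro smooth_on_sum smooth_on_bilinear[OF bounded_bilinear_scaleR]
      smooth_on_bounded_linear[OF bounded_linear_inner_left] g smooth_on_frechet_derivative[OF S f])
  show "(\<Sum>b\<in>Basis. (g x \<bullet> b) *\<^sub>R frechet_derivative f (at x) b) = frechet_derivative f (at x) (g x)"
    if "x \<in> S" for x
    by (rule linear_basis_expansion[OF has_derivative_linear[OF smooth_on_has_derivative[OF f that]], symmetric])
qed

text \<open>The mean value theorem is applied twice: to the difference in direction \<open>v\<close>
  as a function of the step along \<open>u\<close>, then to the derivative along \<open>u\<close> as
  a function of the step along \<open>v\<close>.\<close>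

lemma second_difference_mean_value:
  fixes f :: "'a::euclidean_space \<Rightarrow> real"
  assumes f: "smooth_on (ball x e) f" and h: "h > 0" and small: "h * (norm u + norm v) < e"
  obtains s t where "0 < s" "s < h" "0 < t" "t < h"
    "f (x + h *\<^sub>R u + h *\<^sub>R v) - f (x + h *\<^sub>R u) - f (x + h *\<^sub>R v) + f x
      = h * h * frechet_derivative (\<lambda>y. frechet_derivative f (at y) u) (at (x + s *\<^sub>R u + t *\<^sub>R v)) v"
proof -
  have inb: "x + s *\<^sub>R u + t *\<^sub>R v \<in> ball x e" if "0 \<le> s" "s \<le> h" "0 \<le> t" "t \<le> h" for s t
  proof -
    have "norm (s *\<^sub>R u + t *\<^sub>R v) \<le> s * norm u + t * norm v"
      using norm_triangle_ineq[of "s *\<^sub>R u" "t *\<^sub>R v"] that by simp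
    also have "\<dots> \<le> h * norm u + h * norm v" using that by (intro add_mono mult_right_mono) auto
    also have "\<dots> < e" using small by (simp add: distrib_left)
    finally have "norm (s *\<^sub>R u + t *\<^sub>R v) < e" .
    moreover have "dist x (x + s *\<^sub>R u + t *\<^sub>R v) = norm (s *\<^sub>R u + t *\<^sub>R v)"
      by (metis add.assoc add_diff_cancel_left' dist_commute dist_norm)
    ultimately show ?thesis by simp
  qed
  define fu where "fu y = frechet_derivative f (at y) u" for y
  have fu: "smooth_on (ball x e) fu" unfolding fu_def by (rule smooth_on_frechet_derivative[OF open_ball f])
  have d1: "((\<lambda>s. f (x + s *\<^sub>R u + w)) has_real_derivative fu (x + s *\<^sub>R u + w)) (at s)"
    if "x + s *\<^sub>R u + w \<in> ball x e" for s w
  proof -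
    have "((\<lambda>s. x + s *\<^sub>R u + w) has_derivative (\<lambda>h. h *\<^sub>R u)) (at s)"
      by (auto intro!: derivative_eq_intros)
    from has_derivative_compose[OF this smooth_on_has_derivative[OF f that]]
    show ?thesis
      unfolding has_field_derivative_def fu_def
      using linear_scale[OF has_derivative_linear[OF smooth_on_has_derivative[OF f that]]]
      by (simp add: mult_commute_abs)
  qed
  have d2: "((\<lambda>t. fu (w + t *\<^sub>R v)) has_real_derivative frechet_derivative fu (at (w + t *\<^sub>R v)) v) (at t)"
    if "w + t *\<^sub>R v \<in> ball x e" for t w
  proof -
    have "((\<lambda>t. w + t *\<^sub>R v) has_derivative (\<lambda>h. h *\<^sub>R v)) (at t)"
      by (auto intro!: derivative_eq_intros)
    from has_derivative_compose[OF this smooth_on_has_derivative[OF fu that]]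
    show ?thesis
      unfolding has_field_derivative_def
      using linear_scale[OF has_derivative_linear[OF smooth_on_has_derivative[OF fu that]]]
      by (simp add: mult_commute_abs)
  qed
  define g where "g s = f (x + s *\<^sub>R u + h *\<^sub>R v) - f (x + s *\<^sub>R u + 0)" for s
  have "(g has_real_derivative fu (x + s *\<^sub>R u + h *\<^sub>R v) - fu (x + s *\<^sub>R u + 0)) (at s)"
    if "0 \<le> s" "s \<le> h" for s
    unfolding g_def using inb[of s h] inb[of s 0] that h by (intro DERIV_diff d1) auto
  from MVT2[OF h this] obtain s where s: "0 < s" "s < h"
    "g h - g 0 = (h - 0) * (fu (x + s *\<^sub>R u + h *\<^sub>R v) - fu (x + s *\<^sub>R u + 0))" by auto
  have "((\<lambda>t. fu ((x + s *\<^sub>R u) + t *\<^sub>R v)) has_real_derivative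
      frechet_derivative fu (at ((x + s *\<^sub>R u) + t *\<^sub>R v)) v) (at t)" if "0 \<le> t" "t \<le> h" for t
    using inb[of s t] that s by (intro d2) auto
  from MVT2[OF h this] obtain t where t: "0 < t" "t < h"
    "fu (x + s *\<^sub>R u + h *\<^sub>R v) - fu (x + s *\<^sub>R u + 0 *\<^sub>R v) = (h - 0) * frechet_derivative fu (at (x + s *\<^sub>R u + t *\<^sub>R v)) v"
    by auto
  have "g h - g 0 = h * h * frechet_derivative fu (at (x + s *\<^sub>R u + t *\<^sub>R v)) v"
    using s(3) t(3) by simp
  then show ?thesis using that[OF s(1,2) t(1,2)] unfolding g_def fu_def by simp
qed

text \<open>Schwarz's theorem. The second difference is symmetric in \<open>u\<close> and
  \<open>v\<close>, so the two mixed derivatives agree at intermediate points that tend to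
  \<open>x\<close>, and continuity passes to the limit.\<close>

lemma smooth_on_symmetric_second_derivative_real:
  fixes f :: "'a::euclidean_space \<Rightarrow> real"
  assumes S: "open S" and f: "smooth_on S f" and x: "x \<in> S"
  shows "frechet_derivative (\<lambda>y. frechet_derivative f (at y) u) (at x) v
       = frechet_derivative (\<lambda>y. frechet_derivative f (at y) v) (at x) u" (is "?D u v x = ?D v u x")
proof -
  obtain e where e: "e > 0" "ball x e \<subseteq> S" using S x open_contains_ball by blast
  have cont: "isCont (?D a b) x" for a b
  proof -
    have "smooth_on S (?D a b)"
      by (intro smooth_on_frechet_derivative S f)
    then show ?thesis using smooth_on_has_derivative x has_derivative_continuous by blast
  qed
  have fb: "smooth_on (ball x e) f" using smooth_on_subset[OF f e(2)] .
  \<comment> \<open>The summand 1 keeps the denominator positive when \<open>u\<close> and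
    \<open>v\<close> both vanish.\<close>
  define h where "h n = e / (2 * (norm u + norm v + 1)) / real (Suc n)" for n
  have hp: "h n > 0" for n
    using e(1) norm_ge_zero[of u] norm_ge_zero[of v] by (simp add: h_def add_nonneg_pos)
  have hs: "h n * (norm u + norm v) < e" for n
  proof -
    have N: "norm u + norm v + 1 > 0" using norm_ge_zero[of u] norm_ge_zero[of v] by linarith
    have "h n \<le> e / (2 * (norm u + norm v + 1))"
      unfolding h_def using e(1) N by (simp add: divide_le_eq mult_le_cancel_left1)
    then have "h n * (norm u + norm v) \<le> e / (2 * (norm u + norm v + 1)) * (norm u + norm v + 1)"
      using e(1) N hp[of n] by (intro mult_mono) auto
    also have "\<dots> = e / 2" using N by (simp add: field_simps)
    finally show ?thesis using e(1) by linarith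
  qed
  have h0: "h \<longlonglongrightarrow> 0"
    unfolding h_def by (rule lim_const_over_n[THEN LIMSEQ_Suc])
  have "\<exists>s t s' t'. 0 < s \<and> s < h n \<and> 0 < t \<and> t < h n \<and> 0 < s' \<and> s' < h n \<and> 0 < t' \<and> t' < h n \<and>
      ?D u v (x + s *\<^sub>R u + t *\<^sub>R v) = ?D v u (x + s' *\<^sub>R v + t' *\<^sub>R u)" for n
  proof -
    obtain s t where 1: "0 < s" "s < h n" "0 < t" "t < h n"
      "f (x + h n *\<^sub>R u + h n *\<^sub>R v) - f (x + h n *\<^sub>R u) - f (x + h n *\<^sub>R v) + f x = h n * h n * ?D u v (x + s *\<^sub>R u + t *\<^sub>R v)"
      using second_difference_mean_value[OF fb hp hs] by metis
    have "h n * (norm v + norm u) < e" using hs[of n] by (simp add: add.commute)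
    then obtain s' t' where 2: "0 < s'" "s' < h n" "0 < t'" "t' < h n"
      "f (x + h n *\<^sub>R v + h n *\<^sub>R u) - f (x + h n *\<^sub>R v) - f (x + h n *\<^sub>R u) + f x = h n * h n * ?D v u (x + s' *\<^sub>R v + t' *\<^sub>R u)"
      using second_difference_mean_value[OF fb hp] by metis
    have "f (x + h n *\<^sub>R u + h n *\<^sub>R v) = f (x + h n *\<^sub>R v + h n *\<^sub>R u)"
      by (simp add: add.commute add.left_commute)
    then have "h n * h n * ?D u v (x + s *\<^sub>R u + t *\<^sub>R v) = h n * h n * ?D v u (x + s' *\<^sub>R v + t' *\<^sub>R u)"
      unfolding 1(5)[symmetric] 2(5)[symmetric] by linarith
    then show ?thesis using 1 2 hp[of n] by auto
  qed
  then have ex: "\<forall>n. \<exists>s t s' t'. 0 < s \<and> s < h n \<and> 0 < t \<and> t < h n \<and> 0 < s' \<and> s' < h n \<and> 0 < t' \<and> t' < h n \<and>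
      ?D u v (x + s *\<^sub>R u + t *\<^sub>R v) = ?D v u (x + s' *\<^sub>R v + t' *\<^sub>R u)"
    by blast
  obtain s t s' t' where st: "\<And>n. 0 < s n \<and> s n < h n" "\<And>n. 0 < t n \<and> t n < h n"
      "\<And>n. 0 < s' n \<and> s' n < h n" "\<And>n. 0 < t' n \<and> t' n < h n"
      "\<And>n. ?D u v (x + s n *\<^sub>R u + t n *\<^sub>R v) = ?D v u (x + s' n *\<^sub>R v + t' n *\<^sub>R u)"
    using ex unfolding choice_iff by blast
  have to0: "a \<longlonglongrightarrow> 0" if "\<And>n. 0 < a n \<and> a n < h n" for a :: "nat \<Rightarrow> real"
    by (rule tendsto_sandwich[OF _ _ tendsto_const h0]) (use that in \<open>auto intro!: always_eventually less_imp_le\<close>)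
  have lim: "(\<lambda>n. x + a n *\<^sub>R p + b n *\<^sub>R q) \<longlonglongrightarrow> x" if "a \<longlonglongrightarrow> 0" "b \<longlonglongrightarrow> 0" for a b p q
    using that by (auto intro!: tendsto_eq_intros)
  have "(\<lambda>n. ?D u v (x + s n *\<^sub>R u + t n *\<^sub>R v)) \<longlonglongrightarrow> ?D u v x"
    by (rule isCont_tendsto_compose[OF cont lim[OF to0[OF st(1)] to0[OF st(2)]]])
  moreover have "(\<lambda>n. ?D v u (x + s' n *\<^sub>R v + t' n *\<^sub>R u)) \<longlonglongrightarrow> ?D v u x"
    by (rule isCont_tendsto_compose[OF cont lim[OF to0[OF st(3)] to0[OF st(4)]]])
  ultimately show ?thesis unfolding st(5) by (rule LIMSEQ_unique)
qed

lemma smooth_on_symmetric_second_derivative: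
  fixes f :: "'a::euclidean_space \<Rightarrow> 'b::euclidean_space"
  assumes S: "open S" and f: "smooth_on S f" and x: "x \<in> S"
  shows "frechet_derivative (\<lambda>y. frechet_derivative f (at y) u) (at x) v
       = frechet_derivative (\<lambda>y. frechet_derivative f (at y) v) (at x) u"
proof (rule euclidean_eqI)
  fix b :: 'b
  define fb where "fb y = f y \<bullet> b" for y
  have fb: "smooth_on S fb"
    unfolding fb_def by (rule smooth_on_bounded_linear[OF bounded_linear_inner_left f])
  have d: "frechet_derivative fb (at y) w = frechet_derivative f (at y) w \<bullet> b" if "y \<in> S" for y w
  proof -
    have "(fb has_derivative (\<lambda>w. frechet_derivative f (at y) w \<bullet> b)) (at y)"
      unfolding fb_def
      by (rule bounded_linear.has_derivative[OF bounded_linear_inner_left smooth_on_has_derivative[OF f that]])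
    then show ?thesis using frechet_derivative_at by metis
  qed
  have dd: "frechet_derivative (\<lambda>y. frechet_derivative fb (at y) p) (at x) q
      = frechet_derivative (\<lambda>y. frechet_derivative f (at y) p) (at x) q \<bullet> b" for p q
  proof -
    have "((\<lambda>y. frechet_derivative f (at y) p \<bullet> b) has_derivative
       (\<lambda>q. frechet_derivative (\<lambda>y. frechet_derivative f (at y) p) (at x) q \<bullet> b)) (at x)"
      by (rule bounded_linear.has_derivative[OF bounded_linear_inner_left
            smooth_on_has_derivative[OF smooth_on_frechet_derivative[OF S f] x]])
    then have "((\<lambda>y. frechet_derivative fb (at y) p) has_derivative
       (\<lambda>q. frechet_derivative (\<lambda>y. frechet_derivative f (at y) p) (at x) q \<bullet> b)) (at x)"
      by (rule has_derivative_transform_within_open[OF _ S x]) (simp add: d)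
    then show ?thesis using frechet_derivative_at by metis
  qed
  show "frechet_derivative (\<lambda>y. frechet_derivative f (at y) u) (at x) v \<bullet> b =
        frechet_derivative (\<lambda>y. frechet_derivative f (at y) v) (at x) u \<bullet> b"
    using smooth_on_symmetric_second_derivative_real[OF S fb x, of u v] by (simp add: dd)
qed

section \<open>The Levi-Civita connection of an induced metric\<close>

definition oproj :: "'a::euclidean_space set \<Rightarrow> 'a \<Rightarrow> 'a" where
  "oproj V v = (THE u. u \<in> V \<and> (\<forall>w\<in>V. (v - u) \<bullet> w = 0))"

lemma oproj_eqI:
  assumes "subspace V" "u \<in> V" "\<And>w. w \<in> V \<Longrightarrow> (v - u) \<bullet> w = 0"
  shows "oproj V v = u"
  unfolding oproj_def
proof (rule the_equality)
  fix u' assume u': "u' \<in> V \<and> (\<forall>w\<in>V. (v - u') \<bullet> w = 0)"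
  have "u - u' \<in> V" using assms u' by (auto intro: subspace_diff)
  then have "(v - u') \<bullet> (u - u') = 0" "(v - u) \<bullet> (u - u') = 0" using assms u' by auto
  then have "(u - u') \<bullet> (u - u') = 0" by (simp add: inner_diff_left)
  then show "u' = u" by simp
qed (use assms in auto)

lemma oproj_props:
  assumes "subspace V"
  shows "oproj V v \<in> V" "w \<in> V \<Longrightarrow> (v - oproj V v) \<bullet> w = 0"
proof -
  obtain y z where y: "y \<in> span V" and z: "\<And>w. w \<in> span V \<Longrightarrow> orthogonal z w" "v = y + z"
    using orthogonal_subspace_decomp_exists[of V v] by metis
  have V: "span V = V" using assms by (simp add: span_eq_iff)
  have "oproj V v = y"
    using assms y z by (intro oproj_eqI) (auto simp: V orthogonal_def)
  then show "oproj V v \<in> V" "w \<in> V \<Longrightarrow> (v - oproj V v) \<bullet> w = 0"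
    using y z by (auto simp: V orthogonal_def)
qed

lemma oproj_inner: "subspace V \<Longrightarrow> w \<in> V \<Longrightarrow> oproj V v \<bullet> w = v \<bullet> w"
  using oproj_props(2)[of V w v] by (simp add: inner_diff_left)

lemma oproj_id: "subspace V \<Longrightarrow> v \<in> V \<Longrightarrow> oproj V v = v"
  by (rule oproj_eqI) auto

lemma oproj_linear: "subspace V \<Longrightarrow> linear (oproj V)"
  by (rule linearI; rule oproj_eqI)
    (auto simp: oproj_props oproj_inner subspace_add subspace_scale inner_diff_left inner_add_left)

lemma oproj_bounded_linear: "subspace V \<Longrightarrow> bounded_linear (oproj V)"
  by (simp add: oproj_linear linear_conv_bounded_linear[symmetric])

section \<open>Smooth maps on subsets and their differentials\<close>

lemma smooth_mapI: "smooth_on UNIV F \<Longrightarrow> smooth_map N F"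
  unfolding smooth_map_def by (auto intro!: exI[of _ UNIV] exI[of _ F])

lemma smooth_mapE:
  assumes "smooth_map N f" "x \<in> N"
  obtains U F where "open U" "x \<in> U" "smooth_on U F" "\<And>y. y \<in> N \<Longrightarrow> y \<in> U \<Longrightarrow> F y = f y"
proof -
  obtain U F where "open U \<and> x \<in> U \<and> smooth_on U F \<and> (\<forall>y\<in>N \<inter> U. F y = f y)"
    using bspec[OF assms(1)[unfolded smooth_map_def] assms(2)] by (elim exE)
  then show ?thesis using that[of U F] by simp
qed

lemma smooth_map_const [simp]: "smooth_map N (\<lambda>x. c)"
  by (rule smooth_mapI) simp

lemma smooth_map_id [simp]: "smooth_map N (\<lambda>x. x)"
  by (rule smooth_mapI) simp

text \<open>\<open>B\<close> stands for any operation that preserves smoothness on open sets. Sums,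
  bilinear products and, with the second argument ignored, linear images thus share one argument
  about intersecting the domains of the local extensions.\<close>

lemma smooth_map_combine:
  fixes f :: "'a::euclidean_space \<Rightarrow> 'b::real_normed_vector" and g :: "'a \<Rightarrow> 'c::real_normed_vector"
    and B :: "'b \<Rightarrow> 'c \<Rightarrow> 'd::real_normed_vector"
  assumes "\<And>(U :: 'a set) F G. open U \<Longrightarrow> smooth_on U F \<Longrightarrow> smooth_on U G \<Longrightarrow> smooth_on U (\<lambda>y. B (F y) (G y))"
    and "smooth_map N f" "smooth_map N g"
  shows "smooth_map N (\<lambda>x. B (f x) (g x))"
  unfolding smooth_map_def
proof
  fix x assume x: "x \<in> N"
  obtain U F where U: "open U" "x \<in> U" "smooth_on U F" "\<And>y. y \<in> N \<Longrightarrow> y \<in> U \<Longrightarrow> F y = f y"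
    using smooth_mapE[OF assms(2) x] by blast
  obtain V G where V: "open V" "x \<in> V" "smooth_on V G" "\<And>y. y \<in> N \<Longrightarrow> y \<in> V \<Longrightarrow> G y = g y"
    using smooth_mapE[OF assms(3) x] by blast
  have "smooth_on (U \<inter> V) (\<lambda>y. B (F y) (G y))"
    using U V smooth_on_subset[of U F "U \<inter> V"] smooth_on_subset[of V G "U \<inter> V"]
    by (intro assms(1)[of "U \<inter> V" F G]) auto
  then show "\<exists>W H. open W \<and> x \<in> W \<and> smooth_on W H \<and> (\<forall>y\<in>N \<inter> W. H y = B (f y) (g y))"
    using U V by (intro exI[of _ "U \<inter> V"] exI[of _ "\<lambda>y. B (F y) (G y)"]) auto
qed

lemma smooth_map_bilinear:
  "bounded_bilinear B \<Longrightarrow> smooth_map N f \<Longrightarrow> smooth_map N g \<Longrightarrow> smooth_map N (\<lambda>x. B (f x) (g x))"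
  by (rule smooth_map_combine) (auto intro: smooth_on_bilinear)

lemma smooth_map_add: "smooth_map N f \<Longrightarrow> smooth_map N g \<Longrightarrow> smooth_map N (\<lambda>x. f x + g x)"
  by (rule smooth_map_combine) (auto intro: smooth_on_add)

lemma smooth_map_bounded_linear:
  "bounded_linear L \<Longrightarrow> smooth_map N f \<Longrightarrow> smooth_map N (\<lambda>x. L (f x))"
  by (rule smooth_map_combine[where B = "\<lambda>u v. L u" and g = f]) (auto intro: smooth_on_bounded_linear)

lemma smooth_map_diff: "smooth_map N f \<Longrightarrow> smooth_map N g \<Longrightarrow> smooth_map N (\<lambda>x. f x - g x)"
  using smooth_map_add[of N f "\<lambda>x. - g x"] smooth_map_bounded_linear[OF bounded_linear_minus[OF bounded_linear_ident], of N g]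
  by simp

lemma local_extension_has_derivative:
  assumes "open U" "smooth_on U F" "\<And>y. y \<in> N \<Longrightarrow> y \<in> U \<Longrightarrow> F y = f y" "x \<in> N" "x \<in> U"
  shows "(f has_derivative frechet_derivative F (at x)) (at x within N)"
proof -
  have "(F has_derivative frechet_derivative F (at x)) (at x within N)"
    using smooth_on_has_derivative[OF assms(2,5)] has_derivative_at_withinI by blast
  moreover obtain e where "e > 0" "ball x e \<subseteq> U" using assms(1,5) open_contains_ball by blast
  ultimately show ?thesis
    using assms by (elim has_derivative_transform_within[where d = e]) (auto simp: dist_commute subset_iff)
qed

lemma smooth_map_has_derivative:
  assumes "smooth_map N f" "x \<in> N"
  shows "(f has_derivative frechet_derivative f (at x within N)) (at x within N)"
proof -
  obtain U F where "open U" "x \<in> U" "smooth_on U F" "\<And>y. y \<in> N \<Longrightarrow> y \<in> U \<Longrightarrow> F y = f y"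
    using smooth_mapE[OF assms] by blast
  then have "f differentiable (at x within N)"
    using differentiableI[OF local_extension_has_derivative[of U F N f x]] assms(2) by simp
  then show ?thesis by (rule frechet_derivative_works[THEN iffD1])
qed

lemma has_vector_derivative_along_curve:
  fixes x :: "'a::real_normed_vector"
  assumes f: "(f has_derivative f') (at x within N)" and e: "\<epsilon> > 0"
    and c: "\<And>t. t \<in> {-\<epsilon><..<\<epsilon>} \<Longrightarrow> \<gamma> t \<in> N" "\<gamma> 0 = x"
    and d: "(\<gamma> has_vector_derivative v) (at (0::real))"
  shows "((\<lambda>t. f (\<gamma> t)) has_vector_derivative f' v) (at 0)"
proof -
  let ?T = "{-\<epsilon><..<\<epsilon>}"
  have T: "open ?T" "0 \<in> ?T" using e by auto
  have "(\<gamma> has_derivative (\<lambda>h. h *\<^sub>R v)) (at 0 within ?T)"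
    using d has_derivative_at_withinI unfolding has_vector_derivative_def by blast
  moreover have "(f has_derivative f') (at x within \<gamma> ` ?T)"
    using c(1) by (intro has_derivative_subset[OF f]) auto
  then have "(f has_derivative f') (at (\<gamma> 0) within \<gamma> ` ?T)"
    by (simp add: c(2))
  ultimately have "((f \<circ> \<gamma>) has_derivative (f' \<circ> (\<lambda>h. h *\<^sub>R v))) (at 0 within ?T)"
    by (rule diff_chain_within)
  then have "((f \<circ> \<gamma>) has_derivative (f' \<circ> (\<lambda>h. h *\<^sub>R v))) (at 0)"
    using at_within_open[OF T(2,1)] by simp
  then show ?thesis
    using linear_scale[OF has_derivative_linear[OF f]] by (simp add: has_vector_derivative_def o_def)
qed

lemma tangent_spaceE:
  assumes "v \<in> tangent_space N x"
  obtains \<gamma> \<epsilon> where "\<epsilon> > 0" "\<And>t. t \<in> {-\<epsilon><..<\<epsilon>} \<Longrightarrow> \<gamma> t \<in> N" "\<gamma> 0 = x"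
    "(\<gamma> has_vector_derivative v) (at (0::real))"
proof -
  obtain \<gamma> \<epsilon> where "\<epsilon> > 0 \<and> smooth_on {-\<epsilon><..<\<epsilon>} \<gamma> \<and> (\<forall>t\<in>{-\<epsilon><..<\<epsilon>}. \<gamma> t \<in> N)
      \<and> \<gamma> 0 = x \<and> (\<gamma> has_vector_derivative v) (at (0::real))"
    using assms unfolding tangent_space_def by blast
  then show ?thesis using that[of \<epsilon> \<gamma>] by blast
qed

text \<open>The device for differentiating identities that hold only on \<open>N\<close>: functions
  that agree on \<open>N\<close> have the same derivative on tangent vectors. In particular, a
  function that is constant on an orbit yields an equation for the tangent vectors of the
  orbit.\<close>

lemma differential_eq:
  assumes f: "(f has_derivative f') (at x within N)" and v: "v \<in> tangent_space N x"
  shows "differential N f x v = f' v"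
proof -
  obtain \<gamma> \<epsilon> where c: "\<epsilon> > 0" "\<And>t. t \<in> {-\<epsilon><..<\<epsilon>} \<Longrightarrow> \<gamma> t \<in> N" "\<gamma> 0 = x"
    "(\<gamma> has_vector_derivative v) (at (0::real))" using tangent_spaceE[OF v] by blast
  have g: "(f has_derivative frechet_derivative f (at x within N)) (at x within N)"
    using f differentiableI frechet_derivative_works by blast
  show ?thesis
    by (rule vector_derivative_unique_at[OF has_vector_derivative_along_curve[OF g c]
          has_vector_derivative_along_curve[OF f c]])
qed

text \<open>Applying the derivative of a local extension of \<open>Y\<close> to a local extension of
  \<open>X\<close> gives a smooth function. It agrees with the intrinsic differential on
  \<open>N\<close> because \<open>X y\<close> is tangent there.\<close>

lemma smooth_map_differential:
  fixes N :: "'a::euclidean_space set" and Y :: "'a \<Rightarrow> 'b::euclidean_space"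
  assumes Y: "smooth_map N Y" and X: "X \<in> vector_fields N"
  shows "smooth_map N (\<lambda>y. differential N Y y (X y))"
  unfolding smooth_map_def
proof
  fix x assume x: "x \<in> N"
  obtain U F where U: "open U" "x \<in> U" "smooth_on U F" "\<And>y. y \<in> N \<Longrightarrow> y \<in> U \<Longrightarrow> F y = Y y"
    using smooth_mapE[OF Y x] by blast
  have X': "smooth_map N X" using X by (simp add: vector_fields_def)
  obtain V G where V: "open V" "x \<in> V" "smooth_on V G" "\<And>y. y \<in> N \<Longrightarrow> y \<in> V \<Longrightarrow> G y = X y"
    using smooth_mapE[OF X' x] by blast
  have "smooth_on (U \<inter> V) (\<lambda>y. frechet_derivative F (at y) (G y))"
    using U V smooth_on_subset[of U F "U \<inter> V"] smooth_on_subset[of V G "U \<inter> V"]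
    by (intro smooth_on_frechet_derivative_apply) auto
  moreover have "frechet_derivative F (at y) (G y) = differential N Y y (X y)" if "y \<in> N \<inter> (U \<inter> V)" for y
    using that U V X differential_eq[OF local_extension_has_derivative[OF U(1,3,4)]]
    by (simp add: vector_fields_def)
  ultimately show "\<exists>W H. open W \<and> x \<in> W \<and> smooth_on W H \<and> (\<forall>y\<in>N \<inter> W. H y = differential N Y y (X y))"
    using U V by (intro exI[of _ "U \<inter> V"] exI[of _ "\<lambda>y. frechet_derivative F (at y) (G y)"]) auto
qed

lemma vector_fieldsD:
  assumes "X \<in> vector_fields N"
  shows "smooth_map N X" "x \<in> N \<Longrightarrow> X x \<in> tangent_space N x"
  using assms by (auto simp: vector_fields_def)

lemma is_levi_civitaD:
  assumes "is_levi_civita N g D" "X \<in> vector_fields N" "Y \<in> vector_fields N"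
  shows "D X Y \<in> vector_fields N"
    and "x \<in> N \<Longrightarrow> D X Y x - D Y X x = lie_bracket N X Y x"
    and "Z \<in> vector_fields N \<Longrightarrow> x \<in> N \<Longrightarrow>
      differential N (\<lambda>y. g y (Y y) (Z y)) x (X x) = g x (D X Y x) (Z x) + g x (Y x) (D X Z x)"
  using assms unfolding is_levi_civita_def by blast+

text \<open>On a submanifold with a multiple of the induced metric, the Levi-Civita connection is the
  tangential part of the ambient derivative.\<close>

locale induced_metric =
  fixes N :: "'a::euclidean_space set" and g :: "'a \<Rightarrow> 'a \<Rightarrow> 'a \<Rightarrow> real"
    and P :: "'a \<Rightarrow> 'a \<Rightarrow> 'a" and \<kappa> :: real
  assumes \<kappa>: "\<kappa> > 0"
    and g: "x \<in> N \<Longrightarrow> u \<in> tangent_space N x \<Longrightarrow> v \<in> tangent_space N x \<Longrightarrow> g x u v = \<kappa> * (u \<bullet> v)"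
    and P_linear: "x \<in> N \<Longrightarrow> linear (P x)"
    and P_in: "x \<in> N \<Longrightarrow> P x v \<in> tangent_space N x"
    and P_id: "x \<in> N \<Longrightarrow> v \<in> tangent_space N x \<Longrightarrow> P x v = v"
    and P_inner: "x \<in> N \<Longrightarrow> u \<in> tangent_space N x \<Longrightarrow> P x v \<bullet> u = v \<bullet> u"
    and P_smooth: "smooth_map N V \<Longrightarrow> smooth_map N (\<lambda>y. P y (V y))"
    and bracket_in: "X \<in> vector_fields N \<Longrightarrow> Y \<in> vector_fields N \<Longrightarrow> x \<in> N
      \<Longrightarrow> lie_bracket N X Y x \<in> tangent_space N x"
begin

lemma subspace_tangent: "x \<in> N \<Longrightarrow> subspace (tangent_space N x)"
  using P_in P_id linear_0[OF P_linear] linear_add[OF P_linear] linear_scale[OF P_linear]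
  by (intro subspaceI) metis+

lemma vector_fields_diff: "X \<in> vector_fields N \<Longrightarrow> Y \<in> vector_fields N \<Longrightarrow> (\<lambda>y. X y - Y y) \<in> vector_fields N"
  by (auto simp: vector_fields_def intro: smooth_map_diff subspace_diff[OF subspace_tangent])

definition nabla :: "('a \<Rightarrow> 'a) \<Rightarrow> ('a \<Rightarrow> 'a) \<Rightarrow> 'a \<Rightarrow> 'a" where
  "nabla X Y x = P x (differential N Y x (X x))"

lemma nabla_vector_field:
  assumes "X \<in> vector_fields N" "Y \<in> vector_fields N"
  shows "nabla X Y \<in> vector_fields N"
  unfolding vector_fields_def nabla_def
  using assms by (auto intro!: P_smooth smooth_map_differential P_in dest: vector_fieldsD(1))

text \<open>The ambient derivative obeys all the rules except tangency, which \<open>P\<close>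
  restores. Torsion-freeness survives because the bracket is already tangent, metric compatibility
  because \<open>P\<close> does not change inner products with tangent vectors.\<close>

lemma is_levi_civita_nabla: "is_levi_civita N g nabla"
  unfolding is_levi_civita_def
proof (intro conjI ballI allI impI)
  fix X Y assume XY: "X \<in> vector_fields N" "Y \<in> vector_fields N"
  then show "nabla X Y \<in> vector_fields N" by (rule nabla_vector_field)
  fix x assume x: "x \<in> N"
  note dX = smooth_map_has_derivative[OF vector_fieldsD(1)[OF XY(1)] x]
  note dY = smooth_map_has_derivative[OF vector_fieldsD(1)[OF XY(2)] x]
  show "nabla X Y x - nabla Y X x = lie_bracket N X Y x"
    using P_id[OF x bracket_in[OF XY x]]
    by (simp add: nabla_def lie_bracket_def linear_diff[OF P_linear[OF x]])
  {
    fix f :: "'a \<Rightarrow> real" assume f: "smooth_map N f"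
    note df = smooth_map_has_derivative[OF f x]
    show "nabla (\<lambda>y. f y *\<^sub>R X y) Y x = f x *\<^sub>R nabla X Y x"
      by (simp add: nabla_def linear_scale[OF P_linear[OF x]] linear_scale[OF has_derivative_linear[OF dY]])
    have "differential N (\<lambda>y. f y *\<^sub>R Y y) x (X x)
        = f x *\<^sub>R differential N Y x (X x) + differential N f x (X x) *\<^sub>R Y x"
      by (rule differential_eq[OF has_derivative_scaleR[OF df dY] vector_fieldsD(2)[OF XY(1) x]])
    then show "nabla X (\<lambda>y. f y *\<^sub>R Y y) x = f x *\<^sub>R nabla X Y x + differential N f x (X x) *\<^sub>R Y x"
      using P_id[OF x vector_fieldsD(2)[OF XY(2) x]]
      by (simp add: nabla_def linear_scale[OF P_linear[OF x]] linear_add[OF P_linear[OF x]])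
  }
  fix Z assume Z: "Z \<in> vector_fields N"
  note dZ = smooth_map_has_derivative[OF vector_fieldsD(1)[OF Z] x]
  show "nabla (\<lambda>y. X y + Y y) Z x = nabla X Z x + nabla Y Z x"
    by (simp add: nabla_def linear_add[OF P_linear[OF x]] linear_add[OF has_derivative_linear[OF dZ]])
  show "nabla X (\<lambda>y. Y y + Z y) x = nabla X Y x + nabla X Z x"
    using differential_eq[OF has_derivative_add[OF dY dZ] vector_fieldsD(2)[OF XY(1) x]]
    by (simp add: nabla_def linear_add[OF P_linear[OF x]])
  have "((\<lambda>y. \<kappa> * (Y y \<bullet> Z y)) has_derivative
      (\<lambda>h. \<kappa> * (Y x \<bullet> differential N Z x h + differential N Y x h \<bullet> Z x))) (at x within N)"
    by (intro has_derivative_mult_right has_derivative_inner dY dZ)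
  then have "((\<lambda>y. g y (Y y) (Z y)) has_derivative
      (\<lambda>h. \<kappa> * (Y x \<bullet> differential N Z x h + differential N Y x h \<bullet> Z x))) (at x within N)"
    by (rule has_derivative_transform[OF x, rotated]) (simp add: g vector_fieldsD XY Z)
  from differential_eq[OF this vector_fieldsD(2)[OF XY(1) x]]
  show "differential N (\<lambda>y. g y (Y y) (Z y)) x (X x) = g x (nabla X Y x) (Z x) + g x (Y x) (nabla X Z x)"
    using P_inner[OF x vector_fieldsD(2)[OF Z x]] P_inner[OF x vector_fieldsD(2)[OF XY(2) x]]
    by (simp add: nabla_def g x P_in vector_fieldsD XY Z inner_commute[of "Y x"] algebra_simps)
qed

text \<open>The difference of two connections is symmetric by torsion-freeness and skew by
  compatibility with the metric, hence zero.\<close>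

lemma levi_civita_unique:
  assumes D: "is_levi_civita N g D" and XY: "X \<in> vector_fields N" "Y \<in> vector_fields N" and x: "x \<in> N"
  shows "D X Y x = nabla X Y x"
proof -
  define S where "S A B y = D A B y - nabla A B y" for A B y
  let ?V = "vector_fields N"
  have DV: "D A B \<in> ?V" if "A \<in> ?V" "B \<in> ?V" for A B
    using is_levi_civitaD(1)[OF D that] .
  have SV: "S A B \<in> ?V" if "A \<in> ?V" "B \<in> ?V" for A B
    unfolding S_def using vector_fields_diff[OF DV nabla_vector_field] that by simp
  have sym: "S A B x = S B A x" if "A \<in> ?V" "B \<in> ?V" for A B
  proof -
    have "D A B x - D B A x = nabla A B x - nabla B A x"
      using is_levi_civitaD(2)[OF D that x] is_levi_civitaD(2)[OF is_levi_civita_nabla that x] by simp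
    then show ?thesis unfolding S_def by (simp add: algebra_simps)
  qed
  have skew: "S A B x \<bullet> C x = - (S A C x \<bullet> B x)" if V: "A \<in> ?V" "B \<in> ?V" "C \<in> ?V" for A B C
  proof -
    have "g x (D A B x) (C x) + g x (B x) (D A C x) = g x (nabla A B x) (C x) + g x (B x) (nabla A C x)"
      using is_levi_civitaD(3)[OF D V x] is_levi_civitaD(3)[OF is_levi_civita_nabla V x] by simp
    then have "\<kappa> * (S A B x \<bullet> C x + B x \<bullet> S A C x) = 0"
      by (simp add: g x vector_fieldsD V DV nabla_vector_field S_def inner_diff_left inner_diff_right algebra_simps)
    then show ?thesis using \<kappa> by (simp add: inner_commute)
  qed
  have "S A B x \<bullet> C x = 0" if V: "A \<in> ?V" "B \<in> ?V" "C \<in> ?V" for A B C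
    using skew[OF V(1) V(2) V(3)] skew[OF V(3) V(1) V(2)] skew[OF V(2) V(3) V(1)]
      sym[OF V(1) V(2)] sym[OF V(1) V(3)] sym[OF V(2) V(3)] by simp
  from this[OF XY SV[OF XY]] show ?thesis by (simp add: S_def)
qed

lemma levi_civita_eq_nabla:
  assumes "X \<in> vector_fields N" "Y \<in> vector_fields N" "x \<in> N"
  shows "levi_civita N g X Y x = P x (differential N Y x (X x))"
  using levi_civita_unique[OF _ assms, of "levi_civita N g"] someI[of "is_levi_civita N g", OF is_levi_civita_nabla]
  by (simp add: levi_civita_def nabla_def)

end

section \<open>Derivations of the octonions\<close>

lemma UNIV_8: "(UNIV :: 8 set) = {0,1,2,3,4,5,6,7}"
proof -
  have "x \<in> {0,1,2,3,4,5,6,7}" for x :: 8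
  proof (cases x)
    case (of_int z)
    then have "z \<in> {0,1,2,3,4,5,6,7}" by auto
    then show ?thesis using of_int by auto
  qed
  then show ?thesis by auto
qed

lemma forall_8: "(\<forall>i::8. P i) \<longleftrightarrow> P 0 \<and> P 1 \<and> P 2 \<and> P 3 \<and> P 4 \<and> P 5 \<and> P 6 \<and> P 7"
  by (metis UNIV_8 UNIV_I insertE singletonD)

lemma sum_8: "sum f (UNIV::8 set) = f 0 + f 1 + f 2 + f 3 + f 4 + f 5 + f 6 + f 7"
  for f :: "8 \<Rightarrow> 'a::comm_monoid_add"
  unfolding UNIV_8 by (simp add: add.assoc)

lemma oct_mult_components:
  "oct_mult x y $ 0 = x$0*y$0 - x$1*y$1 - x$2*y$2 - x$3*y$3 - x$4*y$4 - x$5*y$5 - x$6*y$6 - x$7*y$7"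
  "oct_mult x y $ 1 = x$0*y$1 + x$1*y$0 + x$2*y$3 - x$3*y$2 + x$4*y$5 - x$5*y$4 + x$6*y$7 - x$7*y$6"
  "oct_mult x y $ 2 = x$0*y$2 + x$2*y$0 + x$3*y$1 - x$1*y$3 + x$5*y$7 - x$7*y$5 + x$6*y$4 - x$4*y$6"
  "oct_mult x y $ 3 = x$0*y$3 + x$3*y$0 + x$1*y$2 - x$2*y$1 + x$4*y$7 - x$7*y$4 + x$5*y$6 - x$6*y$5"
  "oct_mult x y $ 4 = x$0*y$4 + x$4*y$0 + x$2*y$6 - x$6*y$2 + x$5*y$1 - x$1*y$5 + x$7*y$3 - x$3*y$7"
  "oct_mult x y $ 5 = x$0*y$5 + x$5*y$0 + x$1*y$4 - x$4*y$1 + x$6*y$3 - x$3*y$6 + x$7*y$2 - x$2*y$7"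
  "oct_mult x y $ 6 = x$0*y$6 + x$6*y$0 + x$3*y$5 - x$5*y$3 + x$4*y$2 - x$2*y$4 + x$7*y$1 - x$1*y$7"
  "oct_mult x y $ 7 = x$0*y$7 + x$7*y$0 + x$1*y$6 - x$6*y$1 + x$2*y$5 - x$5*y$2 + x$3*y$4 - x$4*y$3"
  by (simp_all add: oct_mult_def sum_8 oct_coeff_def oct_cyclic_def oct_triples_def)

lemma matrix_vector_mult_8:
  "((A::real^8^8) *v x) $ k = A$k$0*x$0 + A$k$1*x$1 + A$k$2*x$2 + A$k$3*x$3 + A$k$4*x$4 + A$k$5*x$5 + A$k$6*x$6 + A$k$7*x$7"
  by (simp add: matrix_vector_mult_def sum_8)

lemma matrix_mult_8:
  "((A::real^8^8) ** B) $ k $ l = A$k$0*B$0$l + A$k$1*B$1$l + A$k$2*B$2$l + A$k$3*B$3$l + A$k$4*B$4$l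
     + A$k$5*B$5$l + A$k$6*B$6$l + A$k$7*B$7$l"
  by (simp add: matrix_matrix_mult_def sum_8)

lemma oct_mult_0: "oct_mult x y $ 0 = 2 * x$0 * y$0 - x \<bullet> y"
  by (simp add: oct_mult_components inner_vec_def sum_8)

definition oct_der :: "(real^8^8) set" where
  "oct_der = {A. \<forall>x y. A *v oct_mult x y = oct_mult (A *v x) y + oct_mult x (A *v y)}"

lemma oct_der_at:
  assumes "A \<in> oct_der"
  shows "A$k$0 * oct_mult (axis i 1) (axis j 1) $ 0 + A$k$1 * oct_mult (axis i 1) (axis j 1) $ 1
       + A$k$2 * oct_mult (axis i 1) (axis j 1) $ 2 + A$k$3 * oct_mult (axis i 1) (axis j 1) $ 3
       + A$k$4 * oct_mult (axis i 1) (axis j 1) $ 4 + A$k$5 * oct_mult (axis i 1) (axis j 1) $ 5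
       + A$k$6 * oct_mult (axis i 1) (axis j 1) $ 6 + A$k$7 * oct_mult (axis i 1) (axis j 1) $ 7
     = oct_mult (A *v axis i 1) (axis j 1) $ k + oct_mult (axis i 1) (A *v axis j 1) $ k"
  using assms
  by (simp add: oct_der_def flip: matrix_vector_mult_8)

lemma matrix_vector_mult_axis_nth: "((A::real^8^8) *v axis i 1) $ k = A $ k $ i"
  by (simp add: matrix_vector_mult_basis column_def)

lemma axis_nth_if: "axis i (1::real) $ k = (if i = k then 1 else 0)"
  by (auto simp: axis_def)

lemmas oct_entry_simps = oct_mult_components matrix_vector_mult_axis_nth axis_nth_if

text \<open>Products with \<open>e_0\<close> kill the first column and the squares of the imaginary
  units the first row. The real part of a product of imaginary octonions is minus their inner
  product, which gives skewness. One further relation per imaginary unit cuts the 21 skew entries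
  down to 14.\<close>

lemma oct_der_entries:
  assumes A: "A \<in> oct_der"
  shows "A$i$0 = 0" "A$0$i = 0" "A$j$i = - A$i$j"
    and "A$6$7 = - A$2$3 - A$4$5"
    and "A$6$4 = - A$3$1 - A$5$7"
    and "A$5$6 = - A$1$2 - A$4$7"
    and "A$7$3 = - A$2$6 - A$5$1"
    and "A$7$2 = - A$1$4 - A$6$3"
    and "A$7$1 = - A$3$5 - A$4$2"
    and "A$3$4 = - A$1$6 - A$2$5"
proof -
  note D = oct_der_at[OF A]
  have c: "\<forall>i. A$i$0 = 0"
    unfolding forall_8
    using D[of 0 0 0] D[of 0 0 1] D[of 0 0 2] D[of 0 0 3] D[of 0 0 4] D[of 0 0 5] D[of 0 0 6] D[of 0 0 7]
    by (simp add: oct_entry_simps)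
  have s: "\<forall>i j. A$j$i = - A$i$j"
  proof -
    have r: "\<forall>j. A$0$j = 0"
      unfolding forall_8
      using c[unfolded forall_8] D[of 1 1 1] D[of 2 2 2] D[of 3 3 3] D[of 4 4 4] D[of 5 5 5] D[of 6 6 6] D[of 7 7 7]
      by (simp add: oct_entry_simps)
    have "A$j$i + A$i$j = 0" if "i \<noteq> 0" "j \<noteq> 0" for i j
    proof -
      have ax: "axis k (1::real) $ 0 = 0" if "k \<noteq> 0" for k :: 8
        using that by (simp add: axis_def)
      have "(A *v oct_mult (axis i 1) (axis j 1)) $ 0 = 0"
        using r by (simp add: matrix_vector_mult_def)
      then have "oct_mult (A *v axis i 1) (axis j 1) $ 0 + oct_mult (axis i 1) (A *v axis j 1) $ 0 = 0"
        using A by (simp add: oct_der_def)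
      then have "- (A *v axis i 1) $ j - (A *v axis j 1) $ i = 0"
        using that ax by (simp add: oct_mult_0 inner_axis inner_axis')
      then show ?thesis by (simp add: matrix_vector_mult_basis column_def)
    qed
    then show ?thesis using r c by (metis add.inverse_neutral eq_neg_iff_add_eq_0)
  qed
  show "A$i$0 = 0" "A$j$i = - A$i$j" using c s by blast+
  show "A$0$i = 0" using c s by (metis neg_equal_0_iff_equal)
  note ss = s[rule_format]
  \<comment> \<open>Each of these relations is one coordinate of the derivation rule for a product
    of two imaginary units, rewritten by skewness.\<close>
  show "A$6$7 = - A$2$3 - A$4$5"
    using D[of 2 4 7] ss[of 2 3] ss[of 4 5] ss[of 6 7] by (simp add: oct_entry_simps)
  show "A$6$4 = - A$3$1 - A$5$7"
    using D[of 3 5 4] ss[of 3 1] ss[of 5 7] ss[of 6 4] by (simp add: oct_entry_simps)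
  show "A$5$6 = - A$1$2 - A$4$7"
    using D[of 1 4 6] ss[of 1 2] ss[of 4 7] ss[of 5 6] by (simp add: oct_entry_simps)
  show "A$7$3 = - A$2$6 - A$5$1"
    using D[of 2 5 3] ss[of 2 6] ss[of 5 1] ss[of 7 3] by (simp add: oct_entry_simps)
  show "A$7$2 = - A$1$4 - A$6$3"
    using D[of 1 6 2] ss[of 1 4] ss[of 6 3] ss[of 7 2] by (simp add: oct_entry_simps)
  show "A$7$1 = - A$3$5 - A$4$2"
    using D[of 3 4 1] ss[of 3 5] ss[of 4 2] ss[of 7 1] by (simp add: oct_entry_simps)
  show "A$3$4 = - A$1$6 - A$2$5"
    using D[of 1 2 4] ss[of 1 6] ss[of 2 5] ss[of 3 4] by (simp add: oct_entry_simps)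
qed

lemma oct_derI:
  assumes c: "\<And>i. A$i$0 = 0" and s: "\<And>i j. A$j$i = - A$i$j"
    and rel: "A$6$7 = - A$2$3 - A$4$5"
      "A$6$4 = - A$3$1 - A$5$7"
      "A$5$6 = - A$1$2 - A$4$7"
      "A$7$3 = - A$2$6 - A$5$1"
      "A$7$2 = - A$1$4 - A$6$3"
      "A$7$1 = - A$3$5 - A$4$2"
      "A$3$4 = - A$1$6 - A$2$5"
  shows "A \<in> oct_der"
proof -
  have d: "A$i$i = 0" for i using s[of i i] by simp
  have z: "A$0$i = 0" for i using c s by (metis add.inverse_neutral)
  note n = s[of 3 2] s[of 5 4] s[of 7 6] s[of 1 3] s[of 7 5] s[of 4 6] s[of 2 1] s[of 7 4] s[of 6 5]
    s[of 6 2] s[of 1 5] s[of 3 7] s[of 4 1] s[of 3 6] s[of 2 7] s[of 5 3] s[of 2 4] s[of 1 7]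
    s[of 6 1] s[of 5 2] s[of 4 3]
  have "\<forall>k. (A *v oct_mult x y) $ k = (oct_mult (A *v x) y + oct_mult x (A *v y)) $ k" for x y
    unfolding forall_8 matrix_vector_mult_8 oct_mult_components vector_add_component
    by (simp only: c z d n rel, intro conjI; algebra)
  then show ?thesis unfolding oct_der_def by (simp add: vec_eq_iff)
qed

text \<open>Used as rewrite rules, these equations reduce every entry to the fourteen free ones that
  \<open>oct_der_frame\<close> reads off. Trace and shape computations then become polynomial
  identities in independent variables.\<close>

lemma oct_der_normalize:
  assumes A: "A \<in> oct_der"
  shows "A$i$0 = 0" "A$0$i = 0" "A$i$i = 0"
    and "A$3$2 = - A$2$3"
    "A$5$4 = - A$4$5"
    "A$6$7 = - A$2$3 - A$4$5"
    "A$7$6 = A$2$3 + A$4$5"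
    "A$1$3 = - A$3$1"
    "A$7$5 = - A$5$7"
    "A$6$4 = - A$3$1 - A$5$7"
    "A$4$6 = A$3$1 + A$5$7"
    "A$2$1 = - A$1$2"
    "A$7$4 = - A$4$7"
    "A$5$6 = - A$1$2 - A$4$7"
    "A$6$5 = A$1$2 + A$4$7"
    "A$6$2 = - A$2$6"
    "A$1$5 = - A$5$1"
    "A$7$3 = - A$2$6 - A$5$1"
    "A$3$7 = A$2$6 + A$5$1"
    "A$4$1 = - A$1$4"
    "A$3$6 = - A$6$3"
    "A$7$2 = - A$1$4 - A$6$3"
    "A$2$7 = A$1$4 + A$6$3"
    "A$5$3 = - A$3$5"
    "A$1$7 = - A$7$1"
    "A$4$2 = - A$7$1 - A$3$5"
    "A$2$4 = A$7$1 + A$3$5"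
    "A$6$1 = - A$1$6"
    "A$5$2 = - A$2$5"
    "A$3$4 = - A$1$6 - A$2$5"
    "A$4$3 = A$1$6 + A$2$5"
proof -
  note e = oct_der_entries[OF A]
  show "A$i$0 = 0" "A$0$i = 0" "A$i$i = 0" using e(1,2) e(3)[of i i] by simp_all
  show "A$3$2 = - A$2$3" using e(3)[of 3 2] by linarith
  show "A$5$4 = - A$4$5" using e(3)[of 5 4] by linarith
  show "A$6$7 = - A$2$3 - A$4$5" using e(4) by linarith
  show "A$7$6 = A$2$3 + A$4$5" using e(3)[of 7 6] e(4) by linarith
  show "A$1$3 = - A$3$1" using e(3)[of 1 3] by linarith
  show "A$7$5 = - A$5$7" using e(3)[of 7 5] by linarith
  show "A$6$4 = - A$3$1 - A$5$7" using e(5) by linarith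
  show "A$4$6 = A$3$1 + A$5$7" using e(3)[of 4 6] e(5) by linarith
  show "A$2$1 = - A$1$2" using e(3)[of 2 1] by linarith
  show "A$7$4 = - A$4$7" using e(3)[of 7 4] by linarith
  show "A$5$6 = - A$1$2 - A$4$7" using e(6) by linarith
  show "A$6$5 = A$1$2 + A$4$7" using e(3)[of 6 5] e(6) by linarith
  show "A$6$2 = - A$2$6" using e(3)[of 6 2] by linarith
  show "A$1$5 = - A$5$1" using e(3)[of 1 5] by linarith
  show "A$7$3 = - A$2$6 - A$5$1" using e(7) by linarith
  show "A$3$7 = A$2$6 + A$5$1" using e(3)[of 3 7] e(7) by linarith
  show "A$4$1 = - A$1$4" using e(3)[of 4 1] by linarith
  show "A$3$6 = - A$6$3" using e(3)[of 3 6] by linarith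
  show "A$7$2 = - A$1$4 - A$6$3" using e(8) by linarith
  show "A$2$7 = A$1$4 + A$6$3" using e(3)[of 2 7] e(8) by linarith
  show "A$5$3 = - A$3$5" using e(3)[of 5 3] by linarith
  show "A$1$7 = - A$7$1" using e(3)[of 1 7] by linarith
  show "A$4$2 = - A$7$1 - A$3$5" using e(9) by linarith
  show "A$2$4 = A$7$1 + A$3$5" using e(3)[of 2 4] e(9) by linarith
  show "A$6$1 = - A$1$6" using e(3)[of 6 1] by linarith
  show "A$5$2 = - A$2$5" using e(3)[of 5 2] by linarith
  show "A$3$4 = - A$1$6 - A$2$5" using e(10) by linarith
  show "A$4$3 = A$1$6 + A$2$5" using e(3)[of 4 3] e(10) by linarith
qed

section \<open>Generators of the derivation algebra\<close>

definition bivec :: "8 \<Rightarrow> 8 \<Rightarrow> real^8^8" where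
  "bivec i j = (\<chi> a b. if a = i \<and> b = j then 1 else if a = j \<and> b = i then - 1 else 0)"

lemma bivec_nth: "bivec i j $ a $ b = (if a = i \<and> b = j then 1 else if a = j \<and> b = i then - 1 else 0)"
  by (simp add: bivec_def)

lemma bivec_mult_vec:
  assumes "i \<noteq> j"
  shows "(bivec i j *v x) $ a = (if a = i then x$j else if a = j then - x$i else 0)"
proof -
  have "bivec i j $ a $ b * x $ b = (if b = j then (if a = i then x$j else 0) else 0)
      + (if b = i then (if a = j then - x$i else 0) else 0)" for b
    using assms by (auto simp: bivec_nth)
  then show ?thesis using assms by (simp add: matrix_vector_mult_def sum.distrib)
qed

lemma bivec_mult_left:
  assumes "i \<noteq> j"
  shows "(bivec i j ** X) $ a $ b = (if a = i then X$j$b else if a = j then - X$i$b else 0)"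
proof -
  have "(bivec i j ** X) $ a $ b = (bivec i j *v column b X) $ a"
    by (simp add: matrix_matrix_mult_def matrix_vector_mult_def column_def)
  then show ?thesis by (simp add: bivec_mult_vec[OF assms] column_def)
qed

lemma bivec_mult_right:
  assumes "i \<noteq> j"
  shows "(X ** bivec i j) $ a $ b = (if b = j then X$a$i else if b = i then - X$a$j else 0)"
proof -
  have "X $ a $ c * bivec i j $ c $ b = (if c = i then (if b = j then X$a$i else 0) else 0)
      + (if c = j then (if b = i then - X$a$j else 0) else 0)" for c
    using assms by (auto simp: bivec_nth)
  then show ?thesis using assms by (simp add: matrix_matrix_mult_def sum.distrib)
qed

lemma matrix_diff_vec: "((A::real^'n^'m) - B) *v x = A *v x - B *v x"
  by (simp add: matrix_vector_mult_def vec_eq_iff left_diff_distrib sum_subtractf)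

text \<open>\<open>b\<close> turns two disjoint coordinate planes by a right angle, so
  \<open>b ** b\<close> is minus the projection onto their span. The cubic identity is what gives
  the exponential of \<open>b\<close> a closed form, see \<open>rot\<close>.\<close>

lemma bivec_diff_cube:
  assumes "i \<noteq> j" "k \<noteq> l" "i \<noteq> k" "i \<noteq> l" "j \<noteq> k" "j \<noteq> l"
  defines "b \<equiv> bivec i j - bivec k l"
  shows "b ** b ** b = - b"
proof -
  have b: "(b *v x) $ a = (if a = i then x$j else if a = j then - x$i else if a = k then - x$l
      else if a = l then x$k else 0)" for x a
    using assms by (auto simp: b_def matrix_diff_vec bivec_mult_vec)
  have "(b ** b ** b) *v x = - b *v x" for x
  proof -
    have "(b *v (b *v (b *v x))) $ a = - (b *v x) $ a" for a
      unfolding b using assms by auto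
    moreover have "- b *v x = - (b *v x)" by (simp add: vec_eq_iff matrix_vector_mult_def sum_negf)
    ultimately show ?thesis by (simp add: vec_eq_iff flip: matrix_vector_mul_assoc)
  qed
  then show ?thesis by (simp add: matrix_eq)
qed

text \<open>For each \<open>k\<close> the entries of a derivation at the three pairs with \<open>e\<^sub>i e\<^sub>j = e\<^sub>k\<close> add up to zero. The
  eliminated pair never contains \<open>1\<close>: hence if a derivation annihilates \<open>e\<^sub>1\<close>, so does each generator that
  occurs in it.\<close>

lemma oct_der_decomp:
  assumes A: "A \<in> oct_der"
  shows "A = A$2$3 *\<^sub>R (bivec 2 3 - bivec 6 7)
     + A$4$5 *\<^sub>R (bivec 4 5 - bivec 6 7)
     + A$3$1 *\<^sub>R (bivec 3 1 - bivec 6 4)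
     + A$5$7 *\<^sub>R (bivec 5 7 - bivec 6 4)
     + A$1$2 *\<^sub>R (bivec 1 2 - bivec 5 6)
     + A$4$7 *\<^sub>R (bivec 4 7 - bivec 5 6)
     + A$2$6 *\<^sub>R (bivec 2 6 - bivec 7 3)
     + A$5$1 *\<^sub>R (bivec 5 1 - bivec 7 3)
     + A$1$4 *\<^sub>R (bivec 1 4 - bivec 7 2)
     + A$6$3 *\<^sub>R (bivec 6 3 - bivec 7 2)
     + A$7$1 *\<^sub>R (bivec 7 1 - bivec 4 2)
     + A$3$5 *\<^sub>R (bivec 3 5 - bivec 4 2)
     + A$1$6 *\<^sub>R (bivec 1 6 - bivec 3 4)
     + A$2$5 *\<^sub>R (bivec 2 5 - bivec 3 4)"
  unfolding vec_eq_iff forall_8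
  by (simp add: oct_der_normalize[OF A] bivec_nth)

lemma bivec_antisym: "i \<noteq> j \<Longrightarrow> bivec i j $ a $ b = - bivec i j $ b $ a"
  by (auto simp: bivec_nth)

lemma oct_der_generators:
  shows "bivec 2 3 - bivec 6 7 \<in> oct_der"
    "bivec 4 5 - bivec 6 7 \<in> oct_der"
    "bivec 3 1 - bivec 6 4 \<in> oct_der"
    "bivec 5 7 - bivec 6 4 \<in> oct_der"
    "bivec 1 2 - bivec 5 6 \<in> oct_der"
    "bivec 4 7 - bivec 5 6 \<in> oct_der"
    "bivec 2 6 - bivec 7 3 \<in> oct_der"
    "bivec 5 1 - bivec 7 3 \<in> oct_der"
    "bivec 1 4 - bivec 7 2 \<in> oct_der"
    "bivec 6 3 - bivec 7 2 \<in> oct_der"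
    "bivec 7 1 - bivec 4 2 \<in> oct_der"
    "bivec 3 5 - bivec 4 2 \<in> oct_der"
    "bivec 1 6 - bivec 3 4 \<in> oct_der"
    "bivec 2 5 - bivec 3 4 \<in> oct_der"
  by (rule oct_derI; simp add: bivec_antisym bivec_nth; fail)+

text \<open>A basis together with its coordinate functionals, in the form that
  \<open>trace_on_frame_list\<close> consumes. The pairs in the subtracted terms are the eliminated
  ones, hence each functional vanishes on all generators but its own.\<close>

definition oct_der_frame :: "((real^8^8 \<Rightarrow> real) \<times> (real^8^8)) list" where
  "oct_der_frame = [(\<lambda>A. A$2$3, bivec 2 3 - bivec 6 7),
    (\<lambda>A. A$4$5, bivec 4 5 - bivec 6 7),
    (\<lambda>A. A$3$1, bivec 3 1 - bivec 6 4),
    (\<lambda>A. A$5$7, bivec 5 7 - bivec 6 4),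
    (\<lambda>A. A$1$2, bivec 1 2 - bivec 5 6),
    (\<lambda>A. A$4$7, bivec 4 7 - bivec 5 6),
    (\<lambda>A. A$2$6, bivec 2 6 - bivec 7 3),
    (\<lambda>A. A$5$1, bivec 5 1 - bivec 7 3),
    (\<lambda>A. A$1$4, bivec 1 4 - bivec 7 2),
    (\<lambda>A. A$6$3, bivec 6 3 - bivec 7 2),
    (\<lambda>A. A$7$1, bivec 7 1 - bivec 4 2),
    (\<lambda>A. A$3$5, bivec 3 5 - bivec 4 2),
    (\<lambda>A. A$1$6, bivec 1 6 - bivec 3 4),
    (\<lambda>A. A$2$5, bivec 2 5 - bivec 3 4)]"

lemma oct_mult_unit: "oct_mult (axis 0 1) x = x" "oct_mult x (axis 0 1) = x"
  by (simp_all add: vec_eq_iff forall_8 oct_mult_components axis_nth_if)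

lemma oct_mult_square: "oct_mult x x = (2 * x$0) *\<^sub>R x - (x \<bullet> x) *\<^sub>R axis 0 1"
  by (simp add: vec_eq_iff forall_8 oct_mult_components axis_nth_if inner_vec_def sum_8)

lemma bilinear_oct_mult: "bilinear oct_mult"
  unfolding bilinear_def
  by (intro conjI allI linearI) (simp_all add: vec_eq_iff forall_8 oct_mult_components algebra_simps)

lemma bounded_bilinear_oct_mult: "bounded_bilinear oct_mult"
  using bilinear_oct_mult bilinear_conv_bounded_bilinear by blast

lemma oct_der_subspace: "subspace oct_der"
proof (rule subspaceI)
  note l = bounded_bilinear.add_left[OF bounded_bilinear_oct_mult] bounded_bilinear.add_right[OF bounded_bilinear_oct_mult]
    bounded_bilinear.scaleR_left[OF bounded_bilinear_oct_mult] bounded_bilinear.scaleR_right[OF bounded_bilinear_oct_mult]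
    bounded_bilinear.zero_left[OF bounded_bilinear_oct_mult] bounded_bilinear.zero_right[OF bounded_bilinear_oct_mult]
  show "0 \<in> oct_der" by (simp add: oct_der_def l)
  show "A + B \<in> oct_der" if "A \<in> oct_der" "B \<in> oct_der" for A B
    using that by (simp add: oct_der_def matrix_vector_mult_add_rdistrib l)
  show "c *\<^sub>R A \<in> oct_der" if "A \<in> oct_der" for c A
    using that by (simp add: oct_der_def scaleR_matrix_vector_assoc[symmetric] l scaleR_add_right)
qed

lemma oct_der_commutator: "A \<in> oct_der \<Longrightarrow> B \<in> oct_der \<Longrightarrow> commutator A B \<in> oct_der"
  by (simp add: oct_der_def commutator_def matrix_diff_vec matrix_vector_mult_diff_distrib
      bounded_bilinear.diff_left[OF bounded_bilinear_oct_mult] bounded_bilinear.diff_right[OF bounded_bilinear_oct_mult]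
      matrix_vector_right_distrib bounded_bilinear.add_left[OF bounded_bilinear_oct_mult]
      bounded_bilinear.add_right[OF bounded_bilinear_oct_mult] flip: matrix_vector_mul_assoc)

section \<open>The group \<open>G\<^sub>2\<close>\<close>

declare transpose_matrix_vector [simp del]

section \<open>Bilinearity and inner products of matrices\<close>

lemma bounded_bilinear_matrix_mult: "bounded_bilinear ((**) :: real^8^8 \<Rightarrow> real^8^8 \<Rightarrow> real^8^8)"
proof -
  have "bilinear ((**) :: real^8^8 \<Rightarrow> real^8^8 \<Rightarrow> real^8^8)"
    unfolding bilinear_def
    by (intro conjI allI linearI)
      (simp_all add: vec_eq_iff matrix_matrix_mult_def distrib_left distrib_right sum.distrib sum_distrib_left mult.assoc mult.left_commute)
  then show ?thesis using bilinear_conv_bounded_bilinear by blast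
qed

lemma bounded_bilinear_matrix_vec: "bounded_bilinear ((*v) :: real^8^8 \<Rightarrow> real^8 \<Rightarrow> real^8)"
proof -
  have "bilinear ((*v) :: real^8^8 \<Rightarrow> real^8 \<Rightarrow> real^8)"
    unfolding bilinear_def
    by (intro conjI allI linearI)
      (simp_all add: matrix_vector_right_distrib matrix_vector_mult_add_rdistrib
        matrix_vector_mult_scaleR scaleR_matrix_vector_assoc)
  then show ?thesis using bilinear_conv_bounded_bilinear by blast
qed

lemmas mm_simps =
  bounded_bilinear.add_left[OF bounded_bilinear_matrix_mult] bounded_bilinear.add_right[OF bounded_bilinear_matrix_mult]
  bounded_bilinear.diff_left[OF bounded_bilinear_matrix_mult] bounded_bilinear.diff_right[OF bounded_bilinear_matrix_mult]
  bounded_bilinear.minus_left[OF bounded_bilinear_matrix_mult] bounded_bilinear.minus_right[OF bounded_bilinear_matrix_mult]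
  bounded_bilinear.scaleR_left[OF bounded_bilinear_matrix_mult] bounded_bilinear.scaleR_right[OF bounded_bilinear_matrix_mult]
  bounded_bilinear.zero_left[OF bounded_bilinear_matrix_mult] bounded_bilinear.zero_right[OF bounded_bilinear_matrix_mult]

lemmas mv_simps =
  bounded_bilinear.add_left[OF bounded_bilinear_matrix_vec] bounded_bilinear.add_right[OF bounded_bilinear_matrix_vec]
  bounded_bilinear.diff_left[OF bounded_bilinear_matrix_vec] bounded_bilinear.diff_right[OF bounded_bilinear_matrix_vec]
  bounded_bilinear.minus_left[OF bounded_bilinear_matrix_vec] bounded_bilinear.minus_right[OF bounded_bilinear_matrix_vec]
  bounded_bilinear.scaleR_left[OF bounded_bilinear_matrix_vec] bounded_bilinear.scaleR_right[OF bounded_bilinear_matrix_vec]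
  bounded_bilinear.zero_left[OF bounded_bilinear_matrix_vec] bounded_bilinear.zero_right[OF bounded_bilinear_matrix_vec]

lemma inner_matrix_transpose: "transpose A \<bullet> B = A \<bullet> transpose (B :: real^8^8)"
  unfolding inner_vec_def transpose_def by simp (rule sum.swap)

lemma inner_matrix_mult_left: "(X ** A) \<bullet> B = A \<bullet> (transpose X ** B)"
  for A B X :: "real^8^8"
proof -
  have "(X ** A) \<bullet> B = (\<Sum>i\<in>UNIV. \<Sum>j\<in>UNIV. \<Sum>k\<in>UNIV. X$i$k * A$k$j * B$i$j)"
    by (simp add: inner_vec_def matrix_matrix_mult_def sum_distrib_right)
  also have "\<dots> = (\<Sum>k\<in>UNIV. \<Sum>j\<in>UNIV. \<Sum>i\<in>UNIV. X$i$k * A$k$j * B$i$j)"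
    by (subst sum.swap, subst (2) sum.swap, subst sum.swap) (rule refl)
  also have "\<dots> = A \<bullet> (transpose X ** B)"
    by (simp add: inner_vec_def matrix_matrix_mult_def transpose_def sum_distrib_left mult_ac)
  finally show ?thesis .
qed

lemma inner_matrix_mult_right: "(A ** X) \<bullet> B = A \<bullet> (B ** transpose X)"
  for A B X :: "real^8^8"
proof -
  have "(A ** X) \<bullet> B = transpose (A ** X) \<bullet> transpose B"
    by (simp add: inner_matrix_transpose)
  also have "\<dots> = transpose A \<bullet> (X ** transpose B)"
    by (simp add: matrix_transpose_mul inner_matrix_mult_left)
  finally show ?thesis by (simp add: inner_matrix_transpose matrix_transpose_mul)
qed

section \<open>Automorphisms are orthogonal matrices\<close>

lemma G2_I: "invertible A \<Longrightarrow> (\<And>x y. A *v oct_mult x y = oct_mult (A *v x) (A *v y)) \<Longrightarrow> A \<in> G2"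
  by (simp add: G2_def)

lemma G2_inverse:
  assumes "A \<in> G2"
  obtains B where "A ** B = mat 1" "B ** A = mat 1"
  using assms by (auto simp: G2_def invertible_def)

lemma G2_mult_vec: "A \<in> G2 \<Longrightarrow> A *v oct_mult x y = oct_mult (A *v x) (A *v y)"
  by (simp add: G2_def)

lemma G2_unit:
  assumes A: "A \<in> G2"
  shows "A *v axis 0 1 = axis 0 1"
proof -
  obtain B where B: "A ** B = mat 1" using G2_inverse[OF A] by blast
  have "A *v (B *v axis 0 1) = axis 0 1" using B by (simp add: matrix_vector_mul_assoc)
  then show ?thesis
    using G2_mult_vec[OF A, of "axis 0 1" "B *v axis 0 1"] by (simp add: oct_mult_unit)
qed

text \<open>Every octonion satisfies a quadratic equation over the reals. Comparing the one of
  \<open>A *v x\<close> with the image of the one of \<open>x\<close> leaves a multiple of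
  \<open>A *v x\<close> equal to a real octonion; a nonzero real part would make
  \<open>A *v x\<close>, and by injectivity \<open>x\<close>, real, against
  \<open>x $ 0 = 0\<close>.\<close>

lemma G2_norm_imaginary:
  assumes A: "A \<in> G2" and x: "x $ 0 = 0"
  shows "(A *v x) $ 0 = 0 \<and> (A *v x) \<bullet> (A *v x) = x \<bullet> x"
proof -
  let ?y = "A *v x"
  have "oct_mult ?y ?y = A *v (- ((x \<bullet> x) *\<^sub>R axis 0 1))"
    using G2_mult_vec[OF A, of x x] by (simp add: oct_mult_square x)
  then have e: "(2 * ?y$0) *\<^sub>R ?y - (?y \<bullet> ?y) *\<^sub>R axis 0 1 = - ((x \<bullet> x) *\<^sub>R axis 0 1)"
    using G2_unit[OF A] by (simp add: oct_mult_square mv_simps)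
  have y0: "?y $ 0 = 0"
  proof (rule ccontr)
    assume n: "?y $ 0 \<noteq> 0"
    define c where "c = (?y \<bullet> ?y - x \<bullet> x) / (2 * ?y $ 0)"
    have "(2 * ?y$0) *\<^sub>R ?y = (?y \<bullet> ?y - x \<bullet> x) *\<^sub>R axis 0 1"
      using e by (simp add: scaleR_diff_left algebra_simps)
    then have "(1 / (2 * ?y$0)) *\<^sub>R ((2 * ?y$0) *\<^sub>R ?y) = (1 / (2 * ?y$0)) *\<^sub>R ((?y \<bullet> ?y - x \<bullet> x) *\<^sub>R axis 0 1)"
      by (rule arg_cong)
    then have y: "?y = c *\<^sub>R axis 0 1" using n by (simp add: c_def)
    also have "\<dots> = A *v (c *\<^sub>R axis 0 1)" using G2_unit[OF A] by (simp add: mv_simps)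
    finally have "A *v x = A *v (c *\<^sub>R axis 0 1)" .
    moreover obtain B where "B ** A = mat 1" using G2_inverse[OF A] by blast
    ultimately have "x = c *\<^sub>R axis 0 1" by (metis matrix_vector_mul_assoc matrix_vector_mul_lid)
    then have "c = 0" using x by (simp add: axis_nth_if)
    then show False using n y by simp
  qed
  have "(- (?y \<bullet> ?y)) *\<^sub>R axis 0 (1::real) = (- (x \<bullet> x)) *\<^sub>R axis 0 1" using e y0 by simp
  from arg_cong[OF this, of "\<lambda>v. v $ 0"]
  have "- (?y \<bullet> ?y) = - (x \<bullet> x)" by (simp add: axis_nth_if)
  then have "?y \<bullet> ?y = x \<bullet> x" by simp
  with y0 show ?thesis by simp
qed

text \<open>\<open>A\<close> fixes the unit and maps imaginary octonions isometrically to imaginary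
  ones, so it preserves the norm of the sum of a real and an imaginary part.\<close>

lemma G2_orthogonal:
  assumes A: "A \<in> G2"
  shows "transpose A ** A = mat 1" "A ** transpose A = mat 1"
proof -
  have n: "(A *v x) \<bullet> (A *v x) = x \<bullet> x" for x
  proof -
    define v where "v = x - x$0 *\<^sub>R axis 0 1"
    have v0: "v $ 0 = 0" by (simp add: v_def axis_nth_if)
    have x: "x = x$0 *\<^sub>R axis 0 1 + v" by (simp add: v_def)
    have o: "(c *\<^sub>R axis 0 1 + w) \<bullet> (c *\<^sub>R axis 0 1 + w) = c * c + w \<bullet> w" if "w $ 0 = 0" for c and w :: "real^8"
      using that by (simp add: inner_add_left inner_add_right inner_axis inner_axis')
    have "A *v x = x$0 *\<^sub>R axis 0 1 + A *v v"
      by (subst x) (simp add: mv_simps G2_unit[OF A])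
    then show ?thesis using G2_norm_imaginary[OF A v0] o[of v "x$0"] o[of "A *v v" "x$0"] v0 x by simp
  qed
  have "norm (A *v x) = norm x" for x using n by (simp add: norm_eq_sqrt_inner)
  then have "orthogonal_transformation ((*v) A)"
    by (simp add: orthogonal_transformation)
  then have "orthogonal_matrix A" by (simp add: orthogonal_transformation_matrix)
  then show "transpose A ** A = mat 1" "A ** transpose A = mat 1"
    by (simp_all add: orthogonal_matrix_def)
qed

lemma G2_matrix_inv: "A \<in> G2 \<Longrightarrow> matrix_inv A = transpose A"
  unfolding matrix_inv_def
  by (rule some_equality) (use G2_orthogonal[of A] in \<open>auto, metis matrix_mul_assoc matrix_mul_lid matrix_mul_rid\<close>)

lemma G2_one: "mat 1 \<in> G2"
  by (rule G2_I) (auto simp: invertible_def intro: exI[of _ "mat 1"])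

lemma G2_mult: "A \<in> G2 \<Longrightarrow> B \<in> G2 \<Longrightarrow> A ** B \<in> G2"
proof (rule G2_I)
  assume A: "A \<in> G2" and B: "B \<in> G2"
  then show "invertible (A ** B)" by (auto simp: G2_def intro: invertible_mult)
  show "(A ** B) *v oct_mult x y = oct_mult ((A ** B) *v x) ((A ** B) *v y)" for x y
    by (simp only: matrix_vector_mul_assoc[symmetric] G2_mult_vec[OF A] G2_mult_vec[OF B])
qed

lemma G2_transpose:
  assumes A: "A \<in> G2"
  shows "transpose A \<in> G2"
proof (rule G2_I)
  note o = G2_orthogonal[OF A]
  show "invertible (transpose A)" unfolding invertible_def using o by blast
  fix x y
  have "A *v oct_mult (transpose A *v x) (transpose A *v y) = oct_mult x y"
    by (simp add: G2_mult_vec[OF A] matrix_vector_mul_assoc o)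
  then show "transpose A *v oct_mult x y = oct_mult (transpose A *v x) (transpose A *v y)"
    using o by (metis matrix_vector_mul_assoc matrix_vector_mul_lid)
qed

lemma G2_inner: "A \<in> G2 \<Longrightarrow> (A *v x) \<bullet> (A *v y) = x \<bullet> y"
  using G2_orthogonal[of A] dot_lmul_matrix[of "A *v x" A y]
  by (metis dot_lmul_matrix matrix_vector_mul_assoc matrix_vector_mul_lid transpose_matrix_vector)

lemma G2_inner_mult_left: "A \<in> G2 \<Longrightarrow> (A ** X) \<bullet> (A ** Y) = X \<bullet> Y"
  for X Y :: "real^8^8"
  using G2_orthogonal[of A] by (simp add: inner_matrix_mult_left matrix_mul_assoc)

text \<open>If \<open>b ** b ** b = - b\<close>, the exponential series of
  \<open>t *\<^sub>R b\<close> collapses to this expression.\<close>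

definition rot :: "real^8^8 \<Rightarrow> real \<Rightarrow> real^8^8" where
  "rot b t = mat 1 + sin t *\<^sub>R b + (1 - cos t) *\<^sub>R (b ** b)"

lemma rot_0 [simp]: "rot b 0 = mat 1"
  by (simp add: rot_def)

context
  fixes b :: "real^8^8"
  assumes cube: "b ** b ** b = - b"
begin

lemma rot_has_vector_derivative: "(rot b has_vector_derivative b ** rot b t) (at t)"
proof -
  have "(rot b has_vector_derivative cos t *\<^sub>R b + sin t *\<^sub>R (b ** b)) (at t)"
    unfolding rot_def has_vector_derivative_def
    by (auto intro!: derivative_eq_intros ext simp: algebra_simps)
  moreover have "b ** rot b t = cos t *\<^sub>R b + sin t *\<^sub>R (b ** b)"
    using cube by (simp add: rot_def mm_simps matrix_mul_assoc scaleR_diff_left)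
  ultimately show ?thesis by simp
qed

lemma rot_minus: "rot b t ** rot b (- t) = mat 1"
proof -
  have c4: "b ** b ** (b ** b) = - (b ** b)" using cube by (simp add: matrix_mul_assoc mm_simps)
  have c3: "b ** (b ** b) = - b" using cube by (simp add: matrix_mul_assoc)
  have "(cos t * cos t) *\<^sub>R (b ** b) + (sin t * sin t) *\<^sub>R (b ** b) = b ** b"
    using sin_cos_squared_add2[of t] by (simp flip: scaleR_add_left power2_eq_square)
  then show ?thesis
    by (simp add: rot_def mm_simps cube c3 c4 algebra_simps)
qed

text \<open>For a derivation \<open>b\<close>, the curve \<open>rot b (- t) (rot b t x \<cdot> rot b t y)\<close> has derivative zero.\<close>

lemma rot_in_G2:
  assumes b: "b \<in> oct_der"
  shows "rot b t \<in> G2"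
proof (rule G2_I)
  show "invertible (rot b t)"
    unfolding invertible_def using rot_minus[of t] rot_minus[of "- t"] by auto
  fix x y
  define \<phi> where "\<phi> t = rot b (- t) *v oct_mult (rot b t *v x) (rot b t *v y)" for t
  have comm: "b ** rot b s = rot b s ** b" for s
    by (simp add: rot_def mm_simps matrix_mul_assoc)
  have "(\<phi> has_vector_derivative 0) (at t)" for t
  proof -
    have 1: "((\<lambda>t. rot b t *v z) has_vector_derivative b *v (rot b t *v z)) (at t)" for z t
      using bounded_bilinear.has_vector_derivative[OF bounded_bilinear_matrix_vec rot_has_vector_derivative[of t]
          has_vector_derivative_const[of z]]
      by (simp add: matrix_vector_mul_assoc)
    have 2: "((\<lambda>t. rot b (- t)) has_vector_derivative - (b ** rot b (- t))) (at t)"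
    proof -
      have "(uminus has_real_derivative - 1) (at t)" by (auto intro!: derivative_eq_intros)
      then show ?thesis
        using vector_diff_chain_at[of uminus "-1" t "rot b" "b ** rot b (- t)"] rot_has_vector_derivative[of "- t"]
        by (simp add: has_real_derivative_iff_has_vector_derivative o_def)
    qed
    have 3: "(\<phi> has_vector_derivative
        rot b (- t) *v (oct_mult (rot b t *v x) (b *v (rot b t *v y)) + oct_mult (b *v (rot b t *v x)) (rot b t *v y))
        + (- (b ** rot b (- t))) *v oct_mult (rot b t *v x) (rot b t *v y)) (at t)"
      unfolding \<phi>_def
      by (rule bounded_bilinear.has_vector_derivative[OF bounded_bilinear_matrix_vec 2
          bounded_bilinear.has_vector_derivative[OF bounded_bilinear_oct_mult 1 1]])
    have 4: "rot b (- t) *v (oct_mult (rot b t *v x) (b *v (rot b t *v y)) + oct_mult (b *v (rot b t *v x)) (rot b t *v y))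
      = (b ** rot b (- t)) *v oct_mult (rot b t *v x) (rot b t *v y)"
      using b by (simp add: oct_der_def comm add.commute flip: matrix_vector_mul_assoc)
    show ?thesis using 3[unfolded 4] by (simp add: bounded_bilinear.minus_left[OF bounded_bilinear_matrix_vec])
  qed
  then have "\<phi> t = \<phi> 0"
    using has_vector_derivative_zero_constant[of UNIV \<phi>] by (metis UNIV_I convex_UNIV)
  then have "rot b (- t) *v oct_mult (rot b t *v x) (rot b t *v y) = oct_mult x y"
    by (simp add: \<phi>_def)
  then show "rot b t *v oct_mult x y = oct_mult (rot b t *v x) (rot b t *v y)"
    using rot_minus[of t] by (metis matrix_vector_mul_assoc matrix_vector_mul_lid)
qed

end

text \<open>For fixed frequency, these combinations are closed under differentiation; hence the
  induction on \<open>k\<close> with arbitrary coefficients.\<close>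

lemma Ck_on_trig: "Ck_on k S (\<lambda>t::real. a * sin (c * t) + b * cos (c * t) :: real)"
proof (induction k arbitrary: a b)
  case 0
  then show ?case by (auto intro!: continuous_intros)
next
  case (Suc k)
  have d: "((\<lambda>t. a * sin (c * t) + b * cos (c * t)) has_derivative
      (\<lambda>v. v * (- (b * c) * sin (c * x) + (a * c) * cos (c * x)))) (at x)" for x
    by (auto intro!: derivative_eq_intros ext simp: algebra_simps)
  have "Ck_on k S (\<lambda>x. v * (- (b * c) * sin (c * x) + (a * c) * cos (c * x)))" for v
    using Suc[of "v * (- (b * c))" "v * (a * c)"] by (simp add: algebra_simps)
  then show ?case using d by (auto intro!: exI[of _ "\<lambda>x v. v * (- (b * c) * sin (c * x) + (a * c) * cos (c * x))"])
qed

lemma smooth_on_rot: "smooth_on S (\<lambda>t. rot b (c * t))"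
proof -
  have "smooth_on S (\<lambda>t. 1 * sin (c * t) + 0 * cos (c * t))" "smooth_on S (\<lambda>t. 0 * sin (c * t) + (- 1) * cos (c * t))"
    unfolding smooth_on_def using Ck_on_trig by blast+
  then have "smooth_on S (\<lambda>t. sin (c * t))" "smooth_on S (\<lambda>t. 1 - cos (c * t))"
    using smooth_on_add[of S "\<lambda>t. 1" "\<lambda>t. - cos (c * t)"] by simp_all
  then show ?thesis unfolding rot_def
    by (intro smooth_on_add smooth_on_const smooth_on_bilinear[OF bounded_bilinear_scaleR]) auto
qed

section \<open>Traces and the Killing form\<close>

text \<open>On \<open>V\<close> the map is the sum of the rank one maps that send \<open>v\<close>
  to \<open>l i (T v) *\<^sub>R b i\<close>. Expanding \<open>b i\<close> in the basis chosen by
  \<open>trace_on\<close> shows that each has trace \<open>l i (T (b i))\<close>. The linear map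
  \<open>T\<close> stands in for \<open>A\<close>, because a shape operator is determined on the
  tangent space only.\<close>

lemma trace_on_frame:
  fixes V :: "'a::euclidean_space set" and l :: "'i \<Rightarrow> 'a \<Rightarrow> real"
  assumes V: "subspace V" and T: "linear T" "\<And>v. v \<in> V \<Longrightarrow> A v = T v" "\<And>v. v \<in> V \<Longrightarrow> T v \<in> V"
    and I: "finite I" "\<And>i. i \<in> I \<Longrightarrow> b i \<in> V" "\<And>i. i \<in> I \<Longrightarrow> linear (l i)"
    and frame: "\<And>v. v \<in> V \<Longrightarrow> v = (\<Sum>i\<in>I. l i v *\<^sub>R b i)"
  shows "trace_on V A = (\<Sum>i\<in>I. l i (T (b i)))"
proof -
  define B where "B = (SOME B. B \<subseteq> V \<and> independent B \<and> span B = V)"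
  obtain B0 where "B0 \<subseteq> V" "independent B0" "V \<subseteq> span B0" "card B0 = dim V"
    by (rule basis_exists[of V])
  then have "B0 \<subseteq> V \<and> independent B0 \<and> span B0 = V" using span_minimal[OF _ V] by blast
  then have "B \<subseteq> V \<and> independent B \<and> span B = V"
    unfolding B_def by (rule someI)
  then have B: "B \<subseteq> V" "independent B" "span B = V" by auto
  have fin: "finite B" using B(2) by (rule independent_imp_finite)
  have rep: "representation B (A v) c = (\<Sum>i\<in>I. l i (T v) * representation B (b i) c)" if "v \<in> V" for v c
  proof -
    have "representation B (A v) = representation B (\<Sum>i\<in>I. l i (T v) *\<^sub>R b i)"
      by (rule arg_cong[OF trans[OF T(2)[OF that] frame[OF T(3)[OF that]]]])
    also have "\<dots> = (\<lambda>c. \<Sum>i\<in>I. representation B (l i (T v) *\<^sub>R b i) c)"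
      using B I V by (intro representation_sum) (auto intro: subspace_scale)
    also have "\<dots> = (\<lambda>c. \<Sum>i\<in>I. l i (T v) * representation B (b i) c)"
      using B I by (intro ext sum.cong refl) (simp add: representation_scale)
    finally show ?thesis by simp
  qed
  have "trace_on V A = (\<Sum>c\<in>B. \<Sum>i\<in>I. l i (T c) * representation B (b i) c)"
    unfolding trace_on_def B_def[symmetric] Let_def using rep B(1) by (intro sum.cong) auto
  also have "\<dots> = (\<Sum>i\<in>I. \<Sum>c\<in>B. l i (T c) * representation B (b i) c)" by (rule sum.swap)
  also have "\<dots> = (\<Sum>i\<in>I. l i (T (b i)))"
  proof (rule sum.cong[OF refl])
    fix i assume i: "i \<in> I"
    have "b i \<in> span B" using B(3) I(2)[OF i] by simp
    from sum_representation_eq[OF B(2) this fin order_refl]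
    have e: "(\<Sum>c\<in>B. representation B (b i) c *\<^sub>R c) = b i" .
    have "(\<Sum>c\<in>B. l i (T c) * representation B (b i) c) = l i (T (\<Sum>c\<in>B. representation B (b i) c *\<^sub>R c))"
      by (simp add: linear_sum[OF T(1)] linear_scale[OF T(1)] linear_sum[OF I(3)[OF i]]
          linear_scale[OF I(3)[OF i]] mult.commute)
    then show "(\<Sum>c\<in>B. l i (T c) * representation B (b i) c) = l i (T (b i))"
      unfolding e .
  qed
  finally show ?thesis .
qed

lemma trace_on_frame_list:
  fixes V :: "'a::euclidean_space set" and L :: "(('a \<Rightarrow> real) \<times> 'a) list"
  assumes V: "subspace V" and T: "linear T" "\<And>v. v \<in> V \<Longrightarrow> A v = T v" "\<And>v. v \<in> V \<Longrightarrow> T v \<in> V"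
    and L: "\<And>l b. (l, b) \<in> set L \<Longrightarrow> b \<in> V \<and> linear l"
    and frame: "\<And>v. v \<in> V \<Longrightarrow> v = (\<Sum>(l,b)\<leftarrow>L. l v *\<^sub>R b)"
  shows "trace_on V A = (\<Sum>(l,b)\<leftarrow>L. l (T b))"
proof -
  have s: "(\<Sum>(l,b)\<leftarrow>L. f l b) = (\<Sum>i<length L. f (fst (L!i)) (snd (L!i)))" for f :: "('a \<Rightarrow> real) \<Rightarrow> 'a \<Rightarrow> 'c::comm_monoid_add"
    by (simp add: sum_list_sum_nth case_prod_beta lessThan_atLeast0)
  have L': "snd (L!i) \<in> V \<and> linear (fst (L!i))" if "i < length L" for i
    using L[of "fst (L!i)" "snd (L!i)"] that by simp
  show ?thesis unfolding s
    by (rule trace_on_frame[OF V T]) (use L' frame[unfolded s] in auto)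
qed

lemma linear_matrix_nth: "linear (\<lambda>A::real^8^8. A $ i $ j)"
  by (rule linearI) auto

lemma oct_der_frame_props:
  "(l, b) \<in> set oct_der_frame \<Longrightarrow> b \<in> oct_der \<and> linear l"
  "v \<in> oct_der \<Longrightarrow> v = (\<Sum>(l,b)\<leftarrow>oct_der_frame. l v *\<^sub>R b)"
proof -
  show "(l, b) \<in> set oct_der_frame \<Longrightarrow> b \<in> oct_der \<and> linear l"
    unfolding oct_der_frame_def by (auto simp: oct_der_generators linear_matrix_nth)
  show "v \<in> oct_der \<Longrightarrow> v = (\<Sum>(l,b)\<leftarrow>oct_der_frame. l v *\<^sub>R b)"
    by (subst oct_der_decomp) (simp_all add: oct_der_frame_def add.assoc)
qed

lemma oct_der_inner:
  assumes "X \<in> oct_der" "Y \<in> oct_der"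
  shows "X \<bullet> Y = 2 * (\<Sum>(i,j)\<leftarrow>[(2,3),(4,5),(6,7),(3,1),(5,7),(6,4),(1,2),(4,7),(5,6),(2,6),(5,1),(7,3),
      (1,4),(6,3),(7,2),(7,1),(3,5),(4,2),(1,6),(2,5),(3,4)]. X$i$j * Y$i$j)"
  by (simp add: inner_vec_def sum_8 oct_der_normalize[OF assms(1)] oct_der_normalize[OF assms(2)])
    (simp add: algebra_simps)

lemma linear_commutator: "linear (commutator X)"
  unfolding commutator_def by (rule linearI) (simp_all add: mm_simps algebra_simps)

lemma commutator_commutator_nth:
  "commutator X (commutator Y Z) $ p $ q = (\<Sum>r\<in>UNIV. X$p$r * commutator Y Z $ r $ q - commutator Y Z $ p $ r * X$r$q)"
  for X Y Z :: "real^8^8"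
  by (simp add: commutator_def[of X] matrix_matrix_mult_def sum_subtractf)

lemma commutator_bivec_diff_nth:
  assumes "i \<noteq> j" "k \<noteq> l"
  shows "commutator Y (bivec i j - bivec k l) $ r $ q
    = (if q = j then Y$r$i else if q = i then - Y$r$j else 0) - (if q = l then Y$r$k else if q = k then - Y$r$l else 0)
    - (if r = i then Y$j$q else if r = j then - Y$i$q else 0) + (if r = k then Y$l$q else if r = l then - Y$k$q else 0)"
  by (simp add: commutator_def mm_simps bivec_mult_left[OF assms(1)] bivec_mult_left[OF assms(2)]
      bivec_mult_right[OF assms(1)] bivec_mult_right[OF assms(2)])

text \<open>For skew matrices \<open>X \<bullet> Y\<close> is minus the trace of
  \<open>X ** Y\<close>, so this is the value \<open>4 tr(XY)\<close> of the Killing form. After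
  normalisation both sides are explicit bilinear forms in the fourteen free entries of
  \<open>X\<close> and of \<open>Y\<close>.\<close>

lemma oct_der_trace_ad_ad:
  assumes X: "X \<in> oct_der" and Y: "Y \<in> oct_der"
  shows "trace_on oct_der (\<lambda>Z. commutator X (commutator Y Z)) = - 4 * (X \<bullet> Y)"
proof -
  have "trace_on oct_der (\<lambda>Z. commutator X (commutator Y Z))
      = (\<Sum>(l,b)\<leftarrow>oct_der_frame. l (commutator X (commutator Y b)))"
    by (rule trace_on_frame_list[OF oct_der_subspace _ _ _ oct_der_frame_props])
      (use linear_compose[OF linear_commutator[of Y] linear_commutator[of X]] oct_der_commutator X Y in \<open>simp_all add: o_def\<close>)
  also have "\<dots> = - 4 * (X \<bullet> Y)"
    unfolding oct_der_inner[OF X Y] oct_der_frame_def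
    by (simp add: commutator_commutator_nth commutator_bivec_diff_nth sum_8
        oct_der_normalize[OF X] oct_der_normalize[OF Y]) (simp add: algebra_simps)
  finally show ?thesis .
qed

text \<open>The curves are defined on the whole line, so that they can be multiplied without
  shrinking intervals.\<close>

definition has_curve :: "(real^8^8) set \<Rightarrow> real^8^8 \<Rightarrow> bool" where
  "has_curve H A \<longleftrightarrow> (\<exists>\<gamma>. smooth_on UNIV \<gamma> \<and> (\<forall>t. \<gamma> t \<in> H) \<and> \<gamma> 0 = mat 1 \<and> (\<gamma> has_vector_derivative A) (at (0::real)))"

lemma has_curveE:
  assumes "has_curve H A"
  obtains \<gamma> where "smooth_on UNIV \<gamma>" "\<And>t. \<gamma> t \<in> H" "\<gamma> 0 = mat 1" "(\<gamma> has_vector_derivative A) (at (0::real))"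
  using assms that unfolding has_curve_def by (elim exE conjE) simp

text \<open>At the identity, the velocity of a product of two curves is the sum of the
  velocities.\<close>

lemma has_curve_add:
  assumes H: "\<And>A B. A \<in> H \<Longrightarrow> B \<in> H \<Longrightarrow> A ** B \<in> H" and A: "has_curve H A" and B: "has_curve H B"
  shows "has_curve H (A + B)"
proof -
  obtain \<alpha> where a: "smooth_on UNIV \<alpha>" "\<And>t. \<alpha> t \<in> H" "\<alpha> 0 = mat 1" "(\<alpha> has_vector_derivative A) (at (0::real))"
    using has_curveE[OF A] by blast
  obtain \<beta> where b: "smooth_on UNIV \<beta>" "\<And>t. \<beta> t \<in> H" "\<beta> 0 = mat 1" "(\<beta> has_vector_derivative B) (at (0::real))"
    using has_curveE[OF B] by blast
  have "((\<lambda>t. \<alpha> t ** \<beta> t) has_vector_derivative A + B) (at 0)"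
    using bounded_bilinear.has_vector_derivative[OF bounded_bilinear_matrix_mult a(4) b(4)] a(3) b(3)
    by (simp add: add.commute)
  then show ?thesis unfolding has_curve_def
    using a b smooth_on_bilinear[OF bounded_bilinear_matrix_mult a(1) b(1)] H
    by (intro exI[of _ "\<lambda>t. \<alpha> t ** \<beta> t"]) auto
qed

text \<open>The alternative \<open>c = 0\<close> admits generators whose one-parameter group leaves
  \<open>H\<close>, as long as they enter with coefficient zero.\<close>

lemma has_curve_rot:
  assumes "mat 1 \<in> H" and "c = 0 \<or> (\<forall>t. rot b t \<in> H)" and cube: "b ** b ** b = - b"
  shows "has_curve H (c *\<^sub>R b)"
proof -
  have "((\<lambda>t. rot b (c * t)) has_vector_derivative c *\<^sub>R b) (at 0)"
    using vector_diff_chain_at[of "\<lambda>t. c * t" c 0 "rot b" b] rot_has_vector_derivative[OF cube, of 0]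
      DERIV_cmult_Id[of c "0::real" UNIV]
    by (simp add: o_def has_real_derivative_iff_has_vector_derivative)
  moreover have "rot b (c * t) \<in> H" for t using assms by (cases "c = 0") auto
  ultimately show ?thesis unfolding has_curve_def
    using smooth_on_rot by (intro exI[of _ "\<lambda>t. rot b (c * t)"]) auto
qed

text \<open>The curve is the product of the rotations of the frame, each at the speed given by its
  coordinate of \<open>A\<close>. For a subgroup \<open>H\<close> it remains to see that the
  generators with nonzero coordinate stay in \<open>H\<close>.\<close>

lemma has_curve_oct_der:
  assumes A: "A \<in> oct_der" and H: "mat 1 \<in> H" "\<And>A B. A \<in> H \<Longrightarrow> B \<in> H \<Longrightarrow> A ** B \<in> H"
    and gen: "\<And>l b. (l, b) \<in> set oct_der_frame \<Longrightarrow> l A = 0 \<or> (\<forall>t. rot b t \<in> H)"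
  shows "has_curve H A"
proof -
  have add: "has_curve H X \<Longrightarrow> has_curve H Y \<Longrightarrow> has_curve H (X + Y)" for X Y
    using has_curve_add[of H X Y] H(2) by blast
  have cube: "b ** b ** b = - b" if "(l, b) \<in> set oct_der_frame" for l b
    using that unfolding oct_der_frame_def by (auto simp: bivec_diff_cube)
  have tm: "has_curve H (l A *\<^sub>R b)" if "(l, b) \<in> set oct_der_frame" for l b
    by (rule has_curve_rot[OF H(1) gen[OF that] cube[OF that]])
  have zero: "has_curve H 0"
    using has_curve_rot[OF H(1), of 0 0] by (simp add: mm_simps)
  have "has_curve H (\<Sum>(l,b)\<leftarrow>L. l A *\<^sub>R b)" if "set L \<subseteq> set oct_der_frame" for L
    using that by (induction L) (auto intro!: zero add tm)
  from this[OF order_refl] show ?thesis using oct_der_frame_props(2)[OF A] by simp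
qed

section \<open>Tangent spaces and orbits\<close>

lemma tangent_spaceI:
  assumes "smooth_on UNIV \<gamma>" "\<And>t. \<gamma> t \<in> M" "\<gamma> 0 = x" "(\<gamma> has_vector_derivative v) (at (0::real))"
  shows "v \<in> tangent_space M x"
  unfolding tangent_space_def
  using assms smooth_on_subset[OF assms(1), of "{-1<..<1}"]
  by (intro CollectI exI[of _ \<gamma>] exI[of _ "1::real"]) auto

lemma has_curve_G2: "A \<in> oct_der \<Longrightarrow> has_curve G2 A"
proof (rule has_curve_oct_der)
  show "l A = 0 \<or> (\<forall>t. rot b t \<in> G2)" if "(l, b) \<in> set oct_der_frame" for l b
  proof -
    have "b ** b ** b = - b"
      using that unfolding oct_der_frame_def by (auto simp: bivec_diff_cube)
    then show ?thesis using rot_in_G2 oct_der_frame_props(1)[OF that] by blast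
  qed
qed (auto intro: G2_one G2_mult)

text \<open>The derivation rule is the multiplicativity of \<open>\<gamma> t\<close> differentiated
  at 0 and pulled back by the inverse of \<open>x\<close>. Differentiability at 0 suffices for the
  curve, which matters for images of curves under isometries.\<close>

lemma G2_curve_velocity:
  assumes x: "x \<in> G2" and c: "\<epsilon> > 0" "\<And>t. t \<in> {-\<epsilon><..<\<epsilon>} \<Longrightarrow> \<gamma> t \<in> G2" "\<gamma> 0 = x"
      "(\<gamma> has_vector_derivative v) (at (0::real))"
  shows "transpose x ** v \<in> oct_der"
proof -
  have mv: "((\<lambda>t. \<gamma> t *v a) has_vector_derivative v *v a) (at 0)" for a
    using bounded_bilinear.has_vector_derivative[OF bounded_bilinear_matrix_vec c(4) has_vector_derivative_const[of a]]
    by (simp add: mv_simps)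
  have e: "v *v oct_mult a b = oct_mult (x *v a) (v *v b) + oct_mult (v *v a) (x *v b)" for a b
  proof -
    have "((\<lambda>t. oct_mult (\<gamma> t *v a) (\<gamma> t *v b)) has_vector_derivative
        oct_mult (x *v a) (v *v b) + oct_mult (v *v a) (x *v b)) (at 0)"
      using bounded_bilinear.has_vector_derivative[OF bounded_bilinear_oct_mult mv[of a] mv[of b]] by (simp add: c(3))
    then have "((\<lambda>t. \<gamma> t *v oct_mult a b) has_vector_derivative
        oct_mult (x *v a) (v *v b) + oct_mult (v *v a) (x *v b)) (at 0)"
      by (rule has_vector_derivative_transform_within_open[of _ _ _ "{-\<epsilon><..<\<epsilon>}"])
        (use c(1,2) in \<open>auto simp: G2_mult_vec\<close>)
    from vector_derivative_unique_at[OF mv this] show ?thesis .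
  qed
  have xx: "transpose x *v (x *v a) = a" for a
    by (simp only: matrix_vector_mul_assoc G2_orthogonal[OF x] matrix_vector_mul_lid)
  have "transpose x *v (v *v oct_mult a b)
      = oct_mult a (transpose x *v (v *v b)) + oct_mult (transpose x *v (v *v a)) b" for a b
    by (simp only: e mv_simps G2_mult_vec[OF G2_transpose[OF x]] xx)
  then show ?thesis
    unfolding oct_der_def by (simp add: add.commute flip: matrix_vector_mul_assoc)
qed

lemma tangent_space_G2:
  assumes x: "x \<in> G2"
  shows "tangent_space G2 x = (\<lambda>A. x ** A) ` oct_der"
proof
  show "tangent_space G2 x \<subseteq> (\<lambda>A. x ** A) ` oct_der"
  proof
    fix v assume "v \<in> tangent_space G2 x"
    then obtain \<gamma> \<epsilon> where c: "\<epsilon> > 0" "\<And>t. t \<in> {-\<epsilon><..<\<epsilon>} \<Longrightarrow> \<gamma> t \<in> G2" "\<gamma> 0 = x"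
      "(\<gamma> has_vector_derivative v) (at (0::real))" by (rule tangent_spaceE) blast
    have "transpose x ** v \<in> oct_der" by (rule G2_curve_velocity[OF x c])
    moreover have "v = x ** (transpose x ** v)" using G2_orthogonal[OF x] by (simp add: matrix_mul_assoc)
    ultimately show "v \<in> (\<lambda>A. x ** A) ` oct_der" by blast
  qed
  show "(\<lambda>A. x ** A) ` oct_der \<subseteq> tangent_space G2 x"
  proof clarify
    fix A assume "A \<in> oct_der"
    then obtain \<gamma> where g: "smooth_on UNIV \<gamma>" "\<And>t. \<gamma> t \<in> G2" "\<gamma> 0 = mat 1" "(\<gamma> has_vector_derivative A) (at (0::real))"
      using has_curveE[OF has_curve_G2] by blast
    show "x ** A \<in> tangent_space G2 x"
    proof (rule tangent_spaceI)
      show "smooth_on UNIV (\<lambda>t. x ** \<gamma> t)"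
        by (rule smooth_on_bilinear[OF bounded_bilinear_matrix_mult smooth_on_const g(1)])
      show "((\<lambda>t. x ** \<gamma> t) has_vector_derivative x ** A) (at 0)"
        using bounded_bilinear.has_vector_derivative[OF bounded_bilinear_matrix_mult has_vector_derivative_const[of x] g(4)]
        by (simp add: mm_simps)
    qed (use g x in \<open>auto intro: G2_mult\<close>)
  qed
qed

lemma lie_g2_eq: "lie_g2 = oct_der"
  unfolding lie_g2_def using tangent_space_G2[OF G2_one] by simp

lemma metric_G2_eq:
  assumes x: "x \<in> G2" and u: "u \<in> tangent_space G2 x" and v: "v \<in> tangent_space G2 x"
  shows "metric_G2 x u v = (1/2) * (u \<bullet> v)"
proof -
  obtain A B where AB: "A \<in> oct_der" "B \<in> oct_der" "u = x ** A" "v = x ** B"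
    using u v tangent_space_G2[OF x] by auto
  then have "matrix_inv x ** u = A" "matrix_inv x ** v = B"
    using G2_orthogonal[OF x] by (simp_all add: G2_matrix_inv[OF x] matrix_mul_assoc)
  then show ?thesis
    using AB by (simp add: metric_G2_def killing_g2_def lie_g2_eq oct_der_trace_ad_ad G2_inner_mult_left[OF x])
qed

section \<open>The subgroups SU(3) and SO(4) and their Lie algebras\<close>

lemma matrix_inv_SU3: "k \<in> SU3 \<Longrightarrow> matrix_inv k = transpose k"
  by (simp add: SU3_def G2_matrix_inv)

lemma SU3_props:
  "mat 1 \<in> SU3" "A \<in> SU3 \<Longrightarrow> B \<in> SU3 \<Longrightarrow> A ** B \<in> SU3" "A \<in> SU3 \<Longrightarrow> transpose A \<in> SU3"
proof -
  show "mat 1 \<in> SU3" by (simp add: SU3_def G2_one)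
  show "A \<in> SU3 \<Longrightarrow> B \<in> SU3 \<Longrightarrow> A ** B \<in> SU3" by (simp add: SU3_def G2_mult flip: matrix_vector_mul_assoc)
  assume A: "A \<in> SU3"
  then have o: "transpose A ** A = mat 1" and e: "A *v oct_e 1 = oct_e 1"
    using G2_orthogonal[of A] by (simp_all add: SU3_def)
  have "transpose A *v (A *v oct_e 1) = oct_e 1"
    by (simp only: matrix_vector_mul_assoc o matrix_vector_mul_lid)
  then show "transpose A \<in> SU3" using A by (simp add: SU3_def G2_transpose e)
qed

lemma oct_sigma_nth_left: "(oct_sigma ** A) $ i $ j = (if i \<in> {0,1,2,3} then A$i$j else - A$i$j)"
  by (simp add: oct_sigma_def matrix_matrix_mult_def if_distrib[of "\<lambda>z. z * _"] sum.delta cong: if_cong)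

lemma oct_sigma_nth_right: "(A ** oct_sigma) $ i $ j = (if j \<in> {0,1,2,3} then A$i$j else - A$i$j)"
  by (simp add: oct_sigma_def matrix_matrix_mult_def if_distrib[of "\<lambda>z. _ * z"] sum.delta' cong: if_cong)

lemma oct_sigma_mult_vec: "(oct_sigma *v x) $ i = (if i \<in> {0,1,2,3} then x$i else - x$i)"
  by (simp add: oct_sigma_def matrix_vector_mult_def if_distrib[of "\<lambda>z. z * _"] sum.delta cong: if_cong)

lemma transpose_oct_sigma: "transpose oct_sigma = oct_sigma"
  by (auto simp: vec_eq_iff transpose_def oct_sigma_def)

lemma SO4_props:
  "mat 1 \<in> SO4" "A \<in> SO4 \<Longrightarrow> B \<in> SO4 \<Longrightarrow> A ** B \<in> SO4" "A \<in> SO4 \<Longrightarrow> transpose A \<in> SO4"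
proof -
  show "mat 1 \<in> SO4" by (simp add: SO4_def G2_one)
  show "A \<in> SO4 \<Longrightarrow> B \<in> SO4 \<Longrightarrow> A ** B \<in> SO4"
    by (simp add: SO4_def G2_mult matrix_mul_assoc) (simp flip: matrix_mul_assoc)
  assume A: "A \<in> SO4"
  then have "transpose (oct_sigma ** A) = transpose (A ** oct_sigma)" by (simp add: SO4_def)
  then show "transpose A \<in> SO4"
    using A by (simp add: SO4_def G2_transpose matrix_transpose_mul transpose_oct_sigma)
qed

lemma SO4_G2: "A \<in> SO4 \<Longrightarrow> A \<in> G2" and SU3_G2: "A \<in> SU3 \<Longrightarrow> A \<in> G2"
  by (simp_all add: SO4_def SU3_def)

lemma oct_der_frame_cube: "(l, b) \<in> set oct_der_frame \<Longrightarrow> b ** b ** b = - b"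
  unfolding oct_der_frame_def by (auto simp: bivec_diff_cube)

lemma rot_in_SU3: "b \<in> oct_der \<Longrightarrow> b ** b ** b = - b \<Longrightarrow> b *v oct_e 1 = 0 \<Longrightarrow> rot b t \<in> SU3"
  using rot_in_G2[of b t] by (simp add: SU3_def rot_def mv_simps flip: matrix_vector_mul_assoc)

lemma rot_in_SO4: "b \<in> oct_der \<Longrightarrow> b ** b ** b = - b \<Longrightarrow> oct_sigma ** b = b ** oct_sigma \<Longrightarrow> rot b t \<in> SO4"
proof -
  assume b: "b \<in> oct_der" "b ** b ** b = - b" and c: "oct_sigma ** b = b ** oct_sigma"
  have "oct_sigma ** (b ** b) = b ** b ** oct_sigma"
    by (metis c matrix_mul_assoc)
  then show ?thesis using rot_in_G2[OF b(2,1), of t] c by (simp add: SO4_def rot_def mm_simps)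
qed

lemma has_curve_SU3:
  assumes A: "A \<in> oct_der" and A1: "A *v oct_e 1 = 0"
  shows "has_curve SU3 A"
proof (rule has_curve_oct_der[OF A])
  fix l b assume lb: "(l, b) \<in> set oct_der_frame"
  have c: "A$k$1 = 0" for k
    using A1 by (simp add: vec_eq_iff oct_e_def matrix_vector_mult_basis column_def)
  have r: "A$1$k = 0" for k using c[of k] oct_der_entries(3)[OF A, of 1 k] by simp
  have "l A = 0 \<or> b *v oct_e 1 = 0"
    using lb unfolding oct_der_frame_def
    by (auto simp: c r vec_eq_iff oct_e_def matrix_vector_mult_basis column_def bivec_nth)
  then show "l A = 0 \<or> (\<forall>t. rot b t \<in> SU3)"
    using rot_in_SU3 oct_der_frame_props(1)[OF lb] oct_der_frame_cube[OF lb] by blast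
qed (auto intro: SU3_props)

text \<open>The two pairs of a generator either both respect the splitting of the indices into 0 to
  3 and 4 to 7, or both cross it. A derivation that commutes with \<open>oct_sigma\<close> has zero
  coordinates at the crossing pairs, so only commuting generators occur in it.\<close>

lemma has_curve_SO4:
  assumes A: "A \<in> oct_der" and c: "oct_sigma ** A = A ** oct_sigma"
  shows "has_curve SO4 A"
proof (rule has_curve_oct_der[OF A])
  fix l b assume lb: "(l, b) \<in> set oct_der_frame"
  have z: "A$i$j = 0" if "(i \<in> {0,1,2,3}) \<noteq> (j \<in> {0,1,2,3})" for i j
  proof -
    have "(oct_sigma ** A)$i$j = (A ** oct_sigma)$i$j" using c by simp
    then show ?thesis using that unfolding oct_sigma_nth_left oct_sigma_nth_right by (auto split: if_splits)
  qed
  have "l A = 0 \<or> oct_sigma ** b = b ** oct_sigma"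
    using lb unfolding oct_der_frame_def
    by (auto simp: z vec_eq_iff oct_sigma_nth_left oct_sigma_nth_right bivec_nth)
  then show "l A = 0 \<or> (\<forall>t. rot b t \<in> SO4)"
    using rot_in_SO4 oct_der_frame_props(1)[OF lb] oct_der_frame_cube[OF lb] by blast
qed (auto intro: SO4_props)

section \<open>Orbits and their representatives\<close>

lemma orbit_G2_eq: "orbit_G2 x = {h ** x ** k | h k. h \<in> SO4 \<and> k \<in> SU3}"
proof -
  have "\<exists>k'. k' \<in> SU3 \<and> matrix_inv k' = k" if "k \<in> SU3" for k
    using SU3_props(3)[OF that] matrix_inv_SU3[of "transpose k"] by (intro exI[of _ "transpose k"]) simp
  moreover have "matrix_inv k \<in> SU3" if "k \<in> SU3" for k
    using SU3_props(3)[OF that] matrix_inv_SU3[OF that] by simp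
  ultimately show ?thesis unfolding orbit_G2_def by blast
qed

lemma orbit_G2I: "h \<in> SO4 \<Longrightarrow> k \<in> SU3 \<Longrightarrow> h ** x ** k \<in> orbit_G2 x"
  unfolding orbit_G2_eq by blast

lemma orbit_G2_refl: "x \<in> orbit_G2 x"
  using orbit_G2I[OF SO4_props(1) SU3_props(1), of x] by simp

lemma orbit_G2_subset: "x \<in> G2 \<Longrightarrow> orbit_G2 x \<subseteq> G2"
  unfolding orbit_G2_eq by (auto intro: G2_mult SO4_G2 SU3_G2)

lemma orbit_G2_translate:
  assumes "h \<in> SO4" "k \<in> SU3" shows "y \<in> orbit_G2 x \<Longrightarrow> h ** y ** k \<in> orbit_G2 x"
proof -
  assume "y \<in> orbit_G2 x"
  then obtain h' k' where y: "y = h' ** x ** k'" "h' \<in> SO4" "k' \<in> SU3" unfolding orbit_G2_eq by blast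
  have "h ** y ** k = (h ** h') ** x ** (k' ** k)" by (simp add: y matrix_mul_assoc)
  then show ?thesis using orbit_G2I[OF SO4_props(2)[OF assms(1) y(2)] SU3_props(2)[OF y(3) assms(2)]] by metis
qed

lemma SO4_SU3_cancel:
  assumes "h \<in> SO4" "k \<in> SU3"
  shows "transpose h ** (h ** x ** k) ** transpose k = x" "h ** (transpose h ** x ** transpose k) ** k = x"
proof -
  note o = G2_orthogonal[OF SO4_G2[OF assms(1)]] G2_orthogonal[OF SU3_G2[OF assms(2)]]
  have "transpose h ** (h ** x ** k) ** transpose k = (transpose h ** h) ** x ** (k ** transpose k)"
    "h ** (transpose h ** x ** transpose k) ** k = (h ** transpose h) ** x ** (transpose k ** k)"
    by (simp_all only: matrix_mul_assoc)
  then show "transpose h ** (h ** x ** k) ** transpose k = x" "h ** (transpose h ** x ** transpose k) ** k = x"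
    by (simp_all add: o)
qed

lemma orbit_G2_eqI:
  assumes "y \<in> orbit_G2 x" shows "orbit_G2 y = orbit_G2 x"
proof -
  obtain h k where y: "y = h ** x ** k" "h \<in> SO4" "k \<in> SU3" using assms unfolding orbit_G2_eq by blast
  have x: "x = transpose h ** y ** transpose k" using SO4_SU3_cancel[OF y(2,3), of x] y(1) by simp
  have "x \<in> orbit_G2 y" using orbit_G2I[OF SO4_props(3)[OF y(2)] SU3_props(3)[OF y(3)]] x by metis
  then have "orbit_G2 x \<subseteq> orbit_G2 y"
    using orbit_G2_translate unfolding orbit_G2_eq[of x] by blast
  moreover have "orbit_G2 y \<subseteq> orbit_G2 x"
    using orbit_G2_translate assms unfolding orbit_G2_eq[of y] by blast
  ultimately show ?thesis by simp
qed

definition sigma_height :: "real^8^8 \<Rightarrow> real" where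
  "sigma_height y = (y *v oct_e 1) \<bullet> (oct_sigma *v (y *v oct_e 1))"

lemma sigma_height_orbit:
  assumes "y \<in> orbit_G2 x" shows "sigma_height y = sigma_height x"
proof -
  obtain h k where y: "y = h ** x ** k" "h \<in> SO4" "k \<in> SU3" using assms unfolding orbit_G2_eq by blast
  have "y *v oct_e 1 = h *v (x *v oct_e 1)"
    using y by (simp add: SU3_def flip: matrix_vector_mul_assoc)
  moreover have "oct_sigma *v (h *v z) = h *v (oct_sigma *v z)" for z
    using y(2) by (simp add: SO4_def matrix_vector_mul_assoc)
  ultimately show ?thesis by (simp add: sigma_height_def G2_inner[OF SO4_G2[OF y(2)]])
qed

lemma rot_bivec_mult_vec:
  assumes "i \<noteq> j" "k \<noteq> l" "i \<noteq> k" "i \<noteq> l" "j \<noteq> k" "j \<noteq> l"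
  shows "(rot (bivec i j - bivec k l) t *v x) $ a =
    (if a = i then cos t * x$i + sin t * x$j else if a = j then cos t * x$j - sin t * x$i
     else if a = k then cos t * x$k - sin t * x$l else if a = l then cos t * x$l + sin t * x$k else x$a)"
  using assms
  by (auto simp: rot_def mv_simps bivec_mult_vec algebra_simps simp flip: matrix_vector_mul_assoc)

lemma polar_nonneg: "\<exists>r\<ge>0. \<exists>t. (x::real) = r * cos t \<and> y = r * sin t"
proof -
  obtain r a where ra: "x = r * cos a" "y = r * sin a" using polar_Ex by blast
  show ?thesis
  proof (cases "r \<ge> 0")
    case False
    then show ?thesis using ra by (intro exI[of _ "- r"] conjI exI[of _ "a + pi"]) auto
  qed (use ra in blast)
qed

text \<open>The angle is the polar angle of \<open>p\<close> in the plane of \<open>i\<close> and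
  \<open>j\<close>. The rotation also turns the plane of \<open>k\<close> and \<open>l\<close>; the
  clause on zeros there ensures that successive eliminations do not undo each other.\<close>

lemma rotate_to_axis:
  assumes "distinct [i, j, k, l]"
  obtains t q where "q = rot (bivec i j - bivec k l) t *v p" "q$j = 0" "q$i \<ge> 0"
    "p$k = 0 \<and> p$l = 0 \<longrightarrow> q$k = 0 \<and> q$l = 0" "\<forall>a. a \<noteq> i \<and> a \<noteq> j \<and> a \<noteq> k \<and> a \<noteq> l \<longrightarrow> q$a = p$a"
proof -
  have d: "i \<noteq> j" "k \<noteq> l" "i \<noteq> k" "i \<noteq> l" "j \<noteq> k" "j \<noteq> l" using assms by auto
  obtain r t where r: "r \<ge> 0" "p$i = r * cos t" "p$j = r * sin t" using polar_nonneg by blast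
  have "cos t * cos t + sin t * sin t = 1"
    using sin_cos_squared_add2[of t] by (simp add: power2_eq_square)
  moreover have "cos t * (r * cos t) + sin t * (r * sin t) = r * (cos t * cos t + sin t * sin t)"
    by (simp only: ring_distribs mult_ac)
  ultimately have c: "cos t * p$i + sin t * p$j = r" by (simp only: r mult_1_right)
  have s: "cos t * p$j - sin t * p$i = 0" by (simp add: r)
  define q where "q = rot (bivec i j - bivec k l) t *v p"
  have "q$i = cos t * p$i + sin t * p$j" "q$j = cos t * p$j - sin t * p$i"
    "q$k = cos t * p$k - sin t * p$l" "q$l = cos t * p$l + sin t * p$k"
    "\<forall>a. a \<noteq> i \<and> a \<noteq> j \<and> a \<noteq> k \<and> a \<noteq> l \<longrightarrow> q$a = p$a"
    using d by (simp_all add: q_def rot_bivec_mult_vec[OF d])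
  then show ?thesis
    using r(1) by (intro that[OF q_def]) (simp_all add: c s)
qed

lemma bivec_swap: "i \<noteq> j \<Longrightarrow> bivec i j = - bivec j i"
  by (auto simp: vec_eq_iff bivec_nth)

lemma oct_sigma_commuteI:
  assumes "\<And>a b. (a \<in> {0,1,2,3}) \<noteq> (b \<in> {0,1,2,3}) \<Longrightarrow> A$a$b = 0"
  shows "oct_sigma ** A = A ** oct_sigma"
proof -
  have "(if P then z else - z) = (if Q then z else - z)" if "P \<noteq> Q \<Longrightarrow> z = 0" for P Q and z :: real
    using that by auto
  then show ?thesis
    unfolding vec_eq_iff oct_sigma_nth_left oct_sigma_nth_right using assms by blast
qed

lemma bivec_nth_off_block: "(i \<in> S) = (j \<in> S) \<Longrightarrow> (a \<in> S) \<noteq> (b \<in> S) \<Longrightarrow> bivec i j $ a $ b = 0"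
  by (auto simp: bivec_nth)

lemma rot_bivec_in_SO4:
  assumes "bivec i j - bivec k l \<in> oct_der" "i \<noteq> j" "k \<noteq> l" "i \<noteq> k" "i \<noteq> l" "j \<noteq> k" "j \<noteq> l"
    and "(i \<in> {0,1,2,3}) = (j \<in> {0,1,2,3})" "(k \<in> {0,1,2,3}) = (l \<in> {0,1,2,3})"
  shows "rot (bivec i j - bivec k l) t \<in> SO4"
proof (rule rot_in_SO4[OF assms(1) bivec_diff_cube[OF assms(2-7)]])
  show "oct_sigma ** (bivec i j - bivec k l) = (bivec i j - bivec k l) ** oct_sigma"
  proof (rule oct_sigma_commuteI)
    fix a b :: 8
    assume "(a \<in> {0,1,2,3}) \<noteq> (b \<in> {0,1,2,3})"
    from bivec_nth_off_block[OF assms(8) this] bivec_nth_off_block[OF assms(9) this]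
    show "(bivec i j - bivec k l)$a$b = 0" by (simp only: vector_minus_component diff_self)
  qed
qed

text \<open>Coordinates 3 and 2 are cleared first, which may disturb 5, 6 and 7. The rotations that
  then clear 5, 7 and 6 either avoid the coordinates cleared before or turn planes in which both
  coordinates are already zero. A unit vector in the plane of \<open>e_1\<close> and
  \<open>e_4\<close> with nonnegative coordinates is left.\<close>

lemma SO4_normal_form:
  fixes p :: "real^8"
  assumes "p$0 = 0" "p \<bullet> p = 1"
  obtains h t where "h \<in> SO4" "0 \<le> t" "t \<le> pi/2" "h *v p = cos t *\<^sub>R axis 1 1 + sin t *\<^sub>R axis 4 1"
proof -
  have gens: "bivec 2 3 - bivec 6 7 \<in> oct_der" "bivec 1 2 - bivec 5 6 \<in> oct_der" "bivec 4 5 - bivec 6 7 \<in> oct_der"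
    "bivec 6 7 - bivec 2 3 \<in> oct_der" "bivec 4 6 - bivec 7 5 \<in> oct_der"
    using oct_der_generators subspace_neg[OF oct_der_subspace oct_der_generators(1)]
    by (simp_all add: bivec_swap[of 4 6] bivec_swap[of 7 5])
  have d1: "distinct [2, 3, 6, 7 :: 8]" by simp
  obtain t1 q1 where Q1: "q1 = rot (bivec 2 3 - bivec 6 7) t1 *v p" "q1$3 = 0" "q1$2 \<ge> 0"
    "p$6 = 0 \<and> p$7 = 0 \<longrightarrow> q1$6 = 0 \<and> q1$7 = 0" "\<forall>a. a \<noteq> 2 \<and> a \<noteq> 3 \<and> a \<noteq> 6 \<and> a \<noteq> 7 \<longrightarrow> q1$a = p$a"
    by (rule rotate_to_axis[OF d1, of p])
  have 1: "q1$3 = 0" "q1$0 = 0"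
    using Q1(2-5) assms by simp_all
  have d2: "distinct [1, 2, 5, 6 :: 8]" by simp
  obtain t2 q2 where Q2: "q2 = rot (bivec 1 2 - bivec 5 6) t2 *v q1" "q2$2 = 0" "q2$1 \<ge> 0"
    "q1$5 = 0 \<and> q1$6 = 0 \<longrightarrow> q2$5 = 0 \<and> q2$6 = 0" "\<forall>a. a \<noteq> 1 \<and> a \<noteq> 2 \<and> a \<noteq> 5 \<and> a \<noteq> 6 \<longrightarrow> q2$a = q1$a"
    by (rule rotate_to_axis[OF d2, of q1])
  have 2: "q2$2 = 0" "q2$3 = 0" "q2$0 = 0" "q2$1 \<ge> 0"
    using Q2(2-5) 1 by simp_all
  have d3: "distinct [4, 5, 6, 7 :: 8]" by simp
  obtain t3 q3 where Q3: "q3 = rot (bivec 4 5 - bivec 6 7) t3 *v q2" "q3$5 = 0" "q3$4 \<ge> 0"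
    "q2$6 = 0 \<and> q2$7 = 0 \<longrightarrow> q3$6 = 0 \<and> q3$7 = 0" "\<forall>a. a \<noteq> 4 \<and> a \<noteq> 5 \<and> a \<noteq> 6 \<and> a \<noteq> 7 \<longrightarrow> q3$a = q2$a"
    by (rule rotate_to_axis[OF d3, of q2])
  have 3: "q3$5 = 0" "q3$2 = 0" "q3$3 = 0" "q3$0 = 0" "q3$1 \<ge> 0"
    using Q3(2-5) 2 by simp_all
  have d4: "distinct [6, 7, 2, 3 :: 8]" by simp
  obtain t4 q4 where Q4: "q4 = rot (bivec 6 7 - bivec 2 3) t4 *v q3" "q4$7 = 0" "q4$6 \<ge> 0"
    "q3$2 = 0 \<and> q3$3 = 0 \<longrightarrow> q4$2 = 0 \<and> q4$3 = 0" "\<forall>a. a \<noteq> 6 \<and> a \<noteq> 7 \<and> a \<noteq> 2 \<and> a \<noteq> 3 \<longrightarrow> q4$a = q3$a"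
    by (rule rotate_to_axis[OF d4, of q3])
  have 4: "q4$7 = 0" "q4$5 = 0" "q4$2 = 0" "q4$3 = 0" "q4$0 = 0" "q4$1 \<ge> 0"
    using Q4(2-5) 3 by simp_all
  have d5: "distinct [4, 6, 7, 5 :: 8]" by simp
  obtain t5 q5 where Q5: "q5 = rot (bivec 4 6 - bivec 7 5) t5 *v q4" "q5$6 = 0" "q5$4 \<ge> 0"
    "q4$7 = 0 \<and> q4$5 = 0 \<longrightarrow> q5$7 = 0 \<and> q5$5 = 0" "\<forall>a. a \<noteq> 4 \<and> a \<noteq> 6 \<and> a \<noteq> 7 \<and> a \<noteq> 5 \<longrightarrow> q5$a = q4$a"
    by (rule rotate_to_axis[OF d5, of q4])
  have 5: "q5$6 = 0" "q5$7 = 0" "q5$5 = 0" "q5$2 = 0" "q5$3 = 0" "q5$0 = 0" "q5$4 \<ge> 0" "q5$1 \<ge> 0"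
    using Q5(2-5) 4 by simp_all
  define h where "h = rot (bivec 4 6 - bivec 7 5) t5 ** (rot (bivec 6 7 - bivec 2 3) t4 ** (rot (bivec 4 5 - bivec 6 7) t3
      ** (rot (bivec 1 2 - bivec 5 6) t2 ** rot (bivec 2 3 - bivec 6 7) t1)))"
  have h: "h \<in> SO4"
    unfolding h_def by (intro SO4_props(2) rot_bivec_in_SO4 gens) simp_all
  have hp: "h *v p = q5" unfolding h_def Q5(1) Q4(1) Q3(1) Q2(1) Q1(1) by (simp add: matrix_vector_mul_assoc matrix_mul_assoc)
  have "q5 \<bullet> q5 = 1" using G2_inner[OF SO4_G2[OF h], of p p] assms(2) hp by simp
  then have "(q5$1)\<^sup>2 + (q5$4)\<^sup>2 = 1" using 5 by (simp add: inner_vec_def sum_8 power2_eq_square)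
  then obtain t where t: "0 \<le> t" "t \<le> pi/2" "q5$1 = cos t" "q5$4 = sin t"
    using sincos_total_pi_half 5 by metis
  have "q5 = cos t *\<^sub>R axis 1 1 + sin t *\<^sub>R axis 4 1"
    using 5 t by (simp add: vec_eq_iff forall_8 axis_nth_if)
  then show ?thesis using that[OF h t(1,2)] hp by simp
qed

text \<open>The generator turns \<open>e_1\<close> towards \<open>e_4\<close>, so that
  \<open>e_1\<close> is sent to the normal form of \<open>SO4_normal_form\<close>; the plane of
  \<open>e_2\<close> and \<open>e_7\<close> has to turn along for the map to be an
  automorphism.\<close>

definition model_point :: "real \<Rightarrow> real^8^8" where
  "model_point t = rot (bivec 4 1 - bivec 2 7) t"

lemma model_generator: "bivec 4 1 - bivec 2 7 \<in> oct_der"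
  using subspace_neg[OF oct_der_subspace oct_der_generators(9)] by (simp add: bivec_swap[of 4 1] bivec_swap[of 2 7])

lemma model_point_G2: "model_point t \<in> G2"
  unfolding model_point_def by (rule rot_in_G2[OF bivec_diff_cube model_generator]) simp_all

lemma model_point_mult_vec:
  "(model_point t *v x) $ a = (if a = 4 then cos t * x$4 + sin t * x$1 else if a = 1 then cos t * x$1 - sin t * x$4
     else if a = 2 then cos t * x$2 - sin t * x$7 else if a = 7 then cos t * x$7 + sin t * x$2 else x$a)"
  unfolding model_point_def by (rule rot_bivec_mult_vec) simp_all

lemma model_point_e1: "model_point t *v oct_e 1 = cos t *\<^sub>R axis 1 1 + sin t *\<^sub>R axis 4 1"
  by (simp add: vec_eq_iff model_point_mult_vec oct_e_def axis_nth_if)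

text \<open>Some \<open>h\<close> in \<open>SO4\<close> brings \<open>x *v oct_e 1\<close> into
  normal form. Then \<open>h ** x\<close> and the model point agree on \<open>e_1\<close> and hence
  differ by an element of \<open>SU3\<close> on the right.\<close>

lemma in_orbit_model_point:
  assumes x: "x \<in> G2"
  obtains t where "0 \<le> t" "t \<le> pi/2" "x \<in> orbit_G2 (model_point t)"
proof -
  let ?p = "x *v oct_e 1"
  have "?p $ 0 = 0" "?p \<bullet> ?p = 1"
    using G2_norm_imaginary[OF x, of "oct_e 1"] by (simp_all add: oct_e_def axis_nth_if inner_axis)
  then obtain h t where h: "h \<in> SO4" "0 \<le> t" "t \<le> pi/2" "h *v ?p = cos t *\<^sub>R axis 1 1 + sin t *\<^sub>R axis 4 1"
    by (rule SO4_normal_form)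
  let ?m = "model_point t"
  note om = G2_orthogonal[OF model_point_G2[of t]] and oh = G2_orthogonal[OF SO4_G2[OF h(1)]]
  define k where "k = transpose ?m ** (h ** x)"
  have "k *v oct_e 1 = transpose ?m *v (?m *v oct_e 1)"
    using h(4) by (simp add: k_def model_point_e1 flip: matrix_vector_mul_assoc)
  also have "\<dots> = oct_e 1" by (simp only: matrix_vector_mul_assoc om matrix_vector_mul_lid)
  finally have k: "k \<in> SU3"
    unfolding SU3_def k_def using G2_mult[OF G2_transpose[OF model_point_G2] G2_mult[OF SO4_G2[OF h(1)] x]] by simp
  have "transpose h ** ?m ** k = transpose h ** (?m ** transpose ?m) ** h ** x"
    by (simp only: k_def matrix_mul_assoc)
  also have "\<dots> = x" by (simp add: om oh)
  finally have "x \<in> orbit_G2 ?m" using orbit_G2I[OF SO4_props(3)[OF h(1)] k, of ?m] by simp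
  then show ?thesis using that h(2,3) by blast
qed

lemma tangent_space_linear_image:
  assumes L: "bounded_linear L" and M: "\<And>y. y \<in> M \<Longrightarrow> L y \<in> M'" and v: "v \<in> tangent_space M x"
  shows "L v \<in> tangent_space M' (L x)"
proof -
  obtain \<gamma> \<epsilon> where c: "\<epsilon> > 0 \<and> smooth_on {-\<epsilon><..<\<epsilon>} \<gamma> \<and> (\<forall>t\<in>{-\<epsilon><..<\<epsilon>}. \<gamma> t \<in> M)
      \<and> \<gamma> 0 = x \<and> (\<gamma> has_vector_derivative v) (at (0::real))"
    using v unfolding tangent_space_def by blast
  then show ?thesis unfolding tangent_space_def
    using M smooth_on_bounded_linear[OF L, of "{-\<epsilon><..<\<epsilon>}" \<gamma>] bounded_linear.has_vector_derivative[OF L, of \<gamma> v]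
    by (intro CollectI exI[of _ "\<lambda>t. L (\<gamma> t)"] exI[of _ \<epsilon>]) auto
qed

lemma bounded_linear_translate: "bounded_linear (\<lambda>v. h ** v ** k)" for h k :: "real^8^8"
  using bounded_linear_compose[OF bounded_bilinear.bounded_linear_left[OF bounded_bilinear_matrix_mult, of k]
      bounded_bilinear.bounded_linear_right[OF bounded_bilinear_matrix_mult, of h]] by simp

lemma tangent_space_orbit_translate:
  assumes h: "h \<in> SO4" and k: "k \<in> SU3"
  shows "tangent_space (orbit_G2 x) (h ** y ** k) = (\<lambda>v. h ** v ** k) ` tangent_space (orbit_G2 x) y"
proof
  show "(\<lambda>v. h ** v ** k) ` tangent_space (orbit_G2 x) y \<subseteq> tangent_space (orbit_G2 x) (h ** y ** k)"
    using tangent_space_linear_image[OF bounded_linear_translate] orbit_G2_translate[OF h k] by (intro image_subsetI) blast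
  show "tangent_space (orbit_G2 x) (h ** y ** k) \<subseteq> (\<lambda>v. h ** v ** k) ` tangent_space (orbit_G2 x) y"
  proof
    fix v assume "v \<in> tangent_space (orbit_G2 x) (h ** y ** k)"
    from tangent_space_linear_image[OF bounded_linear_translate orbit_G2_translate[OF SO4_props(3)[OF h] SU3_props(3)[OF k]] this]
    have "transpose h ** v ** transpose k \<in> tangent_space (orbit_G2 x) y"
      by (simp add: SO4_SU3_cancel[OF h k])
    then show "v \<in> (\<lambda>v. h ** v ** k) ` tangent_space (orbit_G2 x) y"
      using SO4_SU3_cancel(2)[OF h k, of v] by (intro image_eqI[of _ _ "transpose h ** v ** transpose k"]) auto
  qed
qed

lemma tangent_space_mono: "M \<subseteq> N \<Longrightarrow> tangent_space M x \<subseteq> tangent_space N x"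
  unfolding tangent_space_def by blast

lemma symmetric_oct_sigma: "(oct_sigma *v a) \<bullet> b = a \<bullet> (oct_sigma *v b)"
  by (auto simp: inner_vec_def oct_sigma_mult_vec intro!: sum.cong)

lemma sigma_height_has_derivative:
  "(sigma_height has_derivative (\<lambda>v. 2 * ((v *v oct_e 1) \<bullet> (oct_sigma *v (x *v oct_e 1))))) (at x within S)"
proof -
  note B = bounded_bilinear.bounded_linear_left[OF bounded_bilinear_matrix_vec, of "oct_e 1"]
  have 1: "((\<lambda>y. y *v oct_e 1) has_derivative (\<lambda>v. v *v oct_e 1)) (at x within S)"
    by (rule bounded_linear_imp_has_derivative[OF B])
  have 2: "((\<lambda>y. oct_sigma *v (y *v oct_e 1)) has_derivative (\<lambda>v. oct_sigma *v (v *v oct_e 1))) (at x within S)"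
    by (rule bounded_linear.has_derivative[OF bounded_bilinear.bounded_linear_right[OF bounded_bilinear_matrix_vec] 1])
  have "(sigma_height has_derivative (\<lambda>v. (x *v oct_e 1) \<bullet> (oct_sigma *v (v *v oct_e 1))
      + (v *v oct_e 1) \<bullet> (oct_sigma *v (x *v oct_e 1)))) (at x within S)"
    unfolding sigma_height_def by (rule has_derivative_inner[OF 1 2])
  moreover have "(x *v oct_e 1) \<bullet> (oct_sigma *v (v *v oct_e 1)) = (v *v oct_e 1) \<bullet> (oct_sigma *v (x *v oct_e 1))" for v
    using symmetric_oct_sigma[of "x *v oct_e 1" "v *v oct_e 1"] by (simp only: inner_commute)
  ultimately show ?thesis by (simp only: mult_2)
qed

lemma tangent_orbit_height:
  assumes v: "v \<in> tangent_space (orbit_G2 x) y"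
  shows "(v *v oct_e 1) \<bullet> (oct_sigma *v (y *v oct_e 1)) = 0"
proof -
  note d = sigma_height_has_derivative[of y "orbit_G2 x"]
  obtain \<gamma> \<epsilon> where c: "\<epsilon> > 0" "\<And>t. t \<in> {-\<epsilon><..<\<epsilon>} \<Longrightarrow> \<gamma> t \<in> orbit_G2 x" "\<gamma> 0 = y"
    "(\<gamma> has_vector_derivative v) (at (0::real))" using tangent_spaceE[OF v] by blast
  have "y \<in> orbit_G2 x" using c(1) c(2)[of 0] c(3) by simp
  have "((\<lambda>z. sigma_height x) has_derivative (\<lambda>v. 2 * ((v *v oct_e 1) \<bullet> (oct_sigma *v (y *v oct_e 1))))) (at y within orbit_G2 x)"
    by (rule has_derivative_transform[OF \<open>y \<in> orbit_G2 x\<close> _ d]) (rule sigma_height_orbit[symmetric])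
  from differential_eq[OF this v] differential_eq[OF has_derivative_const[of "sigma_height x"] v]
  show ?thesis by simp
qed

section \<open>The connection of \<open>G\<^sub>2\<close> and the gradient of the height\<close>

abbreviation der_proj :: "real^8^8 \<Rightarrow> real^8^8" where "der_proj \<equiv> oproj oct_der"

lemmas der_proj_in = oproj_props(1)[OF oct_der_subspace]
lemmas der_proj_inner = oproj_inner[OF oct_der_subspace]
lemmas der_proj_id = oproj_id[OF oct_der_subspace]
lemmas der_proj_linear = oproj_linear[OF oct_der_subspace]
lemmas der_proj_eqI = oproj_eqI[OF oct_der_subspace]

lemma transpose_nth: "transpose A $ i $ j = A $ j $ i"
  by (simp add: transpose_def)

lemma transpose_oct_der: "A \<in> oct_der \<Longrightarrow> transpose A = - A"
  unfolding vec_eq_iff transpose_nth vector_uminus_component using oct_der_entries(3) by blast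

lemma bounded_linear_transpose: "bounded_linear (transpose :: real^8^8 \<Rightarrow> real^8^8)"
  by (simp add: linear_conv_bounded_linear[symmetric] linearI vec_eq_iff transpose_nth)

text \<open>The symmetric part of a product of two derivations is orthogonal to the skew matrices.\<close>

lemma der_proj_mult:
  assumes A: "A \<in> oct_der" and B: "B \<in> oct_der"
  shows "der_proj (A ** B) = (1/2) *\<^sub>R commutator A B"
proof (rule der_proj_eqI)
  show "(1/2) *\<^sub>R commutator A B \<in> oct_der"
    by (intro subspace_scale[OF oct_der_subspace] oct_der_commutator A B)
  fix C assume C: "C \<in> oct_der"
  have "transpose (A ** B) = B ** A"
    by (simp add: matrix_transpose_mul transpose_oct_der[OF A] transpose_oct_der[OF B] mm_simps)
  then have "(B ** A) \<bullet> C = - ((A ** B) \<bullet> C)"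
    using inner_matrix_transpose[of "A ** B" C] by (simp add: transpose_oct_der[OF C])
  then show "(A ** B - (1/2) *\<^sub>R commutator A B) \<bullet> C = 0"
    by (simp add: commutator_def inner_diff_left inner_diff_right)
qed

lemma inner_commutator:
  assumes "A \<in> oct_der"
  shows "commutator A B \<bullet> C = - (B \<bullet> commutator A C)"
  by (simp add: commutator_def inner_diff_left inner_diff_right inner_matrix_mult_left[of A B]
      inner_matrix_mult_right[of B A] transpose_oct_der[OF assms] mm_simps)

lemma oct_der_conj:
  assumes k: "k \<in> G2" and A: "A \<in> oct_der"
  shows "transpose k ** A ** k \<in> oct_der"
proof -
  have kk: "transpose k *v (k *v a) = a" for a
    by (simp only: matrix_vector_mul_assoc G2_orthogonal[OF k] matrix_vector_mul_lid)
  have "transpose k *v (A *v (k *v oct_mult a b)) = oct_mult (transpose k *v (A *v (k *v a))) b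
      + oct_mult a (transpose k *v (A *v (k *v b)))" for a b
    using A unfolding oct_der_def
    by (simp only: mem_Collect_eq G2_mult_vec[OF k] mv_simps G2_mult_vec[OF G2_transpose[OF k]] kk)
  then show ?thesis unfolding oct_der_def by (simp flip: matrix_vector_mul_assoc)
qed

lemma G2_conj_cancel:
  assumes "k \<in> G2"
  shows "transpose k ** (k ** A ** transpose k) ** k = A" "k ** (transpose k ** A ** k) ** transpose k = A"
proof -
  have "transpose k ** (k ** A ** transpose k) ** k = (transpose k ** k) ** A ** (transpose k ** k)"
    "k ** (transpose k ** A ** k) ** transpose k = (k ** transpose k) ** A ** (k ** transpose k)"
    by (simp_all only: matrix_mul_assoc)
  then show "transpose k ** (k ** A ** transpose k) ** k = A" "k ** (transpose k ** A ** k) ** transpose k = A"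
    by (simp_all add: G2_orthogonal[OF assms])
qed

lemma inner_conj:
  assumes "k \<in> G2"
  shows "(transpose k ** A ** k) \<bullet> B = A \<bullet> (k ** B ** transpose k)"
  by (simp only: inner_matrix_mult_right[of "transpose k ** A" k B] inner_matrix_mult_left[of "transpose k" A]
      transpose_transpose matrix_mul_assoc)

lemma der_proj_conj:
  assumes k: "k \<in> G2"
  shows "der_proj (transpose k ** M ** k) = transpose k ** der_proj M ** k"
proof (rule der_proj_eqI)
  show "transpose k ** der_proj M ** k \<in> oct_der" by (rule oct_der_conj[OF k der_proj_in])
  fix B assume B: "B \<in> oct_der"
  have "k ** B ** transpose k \<in> oct_der" using oct_der_conj[OF G2_transpose[OF k] B] by simp
  then show "(transpose k ** M ** k - transpose k ** der_proj M ** k) \<bullet> B = 0"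
    by (simp add: inner_diff_left inner_conj[OF k] der_proj_inner)
qed

text \<open>Left multiplication by \<open>y\<close> is an isometry of the matrix space, so for
  \<open>y\<close> in the group this is the orthogonal projection onto the tangent space at
  \<open>y\<close>.\<close>

definition G2_proj :: "real^8^8 \<Rightarrow> real^8^8 \<Rightarrow> real^8^8" where
  "G2_proj y w = y ** der_proj (transpose y ** w)"

lemma G2_proj_left: "y \<in> G2 \<Longrightarrow> G2_proj y (y ** B) = y ** der_proj B"
  by (simp add: G2_proj_def matrix_mul_assoc G2_orthogonal)

lemma smooth_map_mult: "smooth_map N f \<Longrightarrow> smooth_map N g \<Longrightarrow> smooth_map N (\<lambda>y. f y ** g y)"
  for f g :: "'a::euclidean_space \<Rightarrow> real^8^8"
  by (rule smooth_map_bilinear[OF bounded_bilinear_matrix_mult])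

lemma smooth_map_transpose: "smooth_map N f \<Longrightarrow> smooth_map N (\<lambda>y. transpose (f y))"
  for f :: "'a::euclidean_space \<Rightarrow> real^8^8"
  by (rule smooth_map_bounded_linear[OF bounded_linear_transpose])

lemma smooth_map_der_proj: "smooth_map N f \<Longrightarrow> smooth_map N (\<lambda>y. der_proj (f y))"
  by (rule smooth_map_bounded_linear[OF oproj_bounded_linear[OF oct_der_subspace]])

lemma left_invariant_cancel: "x \<in> G2 \<Longrightarrow> transpose x ** (x ** A) = A" "x \<in> G2 \<Longrightarrow> x ** (transpose x ** A) = A"
  by (simp_all add: matrix_mul_assoc G2_orthogonal)

lemma tangent_G2_iff:
  assumes "x \<in> G2"
  shows "v \<in> tangent_space G2 x \<longleftrightarrow> transpose x ** v \<in> oct_der"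
proof
  show "v \<in> tangent_space G2 x \<Longrightarrow> transpose x ** v \<in> oct_der"
    unfolding tangent_space_G2[OF assms] by (auto simp: left_invariant_cancel[OF assms])
  show "transpose x ** v \<in> oct_der \<Longrightarrow> v \<in> tangent_space G2 x"
    unfolding tangent_space_G2[OF assms]
    by (rule image_eqI[of _ _ "transpose x ** v"]) (simp_all add: left_invariant_cancel[OF assms])
qed

text \<open>In the left trivialisation \<open>Y y = y \<eta>(y)\<close> a vector field is a map into the derivations,
  and so is its derivative.\<close>

lemma G2_field_differential:
  assumes Y: "Y \<in> vector_fields G2" and x: "x \<in> G2" and v: "v \<in> tangent_space G2 x"
  obtains B where "B \<in> oct_der" "differential G2 Y x v = v ** (transpose x ** Y x) + x ** B"
proof -
  define \<eta> where "\<eta> y = transpose y ** Y y" for y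
  have eta_in: "\<eta> y \<in> oct_der" if "y \<in> G2" for y
    using vector_fieldsD(2)[OF Y that] that by (simp add: \<eta>_def tangent_G2_iff)
  have "smooth_map G2 \<eta>"
    unfolding \<eta>_def by (intro smooth_map_mult smooth_map_transpose smooth_map_id vector_fieldsD(1)[OF Y])
  then have d: "(\<eta> has_derivative frechet_derivative \<eta> (at x within G2)) (at x within G2)"
    by (rule smooth_map_has_derivative[OF _ x])
  let ?B = "frechet_derivative \<eta> (at x within G2) v"
  have "((\<lambda>y. \<eta> y - der_proj (\<eta> y)) has_derivative
      (\<lambda>h. frechet_derivative \<eta> (at x within G2) h - der_proj (frechet_derivative \<eta> (at x within G2) h))) (at x within G2)"
    by (intro has_derivative_diff d bounded_linear.has_derivative[OF oproj_bounded_linear[OF oct_der_subspace]])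
  then have "((\<lambda>y. 0) has_derivative
      (\<lambda>h. frechet_derivative \<eta> (at x within G2) h - der_proj (frechet_derivative \<eta> (at x within G2) h))) (at x within G2)"
    by (rule has_derivative_transform[OF x, rotated]) (simp add: der_proj_id eta_in)
  from differential_eq[OF this v] differential_eq[OF has_derivative_const[of "0 :: real^8^8"] v]
  have "?B = der_proj ?B" by simp
  then have B: "?B \<in> oct_der" using der_proj_in by metis
  have "((\<lambda>y. y ** \<eta> y) has_derivative (\<lambda>h. x ** frechet_derivative \<eta> (at x within G2) h + h ** \<eta> x)) (at x within G2)"
    by (rule bounded_bilinear.FDERIV[OF bounded_bilinear_matrix_mult has_derivative_ident d])
  then have "(Y has_derivative (\<lambda>h. x ** frechet_derivative \<eta> (at x within G2) h + h ** \<eta> x)) (at x within G2)"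
    by (rule has_derivative_transform[OF x, rotated]) (simp add: \<eta>_def left_invariant_cancel)
  from differential_eq[OF this v] have "differential G2 Y x v = v ** (transpose x ** Y x) + x ** ?B"
    by (simp add: \<eta>_def add.commute)
  with B show ?thesis by (rule that)
qed

interpretation G2: induced_metric G2 metric_G2 G2_proj "1/2"
proof (rule induced_metric.intro)
  show "(1/2 :: real) > 0" by simp
  fix x :: "real^8^8" assume x: "x \<in> G2"
  show "metric_G2 x u v = 1/2 * (u \<bullet> v)" if "u \<in> tangent_space G2 x" "v \<in> tangent_space G2 x" for u v
    by (rule metric_G2_eq[OF x that])
  show "linear (G2_proj x)"
    unfolding G2_proj_def
    by (rule linearI) (simp_all add: mm_simps linear_add[OF der_proj_linear] linear_scale[OF der_proj_linear])
  show "G2_proj x v \<in> tangent_space G2 x" for v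
    unfolding G2_proj_def tangent_space_G2[OF x] using der_proj_in by blast
  show "G2_proj x v = v" if "v \<in> tangent_space G2 x" for v
    using that unfolding tangent_space_G2[OF x] by (auto simp: G2_proj_left[OF x] der_proj_id)
  show "G2_proj x v \<bullet> u = v \<bullet> u" if "u \<in> tangent_space G2 x" for u v
  proof -
    have u: "transpose x ** u \<in> oct_der" using that tangent_G2_iff[OF x] by blast
    have "G2_proj x v \<bullet> u = (transpose x ** v) \<bullet> (transpose x ** u)"
      unfolding G2_proj_def inner_matrix_mult_left[of x] by (rule der_proj_inner[OF u])
    then show ?thesis by (simp add: G2_inner_mult_left[OF G2_transpose[OF x]])
  qed
  fix X Y assume X: "X \<in> vector_fields G2" and Y: "Y \<in> vector_fields G2"
  obtain B where B: "B \<in> oct_der" "differential G2 Y x (X x) = X x ** (transpose x ** Y x) + x ** B"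
    by (rule G2_field_differential[OF Y x vector_fieldsD(2)[OF X x]])
  obtain C where C: "C \<in> oct_der" "differential G2 X x (Y x) = Y x ** (transpose x ** X x) + x ** C"
    by (rule G2_field_differential[OF X x vector_fieldsD(2)[OF Y x]])
  \<comment> \<open>Each differential is a product of matrices plus a tangent term; the products
    combine to a commutator, which is tangent.\<close>
  have "lie_bracket G2 X Y x = x ** (commutator (transpose x ** X x) (transpose x ** Y x) + B - C)"
    by (simp add: lie_bracket_def B(2) C(2) commutator_def mm_simps matrix_mul_assoc G2_orthogonal[OF x])
  moreover have "commutator (transpose x ** X x) (transpose x ** Y x) + B - C \<in> oct_der"
    using vector_fieldsD(2)[OF X x] vector_fieldsD(2)[OF Y x] B(1) C(1) tangent_G2_iff[OF x]
    by (intro subspace_diff[OF oct_der_subspace] subspace_add[OF oct_der_subspace] oct_der_commutator) auto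
  ultimately show "lie_bracket G2 X Y x \<in> tangent_space G2 x"
    unfolding tangent_space_G2[OF x] by blast
next
  fix V :: "real^8^8 \<Rightarrow> real^8^8" assume "smooth_map G2 V"
  then show "smooth_map G2 (\<lambda>y. G2_proj y (V y))"
    unfolding G2_proj_def by (intro smooth_map_mult smooth_map_transpose smooth_map_der_proj smooth_map_id)
qed

text \<open>This matrix represents the functional that sends \<open>A\<close> to the inner product
  of \<open>w\<close> with \<open>A *v oct_e 1\<close>. Gradients of functions of
  \<open>y *v oct_e 1\<close> are therefore projections of such matrices.\<close>

definition col1 :: "real^8 \<Rightarrow> real^8^8" where
  "col1 w = (\<chi> i j. if j = 1 then w $ i else 0)"

lemma col1_nth: "col1 w $ i $ j = (if j = 1 then w $ i else 0)"
  by (simp add: col1_def)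

lemma col1_inner: "col1 w \<bullet> A = w \<bullet> (A *v oct_e 1)"
  by (simp add: inner_vec_def col1_nth oct_e_def matrix_vector_mult_axis_nth sum_8)

lemma bounded_linear_col1: "bounded_linear col1"
  by (simp add: linear_conv_bounded_linear[symmetric] linearI vec_eq_iff col1_nth)

lemma mult_col1: "A ** col1 w = col1 (A *v w)"
  by (simp add: vec_eq_iff col1_nth matrix_matrix_mult_def matrix_vector_mult_def)

lemma col1_mult_SU3:
  assumes k: "k \<in> SU3"
  shows "col1 w ** k = col1 w"
proof -
  have "transpose k *v oct_e 1 = oct_e 1" using SU3_props(3)[OF k] by (simp add: SU3_def)
  then have "(transpose k *v axis 1 1) $ j = axis 1 1 $ j" for j by (simp add: oct_e_def)
  then have "k $ 1 $ j = (if j = 1 then 1 else 0)" for j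
    by (simp only: matrix_vector_mult_axis_nth transpose_nth axis_nth_if eq_commute[of 1 j])
  then show ?thesis by (simp add: vec_eq_iff matrix_mult_8 col1_nth)
qed

text \<open>In the left trivialisation: \<open>y\<^sup>T \<sigma> y\<close> replaces \<open>\<sigma>\<close>, and \<open>grad_der y\<close> is half the gradient of the height.\<close>

definition sigma_at :: "real^8^8 \<Rightarrow> real^8^8" where
  "sigma_at y = transpose y ** oct_sigma ** y"

definition grad_der :: "real^8^8 \<Rightarrow> real^8^8" where
  "grad_der y = der_proj (col1 (sigma_at y *v oct_e 1))"

definition height_grad :: "real^8^8 \<Rightarrow> real^8^8" where
  "height_grad y = y ** grad_der y"

text \<open>The covariant derivative of \<open>height_grad\<close> in direction
  \<open>y ** A\<close>, see \<open>height_grad_differential\<close>. The commutator is the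
  projection of \<open>A ** grad_der y\<close>, as for a left-invariant field; the second term comes
  from the derivative of \<open>sigma_at\<close>, where the transpose of \<open>A\<close> is
  \<open>- A\<close>.\<close>

definition shape_der :: "real^8^8 \<Rightarrow> real^8^8 \<Rightarrow> real^8^8" where
  "shape_der y A = (1/2) *\<^sub>R commutator A (grad_der y)
     + der_proj (col1 (sigma_at y *v (A *v oct_e 1) - A *v (sigma_at y *v oct_e 1)))"

lemma grad_der_in: "grad_der y \<in> oct_der"
  by (simp add: grad_der_def der_proj_in)

lemma grad_der_inner: "A \<in> oct_der \<Longrightarrow> grad_der y \<bullet> A = (sigma_at y *v oct_e 1) \<bullet> (A *v oct_e 1)"
  by (simp add: grad_der_def der_proj_inner col1_inner)

lemma shape_der_in: "A \<in> oct_der \<Longrightarrow> shape_der y A \<in> oct_der"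
  unfolding shape_der_def
  by (intro subspace_add[OF oct_der_subspace] subspace_scale[OF oct_der_subspace] oct_der_commutator
      grad_der_in der_proj_in)

lemma shape_der_linear: "linear (shape_der y)"
proof -
  have l: "linear col1" using bounded_linear_col1 bounded_linear.linear by blast
  show ?thesis unfolding shape_der_def
    by (rule linearI)
      (simp_all add: commutator_def mm_simps mv_simps linear_add[OF l] linear_scale[OF l] linear_diff[OF l]
        linear_add[OF der_proj_linear] linear_scale[OF der_proj_linear] linear_diff[OF der_proj_linear]
        scaleR_add_right scaleR_diff_right mult.commute algebra_simps)
qed

lemma sigma_at_translate:
  assumes h: "h \<in> SO4"
  shows "sigma_at (h ** y ** k) = transpose k ** sigma_at y ** k"
proof -
  have c: "oct_sigma ** h = h ** oct_sigma" and o: "transpose h ** h = mat 1"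
    using h G2_orthogonal[OF SO4_G2[OF h]] by (auto simp: SO4_def)
  have "transpose h ** (oct_sigma ** h) = oct_sigma"
    unfolding c matrix_mul_assoc o by simp
  moreover have "sigma_at (h ** y ** k) = transpose k ** transpose y ** (transpose h ** (oct_sigma ** h)) ** y ** k"
    by (simp add: sigma_at_def matrix_transpose_mul matrix_mul_assoc)
  ultimately show ?thesis by (simp add: sigma_at_def matrix_mul_assoc)
qed

lemma col1_conj: "k \<in> SU3 \<Longrightarrow> col1 (transpose k *v w) = transpose k ** col1 w ** k"
  by (simp add: col1_mult_SU3 mult_col1 flip: matrix_mul_assoc)

lemma grad_der_translate:
  assumes h: "h \<in> SO4" and k: "k \<in> SU3"
  shows "grad_der (h ** y ** k) = transpose k ** grad_der y ** k"
proof -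
  have "k *v oct_e 1 = oct_e 1" using k by (simp add: SU3_def)
  then have "sigma_at (h ** y ** k) *v oct_e 1 = transpose k *v (sigma_at y *v oct_e 1)"
    by (simp add: sigma_at_translate[OF h] flip: matrix_vector_mul_assoc)
  then show ?thesis by (simp add: grad_der_def col1_conj[OF k] der_proj_conj[OF SU3_G2[OF k]])
qed

text \<open>Translation by \<open>h\<close> disappears because \<open>h\<close> commutes with
  \<open>oct_sigma\<close>, and translation by \<open>k\<close> acts by conjugation. This carries
  computations at a model point to its whole orbit.\<close>

lemma shape_der_translate:
  assumes h: "h \<in> SO4" and k: "k \<in> SU3"
  shows "shape_der (h ** y ** k) (transpose k ** A ** k) = transpose k ** shape_der y A ** k"
proof -
  have ke: "k *v oct_e 1 = oct_e 1" using k by (simp add: SU3_def)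
  have kk: "k *v (transpose k *v a) = a" for a
    by (simp only: matrix_vector_mul_assoc G2_orthogonal[OF SU3_G2[OF k]] matrix_vector_mul_lid)
  have 1: "sigma_at (h ** y ** k) *v ((transpose k ** A ** k) *v oct_e 1) - (transpose k ** A ** k) *v (sigma_at (h ** y ** k) *v oct_e 1)
      = transpose k *v (sigma_at y *v (A *v oct_e 1) - A *v (sigma_at y *v oct_e 1))"
    by (simp only: sigma_at_translate[OF h] matrix_vector_mul_assoc[symmetric] ke kk mv_simps)
  have m: "(transpose k ** A ** k) ** (transpose k ** B ** k) = transpose k ** (A ** B) ** k" for A B
  proof -
    have "(transpose k ** A ** k) ** (transpose k ** B ** k) = transpose k ** A ** (k ** transpose k) ** B ** k"
      by (simp only: matrix_mul_assoc)
    then show ?thesis by (simp add: G2_orthogonal[OF SU3_G2[OF k]] matrix_mul_assoc)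
  qed
  have 2: "commutator (transpose k ** A ** k) (transpose k ** grad_der y ** k) = transpose k ** commutator A (grad_der y) ** k"
    unfolding commutator_def m by (simp add: mm_simps)
  show ?thesis
    unfolding shape_der_def 1 grad_der_translate[OF h k] 2 col1_conj[OF k] der_proj_conj[OF SU3_G2[OF k]]
    by (simp add: mm_simps)
qed

lemma sigma_at_e1_inner:
  "(sigma_at y *v oct_e 1) \<bullet> (A *v oct_e 1) = ((y ** A) *v oct_e 1) \<bullet> (oct_sigma *v (y *v oct_e 1))"
proof -
  have "(transpose y *v w) \<bullet> a = w \<bullet> (y *v a)" for w a :: "real^8"
    by (metis dot_lmul_matrix transpose_matrix_vector)
  then show ?thesis
    by (simp add: sigma_at_def inner_commute flip: matrix_vector_mul_assoc)
qed

section \<open>Tangent spaces of the regular orbits\<close>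

lemma tangent_orbit_subset:
  assumes x: "x \<in> G2" and y: "y \<in> orbit_G2 x"
  shows "tangent_space (orbit_G2 x) y \<subseteq> (\<lambda>A. y ** A) ` {A \<in> oct_der. grad_der y \<bullet> A = 0}"
proof
  fix v assume v: "v \<in> tangent_space (orbit_G2 x) y"
  have "y \<in> G2" using y orbit_G2_subset[OF x] by blast
  moreover have "v \<in> tangent_space G2 y" using v tangent_space_mono[OF orbit_G2_subset[OF x]] by blast
  ultimately obtain A where A: "A \<in> oct_der" "v = y ** A" using tangent_space_G2 by blast
  have "grad_der y \<bullet> A = 0"
    unfolding grad_der_inner[OF A(1)] sigma_at_e1_inner A(2)[symmetric] by (rule tangent_orbit_height[OF v])
  then show "v \<in> (\<lambda>A. y ** A) ` {A \<in> oct_der. grad_der y \<bullet> A = 0}" using A by blast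
qed

lemma tangent_orbitI:
  assumes H: "has_curve SO4 H" and K: "has_curve SU3 K"
  shows "H ** x + x ** K \<in> tangent_space (orbit_G2 x) x"
proof -
  obtain h where h: "smooth_on UNIV h" "\<And>t. h t \<in> SO4" "h 0 = mat 1" "(h has_vector_derivative H) (at (0::real))"
    by (rule has_curveE[OF H]) blast
  obtain k where k: "smooth_on UNIV k" "\<And>t. k t \<in> SU3" "k 0 = mat 1" "(k has_vector_derivative K) (at (0::real))"
    by (rule has_curveE[OF K]) blast
  show ?thesis
  proof (rule tangent_spaceI)
    show "smooth_on UNIV (\<lambda>t. h t ** x ** k t)"
      by (intro smooth_on_bilinear[OF bounded_bilinear_matrix_mult] smooth_on_const h k)
    have "((\<lambda>t. h t ** x) has_vector_derivative H ** x) (at 0)"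
      using bounded_bilinear.has_vector_derivative[OF bounded_bilinear_matrix_mult h(4) has_vector_derivative_const[of x]]
      by (simp add: mm_simps)
    from bounded_bilinear.has_vector_derivative[OF bounded_bilinear_matrix_mult this k(4)]
    show "((\<lambda>t. h t ** x ** k t) has_vector_derivative H ** x + x ** K) (at 0)"
      by (simp add: h(3) k(3) add.commute)
  qed (simp_all add: orbit_G2I h k)
qed

lemma transpose_model_point: "transpose (model_point t) = model_point (- t)"
proof -
  have c: "(bivec 4 1 - bivec 2 7) ** (bivec 4 1 - bivec 2 7) ** (bivec 4 1 - bivec 2 7) = - (bivec 4 1 - bivec 2 7)"
    by (rule bivec_diff_cube) simp_all
  have "transpose (model_point t) = transpose (model_point t) ** (model_point t ** model_point (- t))"
    unfolding model_point_def rot_minus[OF c] by simp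
  then show ?thesis by (simp only: left_invariant_cancel(1)[OF model_point_G2])
qed

lemma sigma_at_model_mult_vec:
  defines "F t \<equiv> (cos t)\<^sup>2 - (sin t)\<^sup>2" and "q t \<equiv> 2 * sin t * cos t"
  shows "(sigma_at (model_point t) *v w) $ a =
    (if a = 1 then F t * w$1 - q t * w$4 else if a = 2 then F t * w$2 - q t * w$7
     else if a = 4 then - F t * w$4 - q t * w$1 else if a = 7 then - F t * w$7 - q t * w$2
     else if a = 5 \<or> a = 6 then - w$a else w$a)"
proof -
  have "\<forall>a. (model_point (- t) *v (oct_sigma *v (model_point t *v w))) $ a =
    (if a = 1 then F t * w$1 - q t * w$4 else if a = 2 then F t * w$2 - q t * w$7
     else if a = 4 then - F t * w$4 - q t * w$1 else if a = 7 then - F t * w$7 - q t * w$2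
     else if a = 5 \<or> a = 6 then - w$a else w$a)"
    unfolding forall_8
    by (simp add: model_point_mult_vec oct_sigma_mult_vec F_def q_def power2_eq_square algebra_simps)
  then show ?thesis by (simp add: sigma_at_def transpose_model_point flip: matrix_vector_mul_assoc)
qed

lemma mult_oct_e_nth: "((A::real^8^8) *v oct_e i) $ k = A $ k $ i"
  by (simp add: oct_e_def matrix_vector_mult_axis_nth)

lemma sigma_at_model_nth_1:
  "sigma_at (model_point t) $ a $ 1
    = (if a = 1 then (cos t)\<^sup>2 - (sin t)\<^sup>2 else if a = 4 then - (2 * sin t * cos t) else 0)"
  unfolding mult_oct_e_nth[symmetric] sigma_at_model_mult_vec by (simp add: oct_e_def axis_nth_if)

lemma grad_der_model_inner:
  assumes A: "A \<in> oct_der"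
  shows "grad_der (model_point t) \<bullet> A = - (2 * sin t * cos t) * A$4$1"
  unfolding grad_der_inner[OF A]
  by (simp add: inner_vec_def sum_8 sigma_at_model_nth_1 mult_oct_e_nth oct_der_normalize(2,3)[OF A])

lemma bivec_diffs_in_oct_der:
  "bivec 1 2 - bivec 5 6 \<in> oct_der" "bivec 4 7 - bivec 5 6 \<in> oct_der" "bivec 3 1 - bivec 5 7 \<in> oct_der"
  "bivec 6 4 - bivec 5 7 \<in> oct_der" "bivec 4 5 - bivec 6 7 \<in> oct_der"
proof -
  note g = oct_der_generators
  show "bivec 1 2 - bivec 5 6 \<in> oct_der" "bivec 4 7 - bivec 5 6 \<in> oct_der" "bivec 4 5 - bivec 6 7 \<in> oct_der"
    by (rule g)+
  show "bivec 3 1 - bivec 5 7 \<in> oct_der" using subspace_diff[OF oct_der_subspace g(3) g(4)] by simp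
  show "bivec 6 4 - bivec 5 7 \<in> oct_der" using subspace_neg[OF oct_der_subspace g(4)] by simp
qed

text \<open>Given \<open>A\<close> orthogonal to the gradient, an infinitesimal motion
  \<open>H\<close> in SO(4) is chosen that moves the point \<open>model_point t *v oct_e 1\<close>
  with the prescribed velocity. What remains of \<open>A\<close> annihilates \<open>e_1\<close> and
  so belongs to SU(3).\<close>

lemma tangent_orbit_model:
  assumes sc: "sin t \<noteq> 0" "cos t \<noteq> 0"
  shows "tangent_space (orbit_G2 (model_point t)) (model_point t)
     = (\<lambda>A. model_point t ** A) ` {A \<in> oct_der. grad_der (model_point t) \<bullet> A = 0}" (is "?T = ?R")
proof
  let ?x = "model_point t"
  note x = model_point_G2[of t]
  show "?T \<subseteq> ?R" by (rule tangent_orbit_subset[OF x orbit_G2_refl])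
  show "?R \<subseteq> ?T"
  proof clarify
    fix A assume A: "A \<in> oct_der" and "grad_der ?x \<bullet> A = 0"
    then have A41: "A$4$1 = 0" using sc by (simp add: grad_der_model_inner)
    \<comment> \<open>These are coordinates 2 and 7 of the velocity, which the model point mixes.
      Each of the five generators in \<open>H\<close> moves \<open>cos t e_1 + sin t e_4\<close> in
      exactly one of the directions 2, 7, 3, 6, 5, with speed \<open>cos t\<close> or
      \<open>sin t\<close> up to sign; hence the divisors.\<close>
    define a2 a7 where "a2 = cos t * A$2$1 - sin t * A$7$1" and "a7 = cos t * A$7$1 + sin t * A$2$1"
    define H where "H = (- a2 / cos t) *\<^sub>R (bivec 1 2 - bivec 5 6) + (- a7 / sin t) *\<^sub>R (bivec 4 7 - bivec 5 6)
      + (A$3$1 / cos t) *\<^sub>R (bivec 3 1 - bivec 5 7) + (A$6$1 / sin t) *\<^sub>R (bivec 6 4 - bivec 5 7)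
      + (- A$5$1 / sin t) *\<^sub>R (bivec 4 5 - bivec 6 7)"
    have H: "H \<in> oct_der"
      unfolding H_def
      by (intro subspace_add[OF oct_der_subspace] subspace_scale[OF oct_der_subspace] bivec_diffs_in_oct_der)
    have Hs: "oct_sigma ** H = H ** oct_sigma"
    proof (rule oct_sigma_commuteI)
      fix a b :: 8 assume ab: "(a \<in> {0,1,2,3}) \<noteq> (b \<in> {0,1,2,3})"
      have z: "bivec i j $ a $ b = 0" if "(i \<in> {0,1,2,3}) = (j \<in> {0,1,2,3})" for i j
        by (rule bivec_nth_off_block[OF that ab])
      have "bivec 1 2 $ a $ b = 0" "bivec 5 6 $ a $ b = 0" "bivec 4 7 $ a $ b = 0" "bivec 3 1 $ a $ b = 0"
        "bivec 5 7 $ a $ b = 0" "bivec 6 4 $ a $ b = 0" "bivec 4 5 $ a $ b = 0" "bivec 6 7 $ a $ b = 0"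
        by (rule z, simp)+
      then show "H $ a $ b = 0" by (simp only: H_def vector_add_component vector_scaleR_component vector_minus_component) simp
    qed
    have e: "H *v (?x *v oct_e 1) = ?x *v (A *v oct_e 1)"
      unfolding vec_eq_iff forall_8 model_point_e1 model_point_mult_vec
      using sc A41
      by (simp add: H_def mv_simps bivec_mult_vec axis_nth_if oct_e_def matrix_vector_mult_axis_nth bivec_nth
          oct_der_normalize(2,3)[OF A] a2_def a7_def)
    define K where "K = A - transpose ?x ** H ** ?x"
    have xx: "transpose ?x *v (?x *v a) = a" for a
      by (simp only: matrix_vector_mul_assoc G2_orthogonal[OF x] matrix_vector_mul_lid)
    have K: "K \<in> oct_der"
      unfolding K_def by (intro subspace_diff[OF oct_der_subspace] A oct_der_conj[OF x H])
    have "K *v oct_e 1 = A *v oct_e 1 - transpose ?x *v (H *v (?x *v oct_e 1))"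
      by (simp add: K_def mv_simps flip: matrix_vector_mul_assoc)
    also have "\<dots> = 0" unfolding e xx by simp
    finally have "has_curve SU3 K" by (rule has_curve_SU3[OF K])
    from tangent_orbitI[OF has_curve_SO4[OF H Hs] this, of ?x]
    have "H ** ?x + ?x ** K \<in> ?T" .
    moreover have "?x ** K = ?x ** A - H ** ?x"
      by (simp add: K_def mm_simps matrix_mul_assoc G2_orthogonal[OF x])
    ultimately show "?x ** A \<in> ?T" by simp
  qed
qed

text \<open>Collects what the shape operator computation uses of an orbit, so that it can be carried
  out at any point of it.\<close>

definition regular_orbit :: "(real^8^8) set \<Rightarrow> bool" where
  "regular_orbit M \<longleftrightarrow> M \<subseteq> G2 \<and> (\<forall>y\<in>M. grad_der y \<noteq> 0 \<and>
     tangent_space M y = (\<lambda>A. y ** A) ` {A \<in> oct_der. grad_der y \<bullet> A = 0}) \<and>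
     (\<exists>x. M = orbit_G2 x)"

lemma grad_der_model_nonzero:
  assumes "sin t \<noteq> 0" "cos t \<noteq> 0"
  shows "grad_der (model_point t) \<noteq> 0"
proof
  assume "grad_der (model_point t) = 0"
  then have "- (2 * sin t * cos t) * (bivec 4 1 - bivec 2 7) $ 4 $ 1 = 0"
    using grad_der_model_inner[OF model_generator, of t] by simp
  then show False using assms by (simp add: bivec_nth)
qed

lemma regular_orbit_model:
  assumes sc: "sin t \<noteq> 0" "cos t \<noteq> 0"
  shows "regular_orbit (orbit_G2 (model_point t))"
  unfolding regular_orbit_def
proof (intro conjI ballI)
  let ?x = "model_point t"
  show "orbit_G2 ?x \<subseteq> G2" by (rule orbit_G2_subset[OF model_point_G2])
  show "\<exists>x'. orbit_G2 ?x = orbit_G2 x'" by blast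
  fix y assume "y \<in> orbit_G2 ?x"
  then obtain h k where y: "y = h ** ?x ** k" and h: "h \<in> SO4" and k: "k \<in> SU3"
    unfolding orbit_G2_eq by blast
  note kG = SU3_G2[OF k]
  have ip: "grad_der y \<bullet> (transpose k ** A ** k) = grad_der ?x \<bullet> A" for A
    unfolding y grad_der_translate[OF h k] inner_conj[OF kG] G2_conj_cancel[OF kG] ..
  show "grad_der y \<noteq> 0"
  proof
    assume "grad_der y = 0"
    then have "grad_der ?x \<bullet> grad_der ?x = 0" using ip[of "grad_der ?x"] by simp
    then show False using grad_der_model_nonzero[OF sc] by simp
  qed
  have tr: "h ** (?x ** A) ** k = y ** (transpose k ** A ** k)" for A
  proof -
    have "y ** (transpose k ** A ** k) = h ** ?x ** (k ** transpose k) ** A ** k"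
      unfolding y by (simp only: matrix_mul_assoc)
    then show ?thesis by (simp add: G2_orthogonal[OF kG] matrix_mul_assoc)
  qed
  have "tangent_space (orbit_G2 ?x) y = (\<lambda>A. y ** (transpose k ** A ** k)) ` {A \<in> oct_der. grad_der ?x \<bullet> A = 0}"
    unfolding y tangent_space_orbit_translate[OF h k] tangent_orbit_model[OF sc] image_image
    using tr[unfolded y] by simp
  also have "\<dots> = (\<lambda>A. y ** A) ` {A \<in> oct_der. grad_der y \<bullet> A = 0}"
  proof (intro equalityI image_subsetI)
    fix A assume "A \<in> {A \<in> oct_der. grad_der ?x \<bullet> A = 0}"
    then show "y ** (transpose k ** A ** k) \<in> (\<lambda>A. y ** A) ` {A \<in> oct_der. grad_der y \<bullet> A = 0}"
      using oct_der_conj[OF kG] ip by (intro image_eqI[OF refl]) simp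
  next
    fix A assume A: "A \<in> {A \<in> oct_der. grad_der y \<bullet> A = 0}"
    let ?B = "k ** A ** transpose k"
    have "?B \<in> oct_der" using oct_der_conj[OF G2_transpose[OF kG]] A by simp
    moreover have "grad_der ?x \<bullet> ?B = 0" using ip[of ?B] A by (simp add: G2_conj_cancel[OF kG])
    ultimately show "y ** A \<in> (\<lambda>A. y ** (transpose k ** A ** k)) ` {A \<in> oct_der. grad_der ?x \<bullet> A = 0}"
      by (intro image_eqI[of _ _ ?B]) (simp_all add: G2_conj_cancel[OF kG])
  qed
  finally show "tangent_space (orbit_G2 ?x) y = (\<lambda>A. y ** A) ` {A \<in> oct_der. grad_der y \<bullet> A = 0}" .
qed

lemma regular_orbitD:
  assumes "regular_orbit M" "y \<in> M"
  shows "y \<in> G2" "grad_der y \<noteq> 0"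
    "tangent_space M y = (\<lambda>A. y ** A) ` {A \<in> oct_der. grad_der y \<bullet> A = 0}"
  using assms unfolding regular_orbit_def by blast+

text \<open>The translations by \<open>SO4\<close> and \<open>SU3\<close> are isometries of the
  matrix space that carry gradients to gradients.\<close>

lemma regular_orbit_grad_norm:
  assumes M: "regular_orbit M" and "y \<in> M" "z \<in> M"
  shows "height_grad y \<bullet> height_grad y = height_grad z \<bullet> height_grad z"
proof -
  obtain x where x: "M = orbit_G2 x" using M unfolding regular_orbit_def by blast
  have "height_grad w \<bullet> height_grad w = grad_der x \<bullet> grad_der x" if w: "w \<in> M" for w
  proof -
    obtain h k where y: "w = h ** x ** k" and h: "h \<in> SO4" and k: "k \<in> SU3"
      using w unfolding x orbit_G2_eq by blast
    have "height_grad w \<bullet> height_grad w = grad_der w \<bullet> grad_der w"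
      unfolding height_grad_def by (rule G2_inner_mult_left[OF regular_orbitD(1)[OF M w]])
    also have "\<dots> = grad_der x \<bullet> grad_der x"
      unfolding y grad_der_translate[OF h k] inner_conj[OF SU3_G2[OF k]] G2_conj_cancel[OF SU3_G2[OF k]] ..
    finally show ?thesis .
  qed
  then show ?thesis using assms by simp
qed

section \<open>Shape operators of the orbits\<close>

lemma tangent_space_inter_open:
  assumes U: "open U" "x \<in> U" and v: "v \<in> tangent_space M x"
  shows "v \<in> tangent_space (M \<inter> U) x"
proof -
  obtain \<gamma> \<epsilon> where c: "\<epsilon> > 0 \<and> smooth_on {-\<epsilon><..<\<epsilon>} \<gamma> \<and> (\<forall>t\<in>{-\<epsilon><..<\<epsilon>}. \<gamma> t \<in> M)
      \<and> \<gamma> 0 = x \<and> (\<gamma> has_vector_derivative v) (at (0::real))"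
    using v unfolding tangent_space_def by blast
  then have "isCont \<gamma> 0" using has_vector_derivative_continuous by blast
  moreover have "\<gamma> 0 \<in> U" using c U by simp
  ultimately have "eventually (\<lambda>t. \<gamma> t \<in> U) (at 0)"
    using U(1) topological_tendstoD unfolding isCont_def by blast
  then obtain d where d: "d > 0" "\<And>t. t \<noteq> 0 \<Longrightarrow> dist t 0 < d \<Longrightarrow> \<gamma> t \<in> U"
    unfolding eventually_at by blast
  define e where "e = min d \<epsilon>"
  have e: "e > 0" "e \<le> \<epsilon>" "e \<le> d" using c d(1) by (auto simp: e_def)
  have "\<gamma> t \<in> M \<inter> U" if "t \<in> {-e<..<e}" for t
    using that e c d(2)[of t] \<open>\<gamma> 0 \<in> U\<close> by (cases "t = 0") (auto simp: dist_real_def)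
  moreover have "smooth_on {-e<..<e} \<gamma>"
    by (rule smooth_on_subset[of "{-\<epsilon><..<\<epsilon>}" \<gamma>]) (use c e(2) in auto)
  ultimately have "e > 0 \<and> smooth_on {-e<..<e} \<gamma> \<and> (\<forall>t\<in>{-e<..<e}. \<gamma> t \<in> M \<inter> U)
      \<and> \<gamma> 0 = x \<and> (\<gamma> has_vector_derivative v) (at 0)"
    using c e(1) by blast
  then show ?thesis unfolding tangent_space_def by blast
qed

lemma smooth_map_height_grad: "smooth_map N height_grad"
proof -
  have B: "bounded_linear (\<lambda>M::real^8^8. col1 (M *v oct_e 1))"
    using bounded_linear_compose[OF bounded_linear_col1 bounded_bilinear.bounded_linear_left[OF bounded_bilinear_matrix_vec]] .
  show ?thesis
    unfolding height_grad_def grad_der_def sigma_at_def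
    by (intro smooth_map_mult smooth_map_der_proj smooth_map_transpose smooth_map_id
        smooth_map_bounded_linear[OF B] smooth_map_const)
qed

lemma height_grad_vector_field: "height_grad \<in> vector_fields G2"
  unfolding vector_fields_def
  by (auto simp: smooth_map_height_grad tangent_space_G2 height_grad_def grad_der_in)

lemma height_grad_has_derivative:
  "(height_grad has_derivative (\<lambda>h. y ** der_proj (col1 ((transpose y ** oct_sigma ** h + transpose h ** oct_sigma ** y) *v oct_e 1))
      + h ** grad_der y)) (at y within S)"
proof -
  have B: "bounded_linear (\<lambda>M::real^8^8. der_proj (col1 (M *v oct_e 1)))"
    using bounded_linear_compose[OF oproj_bounded_linear[OF oct_der_subspace]
        bounded_linear_compose[OF bounded_linear_col1 bounded_bilinear.bounded_linear_left[OF bounded_bilinear_matrix_vec]]] .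
  have 1: "((\<lambda>y. transpose y ** oct_sigma) has_derivative (\<lambda>h. transpose h ** oct_sigma)) (at y within S)"
    by (rule bounded_linear_imp_has_derivative[OF bounded_linear_compose[OF
          bounded_bilinear.bounded_linear_left[OF bounded_bilinear_matrix_mult] bounded_linear_transpose]])
  have "(sigma_at has_derivative (\<lambda>h. transpose y ** oct_sigma ** h + transpose h ** oct_sigma ** y)) (at y within S)"
    unfolding sigma_at_def by (rule bounded_bilinear.FDERIV[OF bounded_bilinear_matrix_mult 1 has_derivative_ident])
  from bounded_bilinear.FDERIV[OF bounded_bilinear_matrix_mult has_derivative_ident bounded_linear.has_derivative[OF B this]]
  show ?thesis unfolding height_grad_def grad_der_def .
qed

lemma height_grad_differential:
  assumes y: "y \<in> G2" and A: "A \<in> oct_der"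
  shows "differential G2 height_grad y (y ** A) = y ** (A ** grad_der y)
      + y ** der_proj (col1 (sigma_at y *v (A *v oct_e 1) - A *v (sigma_at y *v oct_e 1)))"
    and "G2_proj y (differential G2 height_grad y (y ** A)) = y ** shape_der y A"
proof -
  have v: "y ** A \<in> tangent_space G2 y" unfolding tangent_space_G2[OF y] using A by blast
  have e: "(transpose y ** oct_sigma ** (y ** A) + transpose (y ** A) ** oct_sigma ** y) *v oct_e 1
      = sigma_at y *v (A *v oct_e 1) - A *v (sigma_at y *v oct_e 1)"
    by (simp add: sigma_at_def matrix_transpose_mul transpose_oct_der[OF A] mv_simps mm_simps
        matrix_vector_mul_assoc matrix_mul_assoc)
  show d: "differential G2 height_grad y (y ** A) = y ** (A ** grad_der y)
      + y ** der_proj (col1 (sigma_at y *v (A *v oct_e 1) - A *v (sigma_at y *v oct_e 1)))"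
    unfolding differential_eq[OF height_grad_has_derivative v] e by (simp add: matrix_mul_assoc add.commute)
  show "G2_proj y (differential G2 height_grad y (y ** A)) = y ** shape_der y A"
    unfolding d linear_add[OF G2.P_linear[OF y]] G2_proj_left[OF y] der_proj_mult[OF A grad_der_in]
      der_proj_id[OF der_proj_in] shape_der_def mm_simps ..
qed

lemma tangent_regular_orbit_G2:
  "regular_orbit M \<Longrightarrow> v \<in> tangent_space M y \<Longrightarrow> v \<in> tangent_space G2 y"
  using tangent_space_mono[of M G2 y] unfolding regular_orbit_def by blast

text \<open>The squared length of the gradient is constant on the orbit, so the derivative of the
  gradient along the orbit is orthogonal to the gradient.\<close>

lemma shape_der_tangent:
  assumes M: "regular_orbit M" and y: "y \<in> M" and A: "A \<in> oct_der" "grad_der y \<bullet> A = 0"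
  shows "grad_der y \<bullet> shape_der y A = 0"
proof -
  note R = regular_orbitD[OF M y]
  have v: "y ** A \<in> tangent_space M y" unfolding R(3) using A by blast
  note vG = tangent_regular_orbit_G2[OF M v]
  let ?D = "frechet_derivative height_grad (at y within M)"
  note d = smooth_map_has_derivative[OF smooth_map_height_grad y]
  have "((\<lambda>z. height_grad z \<bullet> height_grad z) has_derivative (\<lambda>h. height_grad y \<bullet> ?D h + ?D h \<bullet> height_grad y)) (at y within M)"
    by (rule has_derivative_inner[OF d d])
  then have "((\<lambda>z. height_grad y \<bullet> height_grad y) has_derivative (\<lambda>h. height_grad y \<bullet> ?D h + ?D h \<bullet> height_grad y)) (at y within M)"
    by (rule has_derivative_transform[OF y, rotated]) (rule regular_orbit_grad_norm[OF M y])
  from differential_eq[OF this v] differential_eq[OF has_derivative_const[of "height_grad y \<bullet> height_grad y"] v]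
  have "height_grad y \<bullet> ?D (y ** A) = 0" by (simp add: inner_commute)
  moreover have "?D (y ** A) = differential G2 height_grad y (y ** A)"
    using differential_eq[OF height_grad_has_derivative v] differential_eq[OF height_grad_has_derivative vG] by simp
  moreover have "G2_proj y (differential G2 height_grad y (y ** A)) \<bullet> height_grad y = differential G2 height_grad y (y ** A) \<bullet> height_grad y"
    by (rule G2.P_inner[OF R(1) vector_fieldsD(2)[OF height_grad_vector_field R(1)]])
  ultimately have "height_grad y \<bullet> (y ** shape_der y A) = 0"
    unfolding height_grad_differential(2)[OF R(1) A(1)] by (simp add: inner_commute)
  then show ?thesis unfolding height_grad_def by (simp add: G2_inner_mult_left[OF R(1)])
qed

lemma normal_space_regular:
  assumes M: "regular_orbit M" and y: "y \<in> M"
  shows "normal_space G2 metric_G2 M y = range (\<lambda>c. c *\<^sub>R height_grad y)"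
proof
  note R = regular_orbitD[OF M y]
  let ?W = "grad_der y"
  have sc: "c *\<^sub>R height_grad y = y ** (c *\<^sub>R ?W)" for c by (simp add: height_grad_def mm_simps)
  have W: "c *\<^sub>R ?W \<in> oct_der" for c by (intro subspace_scale[OF oct_der_subspace] grad_der_in)
  have g: "metric_G2 y (y ** A) (y ** B) = (1/2) * (A \<bullet> B)" if "A \<in> oct_der" "B \<in> oct_der" for A B
    using that metric_G2_eq[OF R(1)] by (simp add: tangent_space_G2[OF R(1)] G2_inner_mult_left[OF R(1)])
  show "range (\<lambda>c. c *\<^sub>R height_grad y) \<subseteq> normal_space G2 metric_G2 M y"
  proof (rule image_subsetI)
    fix c
    have "metric_G2 y v (c *\<^sub>R height_grad y) = 0" if v: "v \<in> tangent_space M y" for v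
    proof -
      obtain A where "A \<in> oct_der" "?W \<bullet> A = 0" "v = y ** A" using v unfolding R(3) by blast
      then show ?thesis unfolding sc by (simp add: g W inner_commute)
    qed
    then show "c *\<^sub>R height_grad y \<in> normal_space G2 metric_G2 M y"
      unfolding normal_space_def sc using W by (simp add: tangent_space_G2[OF R(1)])
  qed
  show "normal_space G2 metric_G2 M y \<subseteq> range (\<lambda>c. c *\<^sub>R height_grad y)"
  proof
    fix \<xi> assume \<xi>: "\<xi> \<in> normal_space G2 metric_G2 M y"
    then obtain B where B: "B \<in> oct_der" "\<xi> = y ** B"
      unfolding normal_space_def tangent_space_G2[OF R(1)] by blast
    define c where "c = (?W \<bullet> B) / (?W \<bullet> ?W)"
    define E where "E = B - c *\<^sub>R ?W"
    have E: "E \<in> oct_der" unfolding E_def by (rule subspace_diff[OF oct_der_subspace B(1) W])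
    have WE: "?W \<bullet> E = 0" using R(2) by (simp add: E_def c_def inner_diff_right)
    have "y ** E \<in> tangent_space M y" unfolding R(3) using E WE by blast
    then have "metric_G2 y (y ** E) \<xi> = 0" using \<xi> unfolding normal_space_def by blast
    then have "E \<bullet> B = 0" using g[OF E B(1)] B(2) by simp
    moreover have "E \<bullet> E = E \<bullet> B - c * (E \<bullet> ?W)"
      by (subst (2) E_def) (simp add: inner_diff_right)
    ultimately have "E \<bullet> E = 0" using WE by (simp add: inner_commute)
    then have "B = c *\<^sub>R ?W" by (simp add: E_def)
    then show "\<xi> \<in> range (\<lambda>c. c *\<^sub>R height_grad y)" using B(2) sc by auto
  qed
qed

lemma tangential_part_regular:
  assumes M: "regular_orbit M" and y: "y \<in> M" and u: "u \<in> tangent_space M y"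
  shows "tangential_part G2 metric_G2 M y (c *\<^sub>R height_grad y + u) = u"
  unfolding tangential_part_def
proof (rule the_equality)
  note R = regular_orbitD[OF M y]
  note n = normal_space_regular[OF M y]
  show "u \<in> tangent_space M y \<and> c *\<^sub>R height_grad y + u - u \<in> normal_space G2 metric_G2 M y"
    using u rangeI[of "\<lambda>c. c *\<^sub>R height_grad y" c] unfolding n by simp
  fix u' assume u': "u' \<in> tangent_space M y \<and> c *\<^sub>R height_grad y + u - u' \<in> normal_space G2 metric_G2 M y"
  then obtain d where "c *\<^sub>R height_grad y + u - u' = d *\<^sub>R height_grad y" unfolding n by blast
  then have e: "u - u' = (d - c) *\<^sub>R height_grad y" by (simp add: algebra_simps)
  have o: "height_grad y \<bullet> v = 0" if "v \<in> tangent_space M y" for v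
    using that unfolding R(3) height_grad_def by (auto simp: G2_inner_mult_left[OF R(1)])
  have "(u - u') \<bullet> (u - u') = (d - c) * (height_grad y \<bullet> (u - u'))" by (subst e) simp
  also have "height_grad y \<bullet> (u - u') = 0" using o u u' by (simp add: inner_diff_right)
  finally show "u' = u" by simp
qed

text \<open>The description operator ranges over all fields and neighbourhoods, so an arbitrary
  normal extension \<open>\<eta>\<close> has to be treated. On the orbit it is a multiple of
  \<open>height_grad\<close>, and by the product rule the varying factor contributes a normal term,
  which \<open>tangential_part\<close> drops.\<close>

lemma shape_operator_regular:
  assumes M: "regular_orbit M" and y: "y \<in> M" and A: "A \<in> oct_der" "grad_der y \<bullet> A = 0"
  shows "shape_operator G2 metric_G2 M y (c *\<^sub>R height_grad y) (y ** A) = - c *\<^sub>R (y ** shape_der y A)"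
proof -
  note R = regular_orbitD[OF M y]
  note n = normal_space_regular[OF M]
  have MG: "M \<subseteq> G2" using M unfolding regular_orbit_def by blast
  have v: "y ** A \<in> tangent_space M y" unfolding R(3) using A by blast
  note vG = tangent_regular_orbit_G2[OF M v]
  have sh: "y ** shape_der y A \<in> tangent_space M y"
    unfolding R(3) using shape_der_tangent[OF M y A] shape_der_in[OF A(1)] by blast
  have csh: "c *\<^sub>R (y ** shape_der y A) \<in> tangent_space M y"
  proof -
    have "c *\<^sub>R shape_der y A \<in> {A \<in> oct_der. grad_der y \<bullet> A = 0}"
      using shape_der_tangent[OF M y A] shape_der_in[OF A(1)] by (simp add: subspace_scale[OF oct_der_subspace])
    then show ?thesis unfolding R(3) by (intro image_eqI[of _ _ "c *\<^sub>R shape_der y A"]) (simp_all add: mm_simps)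
  qed
  have hgT: "height_grad y \<in> tangent_space G2 y" by (rule vector_fieldsD(2)[OF height_grad_vector_field R(1)])
  have main: "\<exists>b. levi_civita G2 metric_G2 X \<eta> y = b *\<^sub>R height_grad y + c *\<^sub>R (y ** shape_der y A)"
    if X: "X \<in> vector_fields G2" "X y = y ** A" and \<eta>: "\<eta> \<in> vector_fields G2" "\<eta> y = c *\<^sub>R height_grad y"
      and U: "open U" "y \<in> U" "\<And>z. z \<in> M \<inter> U \<Longrightarrow> \<eta> z \<in> normal_space G2 metric_G2 M z" for X \<eta> U
  proof -
    \<comment> \<open>As a quotient of inner products \<open>h\<close> is differentiable at
      \<open>y\<close> within the group, while it is the factor of \<open>\<eta>\<close> on
      \<open>M \<inter> U\<close> only.\<close>
    define h where "h z = (\<eta> z \<bullet> height_grad z) / (height_grad z \<bullet> height_grad z)" for z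
    have nz: "height_grad y \<bullet> height_grad y \<noteq> 0"
      using R(2) by (simp add: height_grad_def G2_inner_mult_left[OF R(1)] del: inner_eq_zero_iff) (simp add: height_grad_def)
    note dn = height_grad_has_derivative[of y G2]
    note de = smooth_map_has_derivative[OF vector_fieldsD(1)[OF \<eta>(1)] R(1)]
    obtain h' where dh: "(h has_derivative h') (at y within G2)"
      using has_derivative_divide[OF has_derivative_inner[OF de dn] has_derivative_inner[OF dn dn] nz]
      unfolding h_def by blast
    have hy: "h y = c" using nz by (simp add: h_def \<eta>(2))
    have eq: "\<eta> z = h z *\<^sub>R height_grad z" if z: "z \<in> M \<inter> U" for z
    proof -
      obtain d where d: "\<eta> z = d *\<^sub>R height_grad z" using U(3)[OF z] n z by blast
      have "height_grad z \<bullet> height_grad z \<noteq> 0" using nz regular_orbit_grad_norm[OF M, of z y] z y by simp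
      then have "h z = d" by (simp add: h_def d)
      then show ?thesis using d by simp
    qed
    let ?Dn = "differential G2 height_grad y" and ?De = "differential G2 \<eta> y"
    have sub: "M \<inter> U \<subseteq> G2" using MG by blast
    have vU: "y ** A \<in> tangent_space (M \<inter> U) y" by (rule tangent_space_inter_open[OF U(1,2) v])
    have dnG: "(height_grad has_derivative ?Dn) (at y within G2)"
      by (rule smooth_map_has_derivative[OF smooth_map_height_grad R(1)])
    have "((\<lambda>z. h z *\<^sub>R height_grad z) has_derivative (\<lambda>w. h y *\<^sub>R ?Dn w + h' w *\<^sub>R height_grad y)) (at y within M \<inter> U)"
      by (rule has_derivative_subset[OF has_derivative_scaleR[OF dh dnG] sub])
    then have "(\<eta> has_derivative (\<lambda>w. h y *\<^sub>R ?Dn w + h' w *\<^sub>R height_grad y)) (at y within M \<inter> U)"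
      by (rule has_derivative_transform[rotated 2]) (use y U eq in auto)
    from differential_eq[OF this vU] differential_eq[OF has_derivative_subset[OF de sub] vU]
    have "?De (y ** A) = c *\<^sub>R ?Dn (y ** A) + h' (y ** A) *\<^sub>R height_grad y" by (simp add: hy)
    then have "G2_proj y (?De (y ** A)) = c *\<^sub>R (y ** shape_der y A) + h' (y ** A) *\<^sub>R height_grad y"
      by (simp add: linear_add[OF G2.P_linear[OF R(1)]] linear_scale[OF G2.P_linear[OF R(1)]]
          height_grad_differential(2)[OF R(1) A(1)] G2.P_id[OF R(1) hgT])
    then show ?thesis
      unfolding G2.levi_civita_eq_nabla[OF X(1) \<eta>(1) R(1)] X(2) by (metis add.commute)
  qed
  have val: "tangential_part G2 metric_G2 M y (levi_civita G2 metric_G2 X \<eta> y) = c *\<^sub>R (y ** shape_der y A)"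
    if "X \<in> vector_fields G2" "X y = y ** A" "\<eta> \<in> vector_fields G2" "\<eta> y = c *\<^sub>R height_grad y"
      "open U" "y \<in> U" "\<And>z. z \<in> M \<inter> U \<Longrightarrow> \<eta> z \<in> normal_space G2 metric_G2 M z" for X \<eta> U
  proof -
    from main[OF that] obtain b
      where "levi_civita G2 metric_G2 X \<eta> y = b *\<^sub>R height_grad y + c *\<^sub>R (y ** shape_der y A)" by blast
    then show ?thesis using tangential_part_regular[OF M y csh] by simp
  qed
  \<comment> \<open>The left-invariant field and a constant multiple of the gradient witness that
    the value is attained.\<close>
  let ?X = "\<lambda>z. z ** A" and ?e = "\<lambda>z. c *\<^sub>R height_grad z"
  have X: "?X \<in> vector_fields G2"
    unfolding vector_fields_def using A(1) smooth_map_mult[OF smooth_map_id smooth_map_const, of G2 A]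
    by (auto simp: tangent_space_G2)
  have e: "?e \<in> vector_fields G2"
    unfolding vector_fields_def
    using smooth_map_bilinear[OF bounded_bilinear_scaleR smooth_map_const smooth_map_height_grad, of G2 c]
      subspace_scale[OF G2.subspace_tangent vector_fieldsD(2)[OF height_grad_vector_field]] by auto
  have nor: "?e z \<in> normal_space G2 metric_G2 M z" if "z \<in> M \<inter> UNIV" for z
    using that n by auto
  show ?thesis
    unfolding shape_operator_def
  proof (rule the_equality)
    show "\<exists>X\<in>vector_fields G2. \<exists>\<eta>\<in>vector_fields G2. \<exists>U. X y = y ** A \<and> \<eta> y = c *\<^sub>R height_grad y \<and> open U \<and> y \<in> U
        \<and> (\<forall>z\<in>M \<inter> U. \<eta> z \<in> normal_space G2 metric_G2 M z)
        \<and> - c *\<^sub>R (y ** shape_der y A) = - tangential_part G2 metric_G2 M y (levi_civita G2 metric_G2 X \<eta> y)"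
      using val[OF X refl e refl open_UNIV UNIV_I nor] nor
      by (intro bexI[OF _ X] bexI[OF _ e] exI[of _ UNIV]) auto
    fix w assume "\<exists>X\<in>vector_fields G2. \<exists>\<eta>\<in>vector_fields G2. \<exists>U. X y = y ** A \<and> \<eta> y = c *\<^sub>R height_grad y \<and> open U \<and> y \<in> U
        \<and> (\<forall>z\<in>M \<inter> U. \<eta> z \<in> normal_space G2 metric_G2 M z)
        \<and> w = - tangential_part G2 metric_G2 M y (levi_civita G2 metric_G2 X \<eta> y)"
    then obtain X \<eta> U where *: "X \<in> vector_fields G2" "\<eta> \<in> vector_fields G2" "X y = y ** A" "\<eta> y = c *\<^sub>R height_grad y"
        "open U" "y \<in> U" "\<forall>z\<in>M \<inter> U. \<eta> z \<in> normal_space G2 metric_G2 M z"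
        "w = - tangential_part G2 metric_G2 M y (levi_civita G2 metric_G2 X \<eta> y)"
      by (elim bexE exE conjE) rule
    have "\<And>z. z \<in> M \<inter> U \<Longrightarrow> \<eta> z \<in> normal_space G2 metric_G2 M z" using *(7) by blast
    from val[OF *(1,3,2,4,5,6) this] show "w = - c *\<^sub>R (y ** shape_der y A)" using *(8) by simp
  qed
qed

section \<open>The shape operator in coordinates at a model point\<close>

lemma bivec_diffs_in_oct_der':
  "bivec 3 1 - bivec 6 4 \<in> oct_der" "bivec 1 2 - bivec 4 7 \<in> oct_der" "bivec 5 1 - bivec 2 6 \<in> oct_der"
  "bivec 5 1 - bivec 7 3 \<in> oct_der" "bivec 1 4 - bivec 6 3 \<in> oct_der" "bivec 1 4 - bivec 7 2 \<in> oct_der"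
  "bivec 7 1 - bivec 3 5 \<in> oct_der" "bivec 7 1 - bivec 4 2 \<in> oct_der" "bivec 1 6 - bivec 2 5 \<in> oct_der"
  "bivec 1 6 - bivec 3 4 \<in> oct_der" "bivec 2 5 - bivec 3 4 \<in> oct_der"
proof -
  note g = oct_der_generators and d = subspace_diff[OF oct_der_subspace]
  show "bivec 3 1 - bivec 6 4 \<in> oct_der" "bivec 5 1 - bivec 7 3 \<in> oct_der" "bivec 1 4 - bivec 7 2 \<in> oct_der"
    "bivec 7 1 - bivec 4 2 \<in> oct_der" "bivec 1 6 - bivec 3 4 \<in> oct_der" "bivec 2 5 - bivec 3 4 \<in> oct_der"
    by (rule g)+
  show "bivec 1 2 - bivec 4 7 \<in> oct_der" "bivec 5 1 - bivec 2 6 \<in> oct_der" "bivec 1 4 - bivec 6 3 \<in> oct_der"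
    "bivec 7 1 - bivec 3 5 \<in> oct_der" "bivec 1 6 - bivec 2 5 \<in> oct_der"
    using d[OF g(5) g(6)] d[OF g(8) g(7)] d[OF g(9) g(10)] d[OF g(11) g(12)] d[OF g(13) g(14)] by simp_all
qed

lemma bivec_inner: "i \<noteq> j \<Longrightarrow> bivec i j \<bullet> B = B$i$j - B$j$i"
proof -
  assume ij: "i \<noteq> j"
  have "(\<Sum>b\<in>UNIV. bivec i j $ a $ b * B $ a $ b) = (if a = i then B$i$j else 0) + (if a = j then - B$j$i else 0)" for a
  proof -
    have "bivec i j $ a $ b * B $ a $ b = (if b = j then (if a = i then B$i$j else 0) else 0)
       + (if b = i then (if a = j then - B$j$i else 0) else 0)" for b
      using ij by (auto simp: bivec_nth)
    then show ?thesis by (simp add: sum.distrib)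
  qed
  then show ?thesis by (simp add: inner_vec_def sum.distrib)
qed

text \<open>By the relation among the three pairs with product \<open>e_2\<close>, the first
  combination pairs with a derivation \<open>B\<close> to \<open>6 * B$3$1\<close>; hence the factor
  1/6. The other five work in the same way, with a minus sign where the pair is written as 1 k
  instead of k 1.\<close>

lemma der_proj_col1:
  "der_proj (col1 d) = (d$3/6) *\<^sub>R ((bivec 3 1 - bivec 5 7) + (bivec 3 1 - bivec 6 4))
     + (- d$2/6) *\<^sub>R ((bivec 1 2 - bivec 4 7) + (bivec 1 2 - bivec 5 6))
     + (d$5/6) *\<^sub>R ((bivec 5 1 - bivec 2 6) + (bivec 5 1 - bivec 7 3))
     + (- d$4/6) *\<^sub>R ((bivec 1 4 - bivec 6 3) + (bivec 1 4 - bivec 7 2))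
     + (d$7/6) *\<^sub>R ((bivec 7 1 - bivec 3 5) + (bivec 7 1 - bivec 4 2))
     + (- d$6/6) *\<^sub>R ((bivec 1 6 - bivec 2 5) + (bivec 1 6 - bivec 3 4))"
proof (rule der_proj_eqI)
  show "(d$3/6) *\<^sub>R ((bivec 3 1 - bivec 5 7) + (bivec 3 1 - bivec 6 4))
     + (- d$2/6) *\<^sub>R ((bivec 1 2 - bivec 4 7) + (bivec 1 2 - bivec 5 6))
     + (d$5/6) *\<^sub>R ((bivec 5 1 - bivec 2 6) + (bivec 5 1 - bivec 7 3))
     + (- d$4/6) *\<^sub>R ((bivec 1 4 - bivec 6 3) + (bivec 1 4 - bivec 7 2))
     + (d$7/6) *\<^sub>R ((bivec 7 1 - bivec 3 5) + (bivec 7 1 - bivec 4 2))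
     + (- d$6/6) *\<^sub>R ((bivec 1 6 - bivec 2 5) + (bivec 1 6 - bivec 3 4)) \<in> oct_der"
    by (intro subspace_add[OF oct_der_subspace] subspace_scale[OF oct_der_subspace]
        bivec_diffs_in_oct_der bivec_diffs_in_oct_der')
  fix B assume B: "B \<in> oct_der"
  have "col1 d \<bullet> B = d$2 * B$2$1 + d$3 * B$3$1 + d$4 * B$4$1 + d$5 * B$5$1 + d$6 * B$6$1 + d$7 * B$7$1"
    unfolding col1_inner by (simp add: inner_vec_def sum_8 mult_oct_e_nth oct_der_normalize(2,3)[OF B])
  then show "(col1 d - ((d$3/6) *\<^sub>R ((bivec 3 1 - bivec 5 7) + (bivec 3 1 - bivec 6 4))
     + (- d$2/6) *\<^sub>R ((bivec 1 2 - bivec 4 7) + (bivec 1 2 - bivec 5 6))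
     + (d$5/6) *\<^sub>R ((bivec 5 1 - bivec 2 6) + (bivec 5 1 - bivec 7 3))
     + (- d$4/6) *\<^sub>R ((bivec 1 4 - bivec 6 3) + (bivec 1 4 - bivec 7 2))
     + (d$7/6) *\<^sub>R ((bivec 7 1 - bivec 3 5) + (bivec 7 1 - bivec 4 2))
     + (- d$6/6) *\<^sub>R ((bivec 1 6 - bivec 2 5) + (bivec 1 6 - bivec 3 4)))) \<bullet> B = 0"
    by (simp only: inner_diff_left inner_add_left inner_scaleR_left)
      (simp add: bivec_inner oct_der_normalize[OF B] field_simps)
qed

text \<open>\<open>F\<close> and \<open>q\<close> are cos 2t and sin 2t. The coordinates interact
  only within the groups 23, 45, 26, 51 and 31, 57, 16, 25 and 12, 47, 71, 35, while 14 and 63 are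
  sent to zero; eigenvectors can therefore be studied group by group.\<close>

lemma shape_der_model_entries:
  fixes t :: real
  defines "F \<equiv> (cos t)\<^sup>2 - (sin t)\<^sup>2" and "q \<equiv> 2 * sin t * cos t"
  assumes A: "A \<in> oct_der" and A41: "A$4$1 = 0"
  defines "R \<equiv> shape_der (model_point t) A"
  shows "R$2$3 = q/12 * A$5$1" "R$4$5 = - q/6 * A$5$1"
    "R$3$1 = (1 - F)/3 * A$3$1 - q/12 * A$1$6 - q/6 * A$2$5"
    "R$5$7 = - (1 - F)/6 * A$3$1 + q/6 * A$1$6 + q/12 * A$2$5"
    "R$1$2 = q/4 * A$7$1 - q/6 * A$3$5" "R$4$7 = - q/4 * A$7$1 + q/12 * A$3$5"
    "R$2$6 = q/12 * A$4$5 + (1 + F)/6 * A$5$1" "R$5$1 = - q/6 * A$4$5 - (1 + F)/3 * A$5$1"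
    "R$1$4 = 0" "R$6$3 = 0"
    "R$7$1 = q/4 * A$1$2 - q/6 * A$4$7 - 2 * F/3 * A$7$1"
    "R$3$5 = - q/4 * A$1$2 + q/12 * A$4$7 + F/3 * A$7$1"
    "R$1$6 = q/12 * A$3$1 + q/6 * A$5$7 - (1 + F)/3 * A$1$6"
    "R$2$5 = - q/6 * A$3$1 - q/12 * A$5$7 + (1 + F)/6 * A$1$6"
proof -
  let ?x = "model_point t"
  have A14: "A$1$4 = 0" using A41 oct_der_entries(3)[OF A, of 4 1] by simp
  have S1: "sigma_at ?x $ a $ 1 = (if a = 1 then F else if a = 4 then - q else 0)" for a
    unfolding sigma_at_model_nth_1 F_def q_def by simp
  have W: "grad_der ?x = (q/6) *\<^sub>R ((bivec 1 4 - bivec 6 3) + (bivec 1 4 - bivec 7 2))"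
    unfolding grad_der_def der_proj_col1 mult_oct_e_nth S1 by simp
  have C: "commutator A (grad_der ?x) $ a $ b
      = (q/6) * (commutator A (bivec 1 4 - bivec 6 3) $ a $ b + commutator A (bivec 1 4 - bivec 7 2) $ a $ b)" for a b
    unfolding W linear_scale[OF linear_commutator] linear_add[OF linear_commutator] by simp
  define d where "d = sigma_at ?x *v (A *v oct_e 1) - A *v (sigma_at ?x *v oct_e 1)"
  have d: "d$2 = q * (A$2$4 - A$7$1)" "d$3 = A$3$1 * (1 - F) + q * A$3$4" "d$4 = 0"
    "d$5 = - A$5$1 * (1 + F) + q * A$5$4" "d$6 = - A$6$1 * (1 + F) + q * A$6$4"
    "d$7 = - 2 * F * A$7$1 + q * (A$7$4 - A$2$1)"
    unfolding d_def vector_minus_component sigma_at_model_mult_vec matrix_vector_mult_8[of A] mult_oct_e_nth S1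
      F_def[symmetric] q_def[symmetric]
    by (simp_all add: A41 oct_der_normalize(3)[OF A] algebra_simps)
  note defs = R_def shape_der_def d_def[symmetric] vector_add_component vector_scaleR_component C der_proj_col1 d
  note n = oct_der_normalize[OF A] A41 A14
  show "R$2$3 = q/12 * A$5$1" "R$4$5 = - q/6 * A$5$1"
    "R$3$1 = (1 - F)/3 * A$3$1 - q/12 * A$1$6 - q/6 * A$2$5"
    "R$5$7 = - (1 - F)/6 * A$3$1 + q/6 * A$1$6 + q/12 * A$2$5"
    "R$1$2 = q/4 * A$7$1 - q/6 * A$3$5" "R$4$7 = - q/4 * A$7$1 + q/12 * A$3$5"
    "R$2$6 = q/12 * A$4$5 + (1 + F)/6 * A$5$1" "R$5$1 = - q/6 * A$4$5 - (1 + F)/3 * A$5$1"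
    "R$1$4 = 0" "R$6$3 = 0"
    "R$7$1 = q/4 * A$1$2 - q/6 * A$4$7 - 2 * F/3 * A$7$1"
    "R$3$5 = - q/4 * A$1$2 + q/12 * A$4$7 + F/3 * A$7$1"
    "R$1$6 = q/12 * A$3$1 + q/6 * A$5$7 - (1 + F)/3 * A$1$6"
    "R$2$5 = - q/6 * A$3$1 - q/12 * A$5$7 + (1 + F)/6 * A$1$6"
    by (simp add: defs commutator_bivec_diff_nth bivec_nth n; simp add: field_simps)+
qed

text \<open>The omitted entry 8 of \<open>oct_der_frame\<close> is the one of the coordinate \<open>A $ 1 $ 4\<close>.\<close>

definition tangent_frame :: "((real^8^8 \<Rightarrow> real) \<times> (real^8^8)) list" where
  "tangent_frame = take 8 oct_der_frame @ drop 9 oct_der_frame"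

lemma tangent_frame_props:
  "(l, b) \<in> set tangent_frame \<Longrightarrow> b \<in> oct_der \<and> linear l \<and> b$4$1 = 0"
  "B \<in> oct_der \<Longrightarrow> B$4$1 = 0 \<Longrightarrow> B = (\<Sum>(l,b)\<leftarrow>tangent_frame. l B *\<^sub>R b)"
proof -
  assume lb: "(l, b) \<in> set tangent_frame"
  then have "(l, b) \<in> set oct_der_frame"
    unfolding tangent_frame_def using set_take_subset set_drop_subset by fastforce
  moreover have "b$4$1 = 0"
    using lb unfolding tangent_frame_def oct_der_frame_def by (auto simp: bivec_nth)
  ultimately show "b \<in> oct_der \<and> linear l \<and> b$4$1 = 0" using oct_der_frame_props(1) by blast
next
  assume B: "B \<in> oct_der" "B$4$1 = 0"
  have "B$1$4 = 0" using B(2) oct_der_entries(3)[OF B(1), of 4 1] by simp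
  then have "(\<Sum>(l,b)\<leftarrow>oct_der_frame. l B *\<^sub>R b) = (\<Sum>(l,b)\<leftarrow>tangent_frame. l B *\<^sub>R b)"
    unfolding tangent_frame_def oct_der_frame_def by simp
  then show "B = (\<Sum>(l,b)\<leftarrow>tangent_frame. l B *\<^sub>R b)" using oct_der_frame_props(2)[OF B(1)] by simp
qed

text \<open>Four diagonal coefficients are present, those at the entries 31, 51, 71 and 16: (1 -
  F)/3, -(1 + F)/3, -2F/3 and -(1 + F)/3, where F is cos 2t.\<close>

lemma shape_der_model_trace:
  "(\<Sum>(l,b)\<leftarrow>tangent_frame. l (shape_der (model_point t) b)) = - (1 + 5 * ((cos t)\<^sup>2 - (sin t)\<^sup>2)) / 3"
proof -
  have "\<forall>(l,b)\<in>set tangent_frame. b \<in> oct_der \<and> b$4$1 = 0" using tangent_frame_props(1) by blast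
  then show ?thesis
    unfolding tangent_frame_def oct_der_frame_def
    by (simp add: shape_der_model_entries bivec_nth field_simps)
qed

text \<open>\<open>J\<close> identifies the derivations with \<open>A$4$1 = 0\<close> with the
  tangent space at \<open>y\<close> and turns \<open>shape_der\<close> at the model point, times
  \<open>- c\<close>, into the shape operator. The trace is then read off from the image of
  \<open>tangent_frame\<close>.\<close>

lemma trace_shape_operator:
  assumes sc: "sin t \<noteq> 0" "cos t \<noteq> 0" and y: "y \<in> orbit_G2 (model_point t)"
  defines "M \<equiv> orbit_G2 (model_point t)"
  shows "trace_on (tangent_space M y) (shape_operator G2 metric_G2 M y (c *\<^sub>R height_grad y))
    = c * (1 + 5 * ((cos t)\<^sup>2 - (sin t)\<^sup>2)) / 3"
proof -
  let ?x = "model_point t"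
  have M: "regular_orbit M" unfolding M_def by (rule regular_orbit_model[OF sc])
  have yM: "y \<in> M" using y M_def by simp
  note R = regular_orbitD[OF M yM]
  obtain h k where hk: "y = h ** ?x ** k" and h: "h \<in> SO4" and k: "k \<in> SU3"
    using y unfolding orbit_G2_eq by blast
  note kG = SU3_G2[OF k]
  have ip: "grad_der y \<bullet> (transpose k ** A ** k) = grad_der ?x \<bullet> A" for A
    unfolding hk grad_der_translate[OF h k] inner_conj[OF kG] G2_conj_cancel[OF kG] ..
  have ip0: "grad_der ?x \<bullet> A = 0 \<longleftrightarrow> A$4$1 = 0" if "A \<in> oct_der" for A
    using sc by (simp add: grad_der_model_inner[OF that])
  define J where "J B = y ** (transpose k ** B ** k)" for B
  define J' where "J' v = k ** (transpose y ** v) ** transpose k" for v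
  have J: "linear J" unfolding J_def by (rule linearI) (simp_all add: mm_simps)
  have J': "linear J'" unfolding J'_def by (rule linearI) (simp_all add: mm_simps)
  have J'J: "J' (J B) = B" for B
    unfolding J'_def J_def by (simp add: left_invariant_cancel[OF R(1)] G2_conj_cancel[OF kG])
  have JV: "J B \<in> tangent_space M y" if "B \<in> oct_der" "B$4$1 = 0" for B
    unfolding R(3) J_def
    by (intro image_eqI[OF refl] CollectI conjI oct_der_conj[OF kG that(1)]) (simp add: ip ip0[OF that(1)] that(2))
  have VJ: "\<exists>B. B \<in> oct_der \<and> B$4$1 = 0 \<and> v = J B" if v: "v \<in> tangent_space M y" for v
  proof -
    obtain A where A: "A \<in> oct_der" "grad_der y \<bullet> A = 0" "v = y ** A" using v unfolding R(3) by blast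
    let ?B = "k ** A ** transpose k"
    have B: "?B \<in> oct_der" using oct_der_conj[OF G2_transpose[OF kG] A(1)] by simp
    have "grad_der ?x \<bullet> ?B = 0" using ip[of ?B] A(2) by (simp add: G2_conj_cancel[OF kG])
    then show ?thesis
      using B ip0[OF B] A(3) by (intro exI[of _ ?B]) (simp add: J_def G2_conj_cancel[OF kG])
  qed
  \<comment> \<open>A linear map on all matrices that agrees with the shape operator on the tangent
    space.\<close>
  define T where "T v = - c *\<^sub>R (y ** shape_der y (transpose y ** v))" for v
  have T: "linear T"
    unfolding T_def by (rule linearI)
      (simp_all add: mm_simps linear_add[OF shape_der_linear] linear_scale[OF shape_der_linear] algebra_simps)
  have TJ: "T (J B) = - c *\<^sub>R J (shape_der ?x B)" for B
    unfolding T_def J_def left_invariant_cancel[OF R(1)]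
    using shape_der_translate[OF h k, of ?x B] by (simp add: hk)
  have V: "subspace (tangent_space M y)"
  proof -
    have "subspace {A \<in> oct_der. grad_der y \<bullet> A = 0}"
      using oct_der_subspace by (auto simp: subspace_def inner_add_right)
    moreover have "linear (\<lambda>A::real^8^8. y ** A)" by (rule linearI) (simp_all add: mm_simps)
    ultimately show ?thesis unfolding R(3) using linear_subspace_image by blast
  qed
  have eqT: "shape_operator G2 metric_G2 M y (c *\<^sub>R height_grad y) v = T v \<and> T v \<in> tangent_space M y"
    if v: "v \<in> tangent_space M y" for v
  proof -
    obtain A where A: "A \<in> oct_der" "grad_der y \<bullet> A = 0" "v = y ** A" using v unfolding R(3) by blast
    have "y ** shape_der y A \<in> tangent_space M y"
      unfolding R(3) using shape_der_tangent[OF M yM A(1,2)] shape_der_in[OF A(1)] by blast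
    then show ?thesis
      using shape_operator_regular[OF M yM A(1,2), of c] subspace_scale[OF V, of _ "- c"]
      by (simp add: T_def A(3) left_invariant_cancel[OF R(1)] del: scaleR_minus_left)
  qed
  define L where "L = map (\<lambda>(l,b). (\<lambda>v. l (J' v), J b)) tangent_frame"
  have "trace_on (tangent_space M y) (shape_operator G2 metric_G2 M y (c *\<^sub>R height_grad y)) = (\<Sum>(l,b)\<leftarrow>L. l (T b))"
  proof (rule trace_on_frame_list[OF V T])
    fix l b assume "(l, b) \<in> set L"
    then obtain l' b' where lb: "(l', b') \<in> set tangent_frame" "l = (\<lambda>v. l' (J' v))" "b = J b'"
      unfolding L_def by auto
    note p = tangent_frame_props(1)[OF lb(1)]
    show "b \<in> tangent_space M y \<and> linear l"
      using p JV linear_compose[OF J', of l'] unfolding lb(2,3) by (auto simp: o_def)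
  next
    fix v assume "v \<in> tangent_space M y"
    then obtain B where B: "B \<in> oct_der" "B$4$1 = 0" "v = J B" using VJ by blast
    have s: "J (\<Sum>(l,b)\<leftarrow>xs. l B *\<^sub>R b) = (\<Sum>(l,b)\<leftarrow>map (\<lambda>(l,b). (\<lambda>v. l (J' v), J b)) xs. l (J B) *\<^sub>R b)" for xs
      by (induction xs) (auto simp: linear_0[OF J] linear_add[OF J] linear_scale[OF J] J'J)
    show "v = (\<Sum>(l,b)\<leftarrow>L. l v *\<^sub>R b)"
      unfolding B(3) L_def s[symmetric] by (rule arg_cong[OF tangent_frame_props(2)[OF B(1,2)]])
  qed (use eqT in auto)
  also have "\<dots> = - c * (\<Sum>(l,b)\<leftarrow>tangent_frame. l (shape_der ?x b))"
  proof -
    have "(\<Sum>(l,b)\<leftarrow>map (\<lambda>(l,b). (\<lambda>v. l (J' v), J b)) xs. l (T b)) = - c * (\<Sum>(l,b)\<leftarrow>xs. l (shape_der ?x b))"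
      if "\<And>l b. (l, b) \<in> set xs \<Longrightarrow> linear l" for xs :: "((real^8^8 \<Rightarrow> real) \<times> (real^8^8)) list"
      using that
    proof (induction xs)
      case (Cons a xs)
      obtain l b where a: "a = (l, b)" by fastforce
      have l: "linear l" using Cons.prems a by auto
      have "l (J' (T (J b))) = - c * l (shape_der ?x b)"
        unfolding TJ linear_scale[OF J'] J'J linear_scale[OF l] by simp
      moreover have "\<And>l b. (l, b) \<in> set xs \<Longrightarrow> linear l" using Cons.prems by (meson list.set_intros(2))
      note Cons.IH[OF this]
      ultimately show ?case unfolding a by (simp add: algebra_simps)
    qed simp
    then show ?thesis unfolding L_def using tangent_frame_props(1) by blast
  qed
  finally show ?thesis unfolding shape_der_model_trace by (simp add: field_simps)
qed

lemma minimal_orbit_model_iff: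
  assumes sc: "sin t \<noteq> 0" "cos t \<noteq> 0"
  shows "minimal_submanifold G2 metric_G2 (orbit_G2 (model_point t)) \<longleftrightarrow> 1 + 5 * ((cos t)\<^sup>2 - (sin t)\<^sup>2) = 0"
proof -
  let ?M = "orbit_G2 (model_point t)"
  note n = normal_space_regular[OF regular_orbit_model[OF sc]]
  have "height_grad (model_point t) \<in> normal_space G2 metric_G2 ?M (model_point t)"
    unfolding n[OF orbit_G2_refl] by (rule range_eqI[of _ _ 1]) simp
  moreover have "trace_on (tangent_space ?M (model_point t)) (shape_operator G2 metric_G2 ?M (model_point t) (height_grad (model_point t)))
      = (1 + 5 * ((cos t)\<^sup>2 - (sin t)\<^sup>2)) / 3"
    using trace_shape_operator[OF sc orbit_G2_refl, of 1] by simp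
  moreover have "trace_on (tangent_space ?M y) (shape_operator G2 metric_G2 ?M y \<xi>) = 0"
    if "1 + 5 * ((cos t)\<^sup>2 - (sin t)\<^sup>2) = 0" "y \<in> ?M" "\<xi> \<in> normal_space G2 metric_G2 ?M y" for y \<xi>
    using that trace_shape_operator[OF sc that(2)] n[OF that(2)] by auto
  ultimately show ?thesis
    unfolding minimal_submanifold_def using orbit_G2_refl[of "model_point t"] by force
qed

section \<open>Principal curvatures of the minimal orbit\<close>

lemma oct_der_eqI:
  assumes "A \<in> oct_der" "B \<in> oct_der" "\<And>l b. (l, b) \<in> set oct_der_frame \<Longrightarrow> l A = l B"
  shows "A = B"
proof -
  have "(\<Sum>(l,b)\<leftarrow>oct_der_frame. l A *\<^sub>R b) = (\<Sum>(l,b)\<leftarrow>oct_der_frame. l B *\<^sub>R b)"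
    by (rule arg_cong[of _ _ sum_list]) (use assms(3) in \<open>auto intro!: map_cong\<close>)
  then show ?thesis
    using oct_der_frame_props(2)[OF assms(1)] oct_der_frame_props(2)[OF assms(2)] by simp
qed

lemma sin_cos_double_square:
  assumes "(cos t)\<^sup>2 - (sin t)\<^sup>2 = - 1/5"
  shows "(2 * sin t * cos t) * (2 * sin t * cos t) = (24/25 :: real)"
proof -
  have "(cos t)\<^sup>2 = 2/5" "(sin t)\<^sup>2 = 3/5"
    using assms sin_cos_squared_add[of t] by linarith+
  then have "4 * ((sin t)\<^sup>2 * (cos t)\<^sup>2) = 4 * (3/5 * (2/5))" by (simp only:)
  then show ?thesis by (simp add: power2_eq_square mult_ac)
qed

text \<open>At the minimal orbit \<open>shape_der\<close>, which is minus the shape operator, splits into blocks with characteristic polynomials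
  \<open>\<lambda>\<^sup>2 - 2/5 \<lambda> - 1/50\<close> (twice), \<open>\<lambda>\<^sup>2 + 4/15 \<lambda> - 1/50\<close> (twice), \<open>\<lambda>\<^sup>2 + 4/15 \<lambda> - 2/75\<close> and \<open>\<lambda>\<^sup>3\<close>;
  the positive root \<open>\<mu>\<close> of the first one has no opposite.\<close>

lemma shape_der_eigenvector:
  assumes F: "(cos t)\<^sup>2 - (sin t)\<^sup>2 = - 1/5" and mu: "\<mu> * \<mu> = 2/5 * \<mu> + 1/50"
  defines "q \<equiv> 2 * sin t * cos t"
  defines "E \<equiv> (4 * \<mu>) *\<^sub>R ((bivec 3 1 - bivec 5 7) + (bivec 3 1 - bivec 6 4)) + (- q) *\<^sub>R (bivec 2 5 - bivec 3 4)"
  shows "E \<in> oct_der" "E$4$1 = 0" "shape_der (model_point t) E = \<mu> *\<^sub>R E" "E$3$1 = 8 * \<mu>"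
proof -
  show E: "E \<in> oct_der"
    unfolding E_def by (intro subspace_add[OF oct_der_subspace] subspace_scale[OF oct_der_subspace]
        bivec_diffs_in_oct_der bivec_diffs_in_oct_der')
  show E41: "E$4$1 = 0" and "E$3$1 = 8 * \<mu>" by (simp_all add: E_def bivec_nth)
  have q: "q * q = 24/25" unfolding q_def by (rule sin_cos_double_square[OF F])
  have mu': "\<mu> * (\<mu> * c) = (2/5 * \<mu> + 1/50) * c" for c unfolding mult.assoc[symmetric] mu ..
  have q': "q * (q * c) = 24/25 * c" for c unfolding mult.assoc[symmetric] q ..
  show "shape_der (model_point t) E = \<mu> *\<^sub>R E"
  proof (rule oct_der_eqI)
    show "shape_der (model_point t) E \<in> oct_der" by (rule shape_der_in[OF E])
    show "\<mu> *\<^sub>R E \<in> oct_der" by (rule subspace_scale[OF oct_der_subspace E])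
    note en = shape_der_model_entries[OF E E41, of t, unfolded F, folded q_def]
    show "l (shape_der (model_point t) E) = l (\<mu> *\<^sub>R E)" if "(l, b) \<in> set oct_der_frame" for l b
      using that unfolding oct_der_frame_def
      by (auto simp: en) (simp_all add: E_def bivec_nth algebra_simps mu mu' q q')
  qed
qed

text \<open>The coordinates are eliminated block by block: the characteristic polynomial of a block
  at \<open>- \<mu>\<close>, reduced by the quadratic equation of \<open>\<mu>\<close>, has a value
  that the bound on \<open>\<mu>\<close> keeps away from zero.\<close>

lemma shape_der_no_opposite_eigenvector:
  assumes F: "(cos t)\<^sup>2 - (sin t)\<^sup>2 = - 1/5" and mu: "\<mu> * \<mu> = 2/5 * \<mu> + 1/50" "\<mu> \<ge> 2/5"
    and A: "A \<in> oct_der" "A$4$1 = 0" and R: "shape_der (model_point t) A = - \<mu> *\<^sub>R A"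
  shows "A = 0"
proof -
  define q where "q = 2 * sin t * cos t"
  have q: "q * q = 24/25" unfolding q_def by (rule sin_cos_double_square[OF F])
  have m0: "\<mu> \<noteq> 0" using mu(2) by auto
  note en = shape_der_model_entries[OF A, of t, unfolded R F, folded q_def, unfolded vector_scaleR_component real_scaleR_def]
  have z51: "A$5$1 = 0"
  proof -
    \<comment> \<open>The polynomial with linear coefficient 4/15 and constant term -2/75, evaluated
      at \<open>- \<mu>\<close>, reduces to \<open>(20 * \<mu> - 1) / 150\<close>.\<close>
    have "(20 * \<mu> - 1) * A$5$1 = 0" using en(2) en(8) mu(1) q by algebra
    then show ?thesis using mu(2) by auto
  qed
  have z45: "A$4$5 = 0" and z23: "A$2$3 = 0" using en(1,2) z51 m0 by auto
  have z26: "A$2$6 = 0" using en(7) z51 z45 m0 by auto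
  have z71: "A$7$1 = 0"
  proof -
    \<comment> \<open>The two quadratic factors of this block take the values
      \<open>4/5 * \<mu>\<close> and \<open>2/15 * \<mu>\<close> at \<open>- \<mu>\<close>, and
      \<open>20 * \<mu> + 1\<close> is 50 times the square of \<open>\<mu>\<close>.\<close>
    have "(20 * \<mu> + 1) * A$7$1 = 0" using en(5) en(6) en(11) en(12) mu(1) q by algebra
    then show ?thesis using mu(2) by auto
  qed
  have z35: "A$3$5 = 0"
  proof -
    have "(20 * \<mu> + 1) * A$3$5 = 0" using en(5) en(6) en(11) en(12) mu(1) q z71 by algebra
    then show ?thesis using mu(2) by auto
  qed
  have z12: "A$1$2 = 0" and z47: "A$4$7 = 0" using en(5,6) z71 z35 m0 by auto
  have z16: "A$1$6 = 0"
  proof -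
    have "\<mu> * A$1$6 = 0" using en(3) en(4) en(13) mu(1) q by algebra
    then show ?thesis using m0 by auto
  qed
  have z31: "A$3$1 = 0"
  proof -
    have "\<mu> * A$3$1 = 0" using en(3) en(13) en(14) mu(1) q z16 by algebra
    then show ?thesis using m0 by auto
  qed
  have z57: "A$5$7 = 0"
  proof -
    have "q \<noteq> 0" using q by auto
    then show ?thesis using en(13) z16 z31 by auto
  qed
  have z25: "A$2$5 = 0" using en(14) z16 z31 z57 m0 by auto
  have z63: "A$6$3 = 0" using en(10) m0 by auto
  have z14: "A$1$4 = 0" using A(2) oct_der_entries(3)[OF A(1), of 4 1] by simp
  show ?thesis
    by (rule oct_der_eqI[OF A(1) subspace_0[OF oct_der_subspace]])
      (auto simp: oct_der_frame_def z51 z45 z23 z26 z71 z35 z12 z47 z16 z31 z57 z25 z63 z14)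
qed

text \<open>The larger root of the first quadratic is (2 + sqrt 6)/10. The bound 2/5 is a convenient
  way to keep \<open>\<mu>\<close> and \<open>20 * \<mu> - 1\<close> nonzero.\<close>

lemma opposite_root_exists: "\<exists>\<mu>::real. \<mu> * \<mu> = 2/5 * \<mu> + 1/50 \<and> \<mu> \<ge> 2/5"
proof (intro exI conjI)
  let ?m = "(2 + sqrt 6) / 10"
  have s: "sqrt 6 * sqrt 6 = 6" by simp
  show "?m * ?m = 2/5 * ?m + 1/50" by (simp add: field_simps s)
  have "2 \<le> sqrt 6" by (rule real_le_rsqrt) simp
  then show "?m \<ge> 2/5" by simp
qed

section \<open>Isometries\<close>

text \<open>The isometry is meaningful on the group only. Its local extension \<open>F\<close> to an
  open set of matrices has second derivatives in the ordinary sense, and these are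
  symmetric.\<close>

locale G2_isometry =
  fixes \<phi> F :: "real^8^8 \<Rightarrow> real^8^8" and U :: "(real^8^8) set"
  assumes iso: "is_isometry G2 metric_G2 \<phi>"
    and U: "open U" and F: "smooth_on U F" and F_eq: "\<And>y. y \<in> G2 \<Longrightarrow> y \<in> U \<Longrightarrow> F y = \<phi> y"
begin

definition dF :: "real^8^8 \<Rightarrow> real^8^8 \<Rightarrow> real^8^8" where
  "dF y v = frechet_derivative F (at y) v"

lemma dF_has_derivative: "y \<in> U \<Longrightarrow> (F has_derivative dF y) (at y)"
  unfolding dF_def using smooth_on_has_derivative[OF F] .

lemma dF_linear: "y \<in> U \<Longrightarrow> linear (dF y)"
  using has_derivative_linear[OF dF_has_derivative] .

lemma phi_has_derivative: "y \<in> G2 \<Longrightarrow> y \<in> U \<Longrightarrow> (\<phi> has_derivative dF y) (at y within G2)"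
  unfolding dF_def by (rule local_extension_has_derivative[OF U F F_eq])

lemma differential_phi: "y \<in> G2 \<Longrightarrow> y \<in> U \<Longrightarrow> v \<in> tangent_space G2 y \<Longrightarrow> differential G2 \<phi> y v = dF y v"
  by (rule differential_eq[OF phi_has_derivative])

lemma phi_G2: "y \<in> G2 \<Longrightarrow> \<phi> y \<in> G2"
  using iso unfolding is_isometry_def bij_betw_def by blast

text \<open>The image of a curve under \<open>\<phi>\<close> is differentiable at 0 and stays in the
  group, which is all that \<open>G2_curve_velocity\<close> asks for.\<close>

lemma dF_tangent:
  assumes y: "y \<in> G2" "y \<in> U" and v: "v \<in> tangent_space G2 y"
  shows "dF y v \<in> tangent_space G2 (\<phi> y)"
proof -
  obtain \<gamma> \<epsilon> where c: "\<epsilon> > 0" "\<And>t. t \<in> {-\<epsilon><..<\<epsilon>} \<Longrightarrow> \<gamma> t \<in> G2" "\<gamma> 0 = y"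
    "(\<gamma> has_vector_derivative v) (at (0::real))" using tangent_spaceE[OF v] by blast
  have "((\<lambda>t. \<phi> (\<gamma> t)) has_vector_derivative dF y v) (at 0)"
    by (rule has_vector_derivative_along_curve[OF phi_has_derivative[OF y] c])
  moreover have "\<phi> (\<gamma> t) \<in> G2" if "t \<in> {-\<epsilon><..<\<epsilon>}" for t using phi_G2[OF c(2)[OF that]] .
  ultimately have "transpose (\<phi> y) ** dF y v \<in> oct_der"
    by (intro G2_curve_velocity[OF phi_G2[OF y(1)] c(1), of "\<lambda>t. \<phi> (\<gamma> t)"]) (auto simp: c(3))
  then show ?thesis using tangent_G2_iff[OF phi_G2[OF y(1)]] by blast
qed

lemma dF_inner:
  assumes y: "y \<in> G2" "y \<in> U" and u: "u \<in> tangent_space G2 y" and v: "v \<in> tangent_space G2 y"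
  shows "dF y u \<bullet> dF y v = u \<bullet> v"
proof -
  have "metric_G2 (\<phi> y) (differential G2 \<phi> y u) (differential G2 \<phi> y v) = metric_G2 y u v"
    using iso y(1) u v unfolding is_isometry_def by blast
  then show ?thesis
    by (simp add: differential_phi[OF y] u v metric_G2_eq[OF y(1) u v]
        metric_G2_eq[OF phi_G2[OF y(1)] dF_tangent[OF y u] dF_tangent[OF y v]])
qed

text \<open>Preserving inner products makes the differential injective, and left translation shows
  that all tangent spaces of the group have the same dimension.\<close>

lemma dF_surj:
  assumes y: "y \<in> G2" "y \<in> U" and w: "w \<in> tangent_space G2 (\<phi> y)"
  obtains v where "v \<in> tangent_space G2 y" "dF y v = w"
proof -
  let ?T = "tangent_space G2 y" and ?T' = "tangent_space G2 (\<phi> y)"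
  have S: "subspace ?T" "subspace ?T'" using G2.subspace_tangent y(1) phi_G2 by auto
  have inj: "inj_on (dF y) ?T"
  proof (rule inj_onI)
    fix u v assume u: "u \<in> ?T" and v: "v \<in> ?T" and e: "dF y u = dF y v"
    have d: "u - v \<in> ?T" using S(1) u v by (rule subspace_diff)
    have "dF y (u - v) = 0" using e by (simp add: linear_diff[OF dF_linear[OF y(2)]])
    then have "(u - v) \<bullet> (u - v) = 0" using dF_inner[OF y d d] by simp
    then show "u = v" by simp
  qed
  have dim: "dim (tangent_space G2 z) = dim oct_der" if z: "z \<in> G2" for z
  proof -
    have "linear (\<lambda>A::real^8^8. z ** A)" by (rule linearI) (simp_all add: mm_simps)
    moreover have "inj_on (\<lambda>A::real^8^8. z ** A) (span oct_der)"
      by (rule inj_on_inverseI[of _ "\<lambda>w. transpose z ** w"]) (rule left_invariant_cancel[OF z])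
    ultimately show ?thesis unfolding tangent_space_G2[OF z] by (rule dim_image_eq)
  qed
  have im: "dF y ` ?T = ?T'"
  proof (rule subspace_dim_equal)
    show "subspace (dF y ` ?T)" by (rule linear_subspace_image[OF dF_linear[OF y(2)] S(1)])
    show "dF y ` ?T \<subseteq> ?T'" using dF_tangent[OF y] by blast
    have "dim (dF y ` ?T) = dim ?T"
      using inj S(1) by (intro dim_image_eq dF_linear[OF y(2)]) (simp add: span_eq_iff[THEN iffD2])
    then show "dim (dF y ` ?T) \<ge> dim ?T'" using dim y(1) phi_G2 by simp
  qed (rule S(2))
  have "w \<in> dF y ` ?T" unfolding im by (rule w)
  then show ?thesis by (elim imageE) (rule that, simp_all)
qed

text \<open>\<open>h\<close> is the direction in which \<open>dF\<close> is differentiated and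
  \<open>w\<close> the argument of \<open>dF\<close>. The expansion in the basis reflects that
  \<open>dF\<close> is known to be differentiable for constant arguments.\<close>

definition d2F :: "real^8^8 \<Rightarrow> real^8^8 \<Rightarrow> real^8^8 \<Rightarrow> real^8^8" where
  "d2F x h w = (\<Sum>b\<in>Basis. (w \<bullet> b) *\<^sub>R frechet_derivative (\<lambda>y. dF y b) (at x) h)"

lemma dF_b_has_derivative: "x \<in> U \<Longrightarrow> ((\<lambda>y. dF y b) has_derivative frechet_derivative (\<lambda>y. dF y b) (at x)) (at x)"
  unfolding dF_def by (rule smooth_on_has_derivative[OF smooth_on_frechet_derivative[OF U F]])

lemma d2F_sym:
  assumes x: "x \<in> U"
  shows "d2F x h w = d2F x w h"
proof -
  have e: "frechet_derivative (\<lambda>y. dF y b) (at x) h = (\<Sum>c\<in>Basis. (h \<bullet> c) *\<^sub>R frechet_derivative (\<lambda>y. dF y b) (at x) c)" for b h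
    by (rule linear_basis_expansion[OF has_derivative_linear[OF dF_b_has_derivative[OF x]]])
  have s: "frechet_derivative (\<lambda>y. dF y b) (at x) c = frechet_derivative (\<lambda>y. dF y c) (at x) b" for b c
    unfolding dF_def by (rule smooth_on_symmetric_second_derivative[OF U F x])
  have dd: "d2F x h w = (\<Sum>b\<in>Basis. \<Sum>c\<in>Basis. (w \<bullet> b) *\<^sub>R (h \<bullet> c) *\<^sub>R frechet_derivative (\<lambda>y. dF y b) (at x) c)" for h w
    unfolding d2F_def e[of _ h] scaleR_sum_right ..
  have "d2F x h w = (\<Sum>b\<in>Basis. \<Sum>c\<in>Basis. (w \<bullet> b) *\<^sub>R (h \<bullet> c) *\<^sub>R frechet_derivative (\<lambda>y. dF y b) (at x) c)"
    by (rule dd)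
  also have "\<dots> = (\<Sum>c\<in>Basis. \<Sum>b\<in>Basis. (w \<bullet> b) *\<^sub>R (h \<bullet> c) *\<^sub>R frechet_derivative (\<lambda>y. dF y b) (at x) c)"
    by (rule sum.swap)
  also have "\<dots> = (\<Sum>c\<in>Basis. \<Sum>b\<in>Basis. (h \<bullet> c) *\<^sub>R (w \<bullet> b) *\<^sub>R frechet_derivative (\<lambda>y. dF y c) (at x) b)"
  proof (intro sum.cong refl)
    fix b c :: "real^8^8"
    show "(w \<bullet> b) *\<^sub>R (h \<bullet> c) *\<^sub>R frechet_derivative (\<lambda>y. dF y b) (at x) c
        = (h \<bullet> c) *\<^sub>R (w \<bullet> b) *\<^sub>R frechet_derivative (\<lambda>y. dF y c) (at x) b"
      unfolding s[of b c] by (rule scaleR_left_commute)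
  qed
  also have "\<dots> = d2F x w h"
    by (rule dd[symmetric])
  finally show ?thesis .
qed

lemma dF_chain:
  assumes x: "x \<in> S" and S: "S \<subseteq> U" and g: "(g has_derivative g') (at x within S)"
  shows "((\<lambda>y. dF y (g y)) has_derivative (\<lambda>h. dF x (g' h) + d2F x h (g x))) (at x within S)"
proof -
  have xU: "x \<in> U" using x S by blast
  have ex: "dF y w = (\<Sum>b\<in>Basis. (w \<bullet> b) *\<^sub>R dF y b)" if "y \<in> U" for y w
    by (rule linear_basis_expansion[OF dF_linear[OF that]])
  have "((\<lambda>y. \<Sum>b\<in>Basis. (g y \<bullet> b) *\<^sub>R dF y b) has_derivative
      (\<lambda>h. \<Sum>b\<in>Basis. (g x \<bullet> b) *\<^sub>R frechet_derivative (\<lambda>y. dF y b) (at x) h + (g' h \<bullet> b) *\<^sub>R dF x b)) (at x within S)"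
    by (intro has_derivative_sum has_derivative_scaleR has_derivative_inner_left g
        has_derivative_at_withinI[OF dF_b_has_derivative[OF xU]])
  moreover have "(\<Sum>b\<in>Basis. (g x \<bullet> b) *\<^sub>R frechet_derivative (\<lambda>y. dF y b) (at x) h + (g' h \<bullet> b) *\<^sub>R dF x b)
      = dF x (g' h) + d2F x h (g x)" for h
    unfolding d2F_def ex[OF xU, of "g' h"] by (simp only: sum.distrib add.commute)
  ultimately have "((\<lambda>y. \<Sum>b\<in>Basis. (g y \<bullet> b) *\<^sub>R dF y b) has_derivative (\<lambda>h. dF x (g' h) + d2F x h (g x))) (at x within S)"
    by simp
  then show ?thesis
    by (rule has_derivative_transform[OF x, rotated]) (rule ex, use S in blast)
qed

text \<open>Naturality of the Levi-Civita connection: the defect \<open>K A B - 1/2 dF [A, B]\<close> is symmetric in \<open>A, B\<close>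
  and skew after pairing with the image of a third vector, hence zero.\<close>

lemma dF_naturality:
  assumes x: "x \<in> G2" "x \<in> U" and A: "A \<in> oct_der" and B: "B \<in> oct_der" and C: "C \<in> oct_der"
  shows "(dF x (x ** (A ** B)) + d2F x (x ** A) (x ** B)) \<bullet> dF x (x ** C) = (1/2) * (commutator A B \<bullet> C)"
proof -
  define K where "K A B = dF x (x ** (A ** B)) + d2F x (x ** A) (x ** B)" for A B
  have tan: "y ** A \<in> tangent_space G2 y" if "A \<in> oct_der" "y \<in> G2" for A y
    unfolding tangent_space_G2[OF that(2)] using that(1) by blast
  have ip: "dF y (y ** A) \<bullet> dF y (y ** B) = A \<bullet> B" if "A \<in> oct_der" "B \<in> oct_der" "y \<in> G2 \<inter> U" for A B y
    using dF_inner[of y "y ** A" "y ** B"] that tan by (simp add: G2_inner_mult_left)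
  have chain: "((\<lambda>y. dF y (y ** B)) has_derivative (\<lambda>h. dF x (h ** B) + d2F x h (x ** B))) (at x within G2 \<inter> U)" for B
    by (rule dF_chain) (use x in \<open>auto intro!: bounded_linear_imp_has_derivative
        bounded_bilinear.bounded_linear_left[OF bounded_bilinear_matrix_mult]\<close>)
  \<comment> \<open>The left-invariant fields \<open>y ** B\<close> and \<open>y ** C\<close> have
    constant inner product and \<open>dF\<close> preserves it; this is the identity differentiated
    in direction \<open>x ** A\<close>.\<close>
  have skew: "K A B \<bullet> dF x (x ** C) + dF x (x ** B) \<bullet> K A C = 0"
    if ABC: "A \<in> oct_der" "B \<in> oct_der" "C \<in> oct_der" for A B C
  proof -
    have xx: "x \<in> G2 \<inter> U" using x by blast
    note d = has_derivative_inner[OF chain[of B] chain[of C]]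
    have d0: "((\<lambda>y. B \<bullet> C) has_derivative (\<lambda>h. dF x (x ** B) \<bullet> (dF x (h ** C) + d2F x h (x ** C))
        + (dF x (h ** B) + d2F x h (x ** B)) \<bullet> dF x (x ** C))) (at x within G2 \<inter> U)"
      by (rule has_derivative_transform[OF xx _ d]) (simp only: ip ABC)
    have v: "x ** A \<in> tangent_space (G2 \<inter> U) x"
      by (rule tangent_space_inter_open[OF U x(2) tan[OF ABC(1) x(1)]])
    show ?thesis
      using differential_eq[OF d0 v] differential_eq[OF has_derivative_const[of "B \<bullet> C"] v]
      unfolding K_def by (simp add: matrix_mul_assoc)
  qed
  define T where "T A B = K A B - (1/2) *\<^sub>R dF x (x ** commutator A B)" for A B
  have Tsym: "T A B = T B A" for A B
  proof -
    have e: "dF x (x ** commutator A B) = dF x (x ** (A ** B)) - dF x (x ** (B ** A))" for A B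
      by (simp add: commutator_def mm_simps linear_diff[OF dF_linear[OF x(2)]])
    have half: "a + h - (1/2) *\<^sub>R (a - b) = b + h - (1/2) *\<^sub>R (b - a)" for a b h :: "real^8^8"
    proof -
      have "a - b = (1/2) *\<^sub>R (a - b) + (1/2) *\<^sub>R (a - b)" by (simp flip: scaleR_add_left)
      moreover have "(1/2) *\<^sub>R (b - a) = - ((1/2) *\<^sub>R (a - b))" by (simp add: scaleR_diff_right)
      ultimately show ?thesis by (simp add: algebra_simps)
    qed
    show ?thesis
      unfolding T_def K_def e d2F_sym[OF x(2), of "x ** B" "x ** A"] by (rule half)
  qed
  have xU: "x \<in> G2 \<inter> U" using x by blast
  have Tskew: "T A B \<bullet> dF x (x ** C) = - (T A C \<bullet> dF x (x ** B))"
    if ABC: "A \<in> oct_der" "B \<in> oct_der" "C \<in> oct_der" for A B C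
    using skew[OF ABC] ip[OF oct_der_commutator[OF ABC(1,2)] ABC(3) xU] ip[OF oct_der_commutator[OF ABC(1,3)] ABC(2) xU]
      inner_commutator[OF ABC(1), of B C]
    unfolding T_def by (simp add: inner_diff_left inner_diff_right inner_commute)
  have "T A B \<bullet> dF x (x ** C) = 0"
    using Tskew[OF A B C] Tskew[OF C A B] Tskew[OF B C A] Tsym[of A B] Tsym[of A C] Tsym[of B C] by simp
  then show ?thesis
    using ip[OF oct_der_commutator[OF A B] C xU] unfolding T_def K_def by (simp add: inner_diff_left)
qed

end

section \<open>Isometries that preserve a regular orbit\<close>

lemma height_grad_tangent: "y \<in> G2 \<Longrightarrow> height_grad y \<in> tangent_space G2 y"
  by (rule vector_fieldsD(2)[OF height_grad_vector_field])

lemma height_grad_inner: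
  assumes y: "y \<in> G2" and w: "w \<in> tangent_space G2 y"
  shows "height_grad y \<bullet> w = (w *v oct_e 1) \<bullet> (oct_sigma *v (y *v oct_e 1))"
proof -
  obtain A where A: "A \<in> oct_der" "w = y ** A" using w unfolding tangent_space_G2[OF y] by blast
  show ?thesis
    unfolding A(2) height_grad_def G2_inner_mult_left[OF y] grad_der_inner[OF A(1)] by (rule sigma_at_e1_inner)
qed

context G2_isometry
begin

text \<open>The preimage \<open>u\<close> of the gradient at \<open>\<phi> y\<close> is orthogonal
  to the orbit, because the height composed with \<open>\<phi>\<close> is constant on it. The normal
  space is a line and the two gradients have equal length, so the factor is 1 or -1.\<close>

lemma height_grad_image:
  assumes M: "regular_orbit M" "\<phi> ` M \<subseteq> M" and y: "y \<in> M" "y \<in> U"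
  obtains c where "c * c = 1" "dF y (height_grad y) = c *\<^sub>R height_grad (\<phi> y)"
proof -
  note R = regular_orbitD[OF M(1) y(1)]
  have pM: "\<phi> z \<in> M" if "z \<in> M" for z using M(2) that by blast
  note pG = phi_G2[OF R(1)]
  obtain u where u: "u \<in> tangent_space G2 y" "dF y u = height_grad (\<phi> y)"
    by (rule dF_surj[OF R(1) y(2) height_grad_tangent[OF pG]])
  obtain x0 where x0: "M = orbit_G2 x0" using M(1) unfolding regular_orbit_def by blast
  have MG: "M \<subseteq> G2" using M(1) unfolding regular_orbit_def by blast
  have "metric_G2 y w u = 0" if w: "w \<in> tangent_space M y" for w
  proof -
    note wG = tangent_regular_orbit_G2[OF M(1) w]
    have "((\<lambda>z. sigma_height (\<phi> z)) has_derivative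
        (\<lambda>v. 2 * ((dF y v *v oct_e 1) \<bullet> (oct_sigma *v (\<phi> y *v oct_e 1))))) (at y within M)"
      by (rule has_derivative_compose[OF has_derivative_subset[OF phi_has_derivative[OF R(1) y(2)] MG]
            sigma_height_has_derivative])
    then have "((\<lambda>z. sigma_height x0) has_derivative
        (\<lambda>v. 2 * ((dF y v *v oct_e 1) \<bullet> (oct_sigma *v (\<phi> y *v oct_e 1))))) (at y within M)"
      by (rule has_derivative_transform[OF y(1), rotated])
        (rule sigma_height_orbit[symmetric], use pM x0 in blast)
    from differential_eq[OF this w] differential_eq[OF has_derivative_const[of "sigma_height x0"] w]
    have "height_grad (\<phi> y) \<bullet> dF y w = 0"
      unfolding height_grad_inner[OF pG dF_tangent[OF R(1) y(2) wG]] by simp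
    then have "w \<bullet> u = 0"
      using dF_inner[OF R(1) y(2) wG u(1)] u(2) by (simp add: inner_commute)
    then show ?thesis using metric_G2_eq[OF R(1) wG u(1)] by simp
  qed
  then have "u \<in> normal_space G2 metric_G2 M y" unfolding normal_space_def using u(1) by blast
  then obtain c where c: "u = c *\<^sub>R height_grad y"
    unfolding normal_space_regular[OF M(1) y(1)] by blast
  have nz: "height_grad y \<bullet> height_grad y \<noteq> 0"
    using R(2) unfolding height_grad_def G2_inner_mult_left[OF R(1)] by simp
  have "u \<bullet> u = height_grad y \<bullet> height_grad y"
    using dF_inner[OF R(1) y(2) u(1) u(1)] u(2) regular_orbit_grad_norm[OF M(1) pM[OF y(1)] y(1)] by simp
  then have "(c * c) * (height_grad y \<bullet> height_grad y) = 1 * (height_grad y \<bullet> height_grad y)" unfolding c by simp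
  then have cc: "c * c = 1" using nz by (simp only: mult_cancel_right simp_thms)
  have "c *\<^sub>R dF y u = (c * c) *\<^sub>R dF y (height_grad y)"
    unfolding c linear_scale[OF dF_linear[OF y(2)]] by simp
  then have "dF y (height_grad y) = c *\<^sub>R height_grad (\<phi> y)" unfolding cc u(2) by simp
  with cc show ?thesis by (rule that)
qed

text \<open>Along the orbit, \<open>dF\<close> sends the gradient to a multiple of the gradient at
  the image point. This identity is differentiated in direction \<open>A\<close>:
  \<open>dF_naturality\<close> turns the left side into \<open>shape_der x A\<close>, the right side
  becomes minus \<open>shape_der x B\<close>. Paired with the images of tangent vectors, it says
  that the differential of the isometry anticommutes with the shape operator.\<close>

lemma shape_der_reflection:
  assumes M: "regular_orbit M" "\<phi> ` M \<subseteq> M" and x: "x \<in> M" "x \<in> U" "\<phi> x = x"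
    and refl: "dF x (height_grad x) = - height_grad x"
    and A: "A \<in> oct_der" "grad_der x \<bullet> A = 0" and C: "C \<in> oct_der" "grad_der x \<bullet> C = 0"
    and B: "B \<in> oct_der" "dF x (x ** A) = x ** B"
  shows "(x ** shape_der x B) \<bullet> dF x (x ** C) = - (shape_der x A \<bullet> C)"
proof -
  note R = regular_orbitD[OF M(1) x(1)]
  let ?W = "grad_der x"
  have tan: "x ** A \<in> tangent_space G2 x" if "A \<in> oct_der" for A
    unfolding tangent_space_G2[OF R(1)] using that by blast
  define S where "S = M \<inter> U"
  have S: "x \<in> S" "S \<subseteq> U" "S \<subseteq> G2"
    using x M(1) unfolding S_def regular_orbit_def by auto
  have v: "x ** A \<in> tangent_space S x"
    unfolding S_def by (rule tangent_space_inter_open[OF U x(2)]) (use A R(3) in blast)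
  have nz: "height_grad y \<bullet> height_grad y \<noteq> 0" if "y \<in> M" for y
    using regular_orbitD(1,2)[OF M(1) that] unfolding height_grad_def by (simp add: G2_inner_mult_left)
  have pM: "\<phi> z \<in> M" if "z \<in> M" for z using M(2) that by blast
  define Dg where "Dg h = x ** der_proj (col1 ((transpose x ** oct_sigma ** h + transpose h ** oct_sigma ** x) *v oct_e 1))
      + h ** grad_der x" for h
  have Dg: "(height_grad has_derivative Dg) (at x within T)" for T
    unfolding Dg_def by (rule height_grad_has_derivative)
  have dphi: "(\<phi> has_derivative dF x) (at x within S)"
    by (rule has_derivative_subset[OF phi_has_derivative[OF R(1) x(2)] S(3)])
  have d1: "((\<lambda>y. dF y (height_grad y)) has_derivative (\<lambda>h. dF x (Dg h) + d2F x h (height_grad x))) (at x within S)"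
    by (rule dF_chain[OF S(1,2) Dg])
  have d2: "((\<lambda>y. height_grad (\<phi> y)) has_derivative (\<lambda>h. Dg (dF x h))) (at x within S)"
    by (rule has_derivative_compose[OF dphi]) (simp add: x(3) Dg)
  \<comment> \<open>Writing the factor of \<open>height_grad_image\<close> as a quotient makes it
    differentiable at \<open>x\<close>; its derivative contributes a multiple of the normal, which
    is orthogonal to the image of \<open>C\<close>.\<close>
  define e where "e y = (dF y (height_grad y) \<bullet> height_grad (\<phi> y)) / (height_grad (\<phi> y) \<bullet> height_grad (\<phi> y))" for y
  obtain e' where de: "(e has_derivative e') (at x within S)"
    using has_derivative_divide[OF has_derivative_inner[OF d1 d2] has_derivative_inner[OF d2 d2] nz[OF pM[OF x(1)]]]
    unfolding e_def by blast
  have ex: "e x = - 1" using nz[OF x(1)] by (simp add: e_def x(3) refl)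
  have eq: "dF y (height_grad y) = e y *\<^sub>R height_grad (\<phi> y)" if y: "y \<in> S" for y
  proof -
    have yM: "y \<in> M" "y \<in> U" using y unfolding S_def by auto
    obtain c where c: "dF y (height_grad y) = c *\<^sub>R height_grad (\<phi> y)"
      by (rule height_grad_image[OF M yM])
    then have "e y = c" using nz[OF pM[OF yM(1)]] by (simp add: e_def)
    then show ?thesis using c by simp
  qed
  have "((\<lambda>y. dF y (height_grad y)) has_derivative (\<lambda>h. e x *\<^sub>R Dg (dF x h) + e' h *\<^sub>R height_grad (\<phi> x))) (at x within S)"
    by (rule has_derivative_transform[OF S(1) eq has_derivative_scaleR[OF de d2]])
  from differential_eq[OF this v] differential_eq[OF d1 v]
  have main: "dF x (Dg (x ** A)) + d2F x (x ** A) (height_grad x) = - Dg (x ** B) + e' (x ** A) *\<^sub>R height_grad x"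
    by (simp add: ex x(3) B(2))
  have Dgd: "Dg (x ** A) = differential G2 height_grad x (x ** A)" if "A \<in> oct_der" for A
    by (rule differential_eq[OF Dg tan[OF that], symmetric])
  define N where "N = der_proj (col1 (sigma_at x *v (A *v oct_e 1) - A *v (sigma_at x *v oct_e 1)))"
  have N: "N \<in> oct_der" unfolding N_def by (rule der_proj_in)
  have DA: "Dg (x ** A) = x ** (A ** ?W) + x ** N"
    unfolding Dgd[OF A(1)] height_grad_differential(1)[OF R(1) A(1)] N_def ..
  have "(dF x (Dg (x ** A)) + d2F x (x ** A) (height_grad x)) \<bullet> dF x (x ** C)
      = (dF x (x ** (A ** ?W)) + d2F x (x ** A) (x ** ?W)) \<bullet> dF x (x ** C) + dF x (x ** N) \<bullet> dF x (x ** C)"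
    unfolding DA linear_add[OF dF_linear[OF x(2)]] height_grad_def by (simp add: inner_add_left)
  also have "\<dots> = (1/2) * (commutator A ?W \<bullet> C) + N \<bullet> C"
    unfolding dF_naturality[OF R(1) x(2) A(1) grad_der_in C(1)] dF_inner[OF R(1) x(2) tan[OF N] tan[OF C(1)]]
      G2_inner_mult_left[OF R(1)] ..
  also have "\<dots> = shape_der x A \<bullet> C" unfolding shape_der_def N_def by (simp add: inner_add_left)
  finally have l: "(dF x (Dg (x ** A)) + d2F x (x ** A) (height_grad x)) \<bullet> dF x (x ** C) = shape_der x A \<bullet> C" .
  have CT: "dF x (x ** C) \<in> tangent_space G2 x" using dF_tangent[OF R(1) x(2) tan[OF C(1)]] by (simp add: x(3))
  have "height_grad x \<bullet> dF x (x ** C) = - (dF x (height_grad x) \<bullet> dF x (x ** C))" by (simp add: refl)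
  also have "\<dots> = - (?W \<bullet> C)"
    unfolding dF_inner[OF R(1) x(2) height_grad_tangent[OF R(1)] tan[OF C(1)]]
    by (simp add: height_grad_def G2_inner_mult_left[OF R(1)])
  finally have z: "height_grad x \<bullet> dF x (x ** C) = 0" using C(2) by simp
  have "Dg (x ** B) \<bullet> dF x (x ** C) = (x ** shape_der x B) \<bullet> dF x (x ** C)"
    using G2.P_inner[OF R(1) CT, of "Dg (x ** B)"] height_grad_differential(2)[OF R(1) B(1)] Dgd[OF B(1)] by simp
  then show ?thesis using l unfolding main by (simp add: inner_add_left inner_diff_left z)
qed

end

lemma minimal_angle_nonzero:
  fixes t :: real
  assumes F: "(cos t)\<^sup>2 - (sin t)\<^sup>2 = - 1/5"
  shows "sin t \<noteq> 0" "cos t \<noteq> 0"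
proof -
  have "(cos t)\<^sup>2 = 2/5" "(sin t)\<^sup>2 = 3/5"
    using assms sin_cos_squared_add[of t] by linarith+
  then show "sin t \<noteq> 0" "cos t \<noteq> 0" by auto
qed

lemma not_weakly_reflective_model:
  assumes F: "(cos t)\<^sup>2 - (sin t)\<^sup>2 = - 1/5"
  shows "\<not> weakly_reflective G2 metric_G2 (orbit_G2 (model_point t))"
proof
  let ?x = "model_point t" and ?M = "orbit_G2 (model_point t)"
  let ?W = "grad_der ?x"
  assume wr: "weakly_reflective G2 metric_G2 ?M"
  note sc = minimal_angle_nonzero[OF F]
  note M = regular_orbit_model[OF sc]
  note x = orbit_G2_refl[of ?x]
  note R = regular_orbitD[OF M x]
  have "height_grad ?x \<in> normal_space G2 metric_G2 ?M ?x"
    unfolding normal_space_regular[OF M x] by (rule range_eqI[of _ _ 1]) simp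
  then obtain \<phi> where phi: "is_isometry G2 metric_G2 \<phi>" "\<phi> ?x = ?x"
    "differential G2 \<phi> ?x (height_grad ?x) = - height_grad ?x" "\<phi> ` ?M \<subseteq> ?M"
    using wr x unfolding weakly_reflective_def by blast
  have "smooth_map G2 \<phi>" using phi(1) unfolding is_isometry_def by blast
  then obtain U F where U: "open U" "?x \<in> U" "smooth_on U F" "\<And>y. y \<in> G2 \<Longrightarrow> y \<in> U \<Longrightarrow> F y = \<phi> y"
    by (rule smooth_mapE[OF _ R(1)]) blast
  interpret I: G2_isometry \<phi> F U
    by (rule G2_isometry.intro[OF phi(1) U(1,3,4)])
  have refl: "I.dF ?x (height_grad ?x) = - height_grad ?x"
    using phi(3) I.differential_phi[OF R(1) U(2) height_grad_tangent[OF R(1)]] by simp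
  have tan: "?x ** A \<in> tangent_space G2 ?x" if "A \<in> oct_der" for A
    unfolding tangent_space_G2[OF R(1)] using that by blast
  have orth: "?W \<bullet> A = 0 \<longleftrightarrow> A$4$1 = 0" if "A \<in> oct_der" for A
    using sc by (simp add: grad_der_model_inner[OF that])
  obtain \<mu> :: real where mu: "\<mu> * \<mu> = 2/5 * \<mu> + 1/50" "\<mu> \<ge> 2/5" using opposite_root_exists by blast
  define A where "A = (4 * \<mu>) *\<^sub>R ((bivec 3 1 - bivec 5 7) + (bivec 3 1 - bivec 6 4))
      + (- (2 * sin t * cos t)) *\<^sub>R (bivec 2 5 - bivec 3 4)"
  note E = shape_der_eigenvector[OF F mu(1), folded A_def]
  have WA: "?W \<bullet> A = 0" using orth[OF E(1)] E(2) by simp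
  have "I.dF ?x (?x ** A) \<in> tangent_space G2 ?x"
    using I.dF_tangent[OF R(1) U(2) tan[OF E(1)]] by (simp add: phi(2))
  then obtain B where B: "B \<in> oct_der" "I.dF ?x (?x ** A) = ?x ** B" unfolding tangent_space_G2[OF R(1)] by blast
  have hW: "height_grad ?x \<bullet> I.dF ?x (?x ** D) = - (?W \<bullet> D)" if D: "D \<in> oct_der" for D
  proof -
    have "I.dF ?x (height_grad ?x) \<bullet> I.dF ?x (?x ** D) = ?W \<bullet> D"
      unfolding I.dF_inner[OF R(1) U(2) height_grad_tangent[OF R(1)] tan[OF D]]
      by (simp add: height_grad_def G2_inner_mult_left[OF R(1)])
    then show ?thesis by (simp add: refl)
  qed
  have WB: "?W \<bullet> B = 0"
    using hW[OF E(1)] WA unfolding B(2) by (simp add: height_grad_def G2_inner_mult_left[OF R(1)])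
  \<comment> \<open>\<open>D\<close> measures by how much the image \<open>B\<close> of the
    eigenvector \<open>A\<close> fails to be an eigenvector for \<open>- \<mu>\<close>. It vanishes
    because it is orthogonal to itself.\<close>
  define D where "D = shape_der ?x B + \<mu> *\<^sub>R B"
  have D: "D \<in> oct_der"
    unfolding D_def by (intro subspace_add[OF oct_der_subspace] subspace_scale[OF oct_der_subspace] shape_der_in B(1))
  have WD: "?W \<bullet> D = 0" using shape_der_tangent[OF M x B(1) WB] WB by (simp add: D_def inner_add_right)
  \<comment> \<open>The reflection identity pairs with images under the differential only, so
    \<open>D\<close> itself has to be written as an image.\<close>
  obtain w where w: "w \<in> tangent_space G2 ?x" "I.dF ?x w = ?x ** D"
    using I.dF_surj[OF R(1) U(2), of "?x ** D"] tan[OF D] phi(2) by metis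
  obtain C where C: "C \<in> oct_der" "w = ?x ** C" using w(1) unfolding tangent_space_G2[OF R(1)] by blast
  have WC: "?W \<bullet> C = 0"
    using hW[OF C(1)] w(2) WD unfolding C(2) by (simp add: height_grad_def G2_inner_mult_left[OF R(1)])
  have 1: "(?x ** shape_der ?x B) \<bullet> (?x ** D) = - (\<mu> * (A \<bullet> C))"
    using I.shape_der_reflection[OF M phi(4) x U(2) phi(2) refl E(1) WA C(1) WC B] w(2)
    unfolding C(2) E(3) by simp
  have 2: "(?x ** B) \<bullet> (?x ** D) = A \<bullet> C"
    using I.dF_inner[OF R(1) U(2) tan[OF E(1)] tan[OF C(1)]] w(2) B(2)
    unfolding C(2) by (simp add: G2_inner_mult_left[OF R(1)])
  have "D \<bullet> D = shape_der ?x B \<bullet> D + \<mu> * (B \<bullet> D)"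
    by (subst (1) D_def) (simp only: inner_add_left inner_scaleR_left)
  also have "\<dots> = 0" using 1 2 by (simp add: G2_inner_mult_left[OF R(1)])
  finally have "shape_der ?x B = - \<mu> *\<^sub>R B" by (simp add: D_def eq_neg_iff_add_eq_0)
  then have "B = 0"
    using shape_der_no_opposite_eigenvector[OF F mu B(1)] orth[OF B(1)] WB by simp
  then have "A \<bullet> A = 0"
    using I.dF_inner[OF R(1) U(2) tan[OF E(1)] tan[OF E(1)]] B(2) by (simp add: G2_inner_mult_left[OF R(1)] mm_simps)
  then show False using E(4) mu(2) by simp
qed

lemma not_austere_model:
  assumes F: "(cos t)\<^sup>2 - (sin t)\<^sup>2 = - 1/5"
  shows "\<not> austere G2 metric_G2 (orbit_G2 (model_point t))"
proof
  let ?x = "model_point t" and ?M = "orbit_G2 (model_point t)"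
  let ?S = "shape_operator G2 metric_G2 ?M ?x (height_grad ?x)" and ?T = "tangent_space ?M ?x"
  assume au: "austere G2 metric_G2 ?M"
  note sc = minimal_angle_nonzero[OF F]
  note M = regular_orbit_model[OF sc]
  note x = orbit_G2_refl[of ?x]
  note R = regular_orbitD[OF M x]
  have n: "height_grad ?x \<in> normal_space G2 metric_G2 ?M ?x"
    unfolding normal_space_regular[OF M x] by (rule range_eqI[of _ _ 1]) simp
  have orth: "grad_der ?x \<bullet> A = 0 \<longleftrightarrow> A$4$1 = 0" if "A \<in> oct_der" for A
    using sc by (simp add: grad_der_model_inner[OF that])
  \<comment> \<open>Because of this sign the eigenvalue \<open>\<mu>\<close> of
    \<open>shape_der\<close> makes \<open>- \<mu>\<close> a principal curvature, whereas
    \<open>\<mu>\<close> is none.\<close>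
  have S: "?S (?x ** A) = - (?x ** shape_der ?x A)" if "A \<in> oct_der" "grad_der ?x \<bullet> A = 0" for A
    using shape_operator_regular[OF M x that, of 1] by simp
  obtain \<mu> :: real where mu: "\<mu> * \<mu> = 2/5 * \<mu> + 1/50" "\<mu> \<ge> 2/5" using opposite_root_exists by blast
  define A where "A = (4 * \<mu>) *\<^sub>R ((bivec 3 1 - bivec 5 7) + (bivec 3 1 - bivec 6 4))
      + (- (2 * sin t * cos t)) *\<^sub>R (bivec 2 5 - bivec 3 4)"
  note E = shape_der_eigenvector[OF F mu(1), folded A_def]
  have WA: "grad_der ?x \<bullet> A = 0" using orth[OF E(1)] E(2) by simp
  have "{v \<in> ?T. ?S v = \<mu> *\<^sub>R v} \<subseteq> {0}"
  proof clarify
    fix v assume v: "v \<in> ?T" "?S v = \<mu> *\<^sub>R v"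
    obtain B where B: "B \<in> oct_der" "grad_der ?x \<bullet> B = 0" "v = ?x ** B" using v(1) unfolding R(3) by blast
    have "- (?x ** shape_der ?x B) = \<mu> *\<^sub>R (?x ** B)" using v(2) S[OF B(1,2)] unfolding B(3) by simp
    then have "transpose ?x ** (- (?x ** shape_der ?x B)) = transpose ?x ** (\<mu> *\<^sub>R (?x ** B))" by simp
    then have "- shape_der ?x B = \<mu> *\<^sub>R B" by (simp add: mm_simps left_invariant_cancel[OF R(1)])
    then have "shape_der ?x B = - \<mu> *\<^sub>R B" by (metis add.inverse_inverse scaleR_minus_left)
    then have "B = 0" using shape_der_no_opposite_eigenvector[OF F mu B(1)] orth[OF B(1)] B(2) by simp
    then show "v = 0" using B(3) by (simp add: mm_simps)
  qed
  then have z: "eigenvalue_multiplicity ?T ?S \<mu> = 0"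
    unfolding eigenvalue_multiplicity_def by (simp only: dim_eq_0)
  have "?x ** A \<in> {v \<in> ?T. ?S v = (- \<mu>) *\<^sub>R v}"
    using S[OF E(1) WA] E(1) WA unfolding R(3) by (auto simp: E(3) mm_simps)
  moreover have "?x ** A \<noteq> 0"
  proof
    assume "?x ** A = 0"
    then have "A = 0" using left_invariant_cancel(1)[OF R(1), of A] by (simp add: mm_simps)
    then show False using E(4) mu(2) by simp
  qed
  ultimately have "\<not> {v \<in> ?T. ?S v = (- \<mu>) *\<^sub>R v} \<subseteq> {0}" by blast
  then have "eigenvalue_multiplicity ?T ?S (- \<mu>) \<noteq> 0"
    unfolding eigenvalue_multiplicity_def by (simp only: dim_eq_0 simp_thms)
  moreover have "eigenvalue_multiplicity ?T ?S (- \<mu>) = eigenvalue_multiplicity ?T ?S \<mu>"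
    using au x n unfolding austere_def by blast
  ultimately show False using z by simp
qed

section \<open>The principal orbits\<close>

text \<open>At these angles \<open>e_1\<close> is sent to an eigenvector of
  \<open>oct_sigma\<close>, and \<open>SO4\<close> preserves the eigenspaces. This linear condition
  holds on the whole orbit; once differentiated it forces the entry \<open>A$7$1\<close> to vanish
  in addition to \<open>A$4$1\<close>.\<close>

lemma tangent_orbit_model_singular:
  assumes sc: "sin t = 0 \<or> cos t = 0"
  shows "tangent_space (orbit_G2 (model_point t)) (model_point t)
    \<subseteq> (\<lambda>A. model_point t ** A) ` {A \<in> oct_der. A$4$1 = 0 \<and> A$7$1 = 0}"
proof
  let ?x = "model_point t" and ?M = "orbit_G2 (model_point t)"
  note x = model_point_G2[of t]
  define s where "s = (cos t)\<^sup>2 - (sin t)\<^sup>2"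
  have s0: "s \<noteq> 0"
  proof
    assume "s = 0"
    then have "(cos t)\<^sup>2 = 1/2" "(sin t)\<^sup>2 = 1/2"
      unfolding s_def using sin_cos_squared_add[of t] by linarith+
    then show False using sc by auto
  qed
  fix v assume v: "v \<in> tangent_space ?M ?x"
  then have "v \<in> tangent_space G2 ?x" using tangent_space_mono[OF orbit_G2_subset[OF x]] by blast
  then obtain A where A: "A \<in> oct_der" "v = ?x ** A" unfolding tangent_space_G2[OF x] by blast
  have e0: "oct_sigma *v (?x *v oct_e 1) = s *\<^sub>R (?x *v oct_e 1)"
  proof -
    have "(sin t = 0 \<and> (cos t)\<^sup>2 = 1) \<or> (cos t = 0 \<and> (sin t)\<^sup>2 = 1)"
      using sc cos_squared_eq[of t] sin_squared_eq[of t] by auto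
    then show ?thesis
      unfolding vec_eq_iff forall_8 model_point_e1 s_def
      by (elim disjE conjE) (simp_all add: oct_sigma_mult_vec axis_nth_if)
  qed
  have e: "oct_sigma *v (z *v oct_e 1) - s *\<^sub>R (z *v oct_e 1) = 0" if z: "z \<in> ?M" for z
  proof -
    obtain h k where hk: "z = h ** ?x ** k" "h \<in> SO4" "k \<in> SU3" using z unfolding orbit_G2_eq by blast
    have "z *v oct_e 1 = h *v (?x *v oct_e 1)" using hk by (simp add: SU3_def flip: matrix_vector_mul_assoc)
    moreover have "oct_sigma *v (h *v w) = h *v (oct_sigma *v w)" for w
      using hk(2) by (simp add: SO4_def matrix_vector_mul_assoc)
    ultimately show ?thesis by (simp add: e0 mv_simps)
  qed
  have "((\<lambda>z::real^8^8. oct_sigma *v (z *v oct_e 1) - s *\<^sub>R (z *v oct_e 1)) has_derivative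
      (\<lambda>z. oct_sigma *v (z *v oct_e 1) - s *\<^sub>R (z *v oct_e 1))) (at ?x within ?M)"
    by (rule bounded_linear_imp_has_derivative)
      (simp add: linear_conv_bounded_linear[symmetric] linearI mv_simps scaleR_add_right algebra_simps)
  then have "((\<lambda>z::real^8^8. 0) has_derivative
      (\<lambda>z. oct_sigma *v (z *v oct_e 1) - s *\<^sub>R (z *v oct_e 1))) (at ?x within ?M)"
    by (rule has_derivative_transform[OF orbit_G2_refl, rotated]) (rule e[symmetric])
  from differential_eq[OF this v] differential_eq[OF has_derivative_const[of "0::real^8"] v]
  have "oct_sigma *v (v *v oct_e 1) = s *\<^sub>R (v *v oct_e 1)" by simp
  then have "transpose ?x *v (oct_sigma *v (?x *v (A *v oct_e 1))) = s *\<^sub>R (transpose ?x *v (?x *v (A *v oct_e 1)))"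
    unfolding A(2) by (simp add: mv_simps flip: matrix_vector_mul_assoc)
  then have "sigma_at ?x *v (A *v oct_e 1) = s *\<^sub>R (A *v oct_e 1)"
    unfolding sigma_at_def by (simp only: matrix_vector_mul_assoc matrix_mul_assoc G2_orthogonal[OF x] matrix_mul_lid)
  then have c: "(sigma_at ?x *v (A *v oct_e 1)) $ a = s * A$a$1" for a by (simp add: mult_oct_e_nth)
  have q: "2 * sin t * cos t = 0" using sc by auto
  have "(sigma_at ?x *v (A *v oct_e 1)) $ 4 = - s * A$4$1" "(sigma_at ?x *v (A *v oct_e 1)) $ 7 = - s * A$7$1"
    unfolding sigma_at_model_mult_vec mult_oct_e_nth s_def[symmetric] q by simp_all
  then have "s * A$4$1 = 0" "s * A$7$1 = 0" using c[of 4] c[of 7] by linarith+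
  then have "A$4$1 = 0 \<and> A$7$1 = 0" using s0 by simp
  then show "v \<in> (\<lambda>A. ?x ** A) ` {A \<in> oct_der. A$4$1 = 0 \<and> A$7$1 = 0}" using A by blast
qed

lemma dim_left_mult:
  fixes S :: "(real^8^8) set"
  assumes "x \<in> G2"
  shows "dim ((\<lambda>A. x ** A) ` S) = dim S"
proof -
  have "linear (\<lambda>A::real^8^8. x ** A)" by (rule linearI) (simp_all add: mm_simps)
  moreover have "inj_on (\<lambda>A::real^8^8. x ** A) (span S)"
    by (rule inj_on_inverseI[of _ "\<lambda>w. transpose x ** w"]) (rule left_invariant_cancel[OF assms])
  ultimately show ?thesis by (rule dim_image_eq)
qed

lemma dim_tangent_orbit:
  assumes y: "y \<in> orbit_G2 (model_point t)"
  shows "dim (tangent_space (orbit_G2 (model_point t)) y)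
    = dim (tangent_space (orbit_G2 (model_point t)) (model_point t))"
proof -
  obtain h k where hk: "y = h ** model_point t ** k" and h: "h \<in> SO4" and k: "k \<in> SU3"
    using y unfolding orbit_G2_eq by blast
  have "linear (\<lambda>v. h ** v ** k)" using bounded_linear_translate bounded_linear.linear by blast
  moreover have "inj_on (\<lambda>v. h ** v ** k) S" for S
    by (rule inj_on_inverseI[of _ "\<lambda>v. transpose h ** v ** transpose k"]) (rule SO4_SU3_cancel[OF h k])
  ultimately show ?thesis unfolding hk tangent_space_orbit_translate[OF h k] by (rule dim_image_eq)
qed

text \<open>The tangent spaces of the regular orbits have the dimension of \<open>V\<close>, those
  of the singular ones at most that of the smaller space \<open>V'\<close>. Every orbit meets the
  curve of model points, so this comparison decides which orbits are principal.\<close>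

lemma principal_orbit_iff:
  "principal_orbit M \<longleftrightarrow> (\<exists>t. 0 \<le> t \<and> t \<le> pi/2 \<and> sin t \<noteq> 0 \<and> cos t \<noteq> 0 \<and> M = orbit_G2 (model_point t))"
proof -
  define V where "V = {A \<in> oct_der. A$4$1 = 0}"
  define V' where "V' = {A \<in> oct_der. A$4$1 = 0 \<and> A$7$1 = 0}"
  have sub: "subspace V" "subspace V'" using oct_der_subspace by (auto simp: V_def V'_def subspace_def)
  have lt: "dim V' < dim V"
  proof (rule ccontr)
    assume "\<not> dim V' < dim V"
    then have "V' = V" using sub by (intro subspace_dim_equal) (auto simp: V_def V'_def)
    \<comment> \<open>A derivation that moves \<open>e_1\<close> towards \<open>e_7\<close> without
      a component along \<open>e_4\<close> separates the two spaces.\<close>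
    moreover have "bivec 7 1 - bivec 3 5 \<in> V" "bivec 7 1 - bivec 3 5 \<notin> V'"
      using bivec_diffs_in_oct_der'(7) by (simp_all add: V_def V'_def bivec_nth)
    ultimately show False by blast
  qed
  define d where "d t = dim (tangent_space (orbit_G2 (model_point t)) (model_point t))" for t
  have reg: "d t = dim V" if sc: "sin t \<noteq> 0" "cos t \<noteq> 0" for t
  proof -
    have "{A \<in> oct_der. grad_der (model_point t) \<bullet> A = 0} = V"
      using sc unfolding V_def by (auto simp: grad_der_model_inner)
    then show ?thesis unfolding d_def tangent_orbit_model[OF sc] dim_left_mult[OF model_point_G2] by simp
  qed
  have sing: "d t < dim V" if sc: "sin t = 0 \<or> cos t = 0" for t
  proof -
    have "d t \<le> dim V'"
      unfolding d_def using dim_subset[OF tangent_orbit_model_singular[OF sc]]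
      unfolding dim_left_mult[OF model_point_G2] V'_def .
    then show ?thesis using lt by simp
  qed
  have le: "d t \<le> dim V" for t using reg[of t] sing[of t] by (cases "sin t = 0 \<or> cos t = 0") auto
  have dy: "dim (tangent_space (orbit_G2 y) y) = d t" if "y \<in> orbit_G2 (model_point t)" for y t
    unfolding d_def orbit_G2_eqI[OF that] by (rule dim_tangent_orbit[OF that])
  show ?thesis
  proof
    assume P: "principal_orbit M"
    then obtain x where x: "x \<in> G2" "M = orbit_G2 x" unfolding principal_orbit_def by blast
    obtain t where t: "0 \<le> t" "t \<le> pi/2" "x \<in> orbit_G2 (model_point t)" by (rule in_orbit_model_point[OF x(1)])
    \<comment> \<open>The angle \<open>pi/4\<close> provides a regular orbit against which
      \<open>M\<close> is measured.\<close>
    have "dim (tangent_space (orbit_G2 (model_point (pi/4))) (model_point (pi/4))) \<le> dim (tangent_space M x)"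
      using P x orbit_G2_refl model_point_G2 unfolding principal_orbit_def by blast
    moreover have "sin (pi/4) \<noteq> 0" "cos (pi/4) \<noteq> 0" by (simp_all add: sin_45 cos_45)
    ultimately have "dim V \<le> d t"
      using reg[of "pi/4"] dy[OF t(3)] unfolding x(2) d_def by simp
    then have "sin t \<noteq> 0" "cos t \<noteq> 0" using sing[of t] by auto
    then show "\<exists>t. 0 \<le> t \<and> t \<le> pi/2 \<and> sin t \<noteq> 0 \<and> cos t \<noteq> 0 \<and> M = orbit_G2 (model_point t)"
      using t x(2) orbit_G2_eqI[OF t(3)] by blast
  next
    assume "\<exists>t. 0 \<le> t \<and> t \<le> pi/2 \<and> sin t \<noteq> 0 \<and> cos t \<noteq> 0 \<and> M = orbit_G2 (model_point t)"
    then obtain t where t: "sin t \<noteq> 0" "cos t \<noteq> 0" "M = orbit_G2 (model_point t)" by blast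
    have "dim (tangent_space (orbit_G2 y) y) \<le> dim (tangent_space M x)" if xy: "x \<in> M" "y \<in> G2" for x y
    proof -
      obtain s where "y \<in> orbit_G2 (model_point s)" by (rule in_orbit_model_point[OF xy(2)])
      then have "dim (tangent_space (orbit_G2 y) y) \<le> dim V" using dy le by simp
      also have "\<dots> = dim (tangent_space M x)"
        using dim_tangent_orbit[of x t] xy(1) reg[OF t(1,2)] unfolding t(3) d_def by simp
      finally show ?thesis .
    qed
    then show "principal_orbit M" unfolding principal_orbit_def using t(3) model_point_G2 by blast
  qed
qed

section \<open>The unique minimal principal orbit\<close>

lemma principal_minimal_iff:
  "principal_orbit M \<and> minimal_submanifold G2 metric_G2 M \<longleftrightarrow>
    (\<exists>t. 0 \<le> t \<and> t \<le> pi/2 \<and> (cos t)\<^sup>2 - (sin t)\<^sup>2 = - 1/5 \<and> M = orbit_G2 (model_point t))"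
proof
  assume "principal_orbit M \<and> minimal_submanifold G2 metric_G2 M"
  then obtain t where t: "0 \<le> t" "t \<le> pi/2" "sin t \<noteq> 0" "cos t \<noteq> 0" "M = orbit_G2 (model_point t)"
    and m: "minimal_submanifold G2 metric_G2 M" unfolding principal_orbit_iff by blast
  have "1 + 5 * ((cos t)\<^sup>2 - (sin t)\<^sup>2) = 0" using m minimal_orbit_model_iff[OF t(3,4)] t(5) by simp
  then have "(cos t)\<^sup>2 - (sin t)\<^sup>2 = - 1/5" by (simp add: field_simps)
  then show "\<exists>t. 0 \<le> t \<and> t \<le> pi/2 \<and> (cos t)\<^sup>2 - (sin t)\<^sup>2 = - 1/5 \<and> M = orbit_G2 (model_point t)" using t by blast
next
  assume "\<exists>t. 0 \<le> t \<and> t \<le> pi/2 \<and> (cos t)\<^sup>2 - (sin t)\<^sup>2 = - 1/5 \<and> M = orbit_G2 (model_point t)"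
  then obtain t where t: "0 \<le> t" "t \<le> pi/2" "(cos t)\<^sup>2 - (sin t)\<^sup>2 = - 1/5" "M = orbit_G2 (model_point t)" by blast
  note sc = minimal_angle_nonzero[OF t(3)]
  have "1 + 5 * ((cos t)\<^sup>2 - (sin t)\<^sup>2) = 0" unfolding t(3) by simp
  then show "principal_orbit M \<and> minimal_submanifold G2 metric_G2 M"
    using minimal_orbit_model_iff[OF sc] sc t unfolding principal_orbit_iff by blast
qed

theorem mainTheorem5:
  shows "(\<exists>!M. principal_orbit M \<and> minimal_submanifold G2 metric_G2 M) \<and>
         (\<forall>M. principal_orbit M \<and> minimal_submanifold G2 metric_G2 M \<longrightarrow>
              \<not> austere G2 metric_G2 M \<and> \<not> weakly_reflective G2 metric_G2 M)"
proof (intro conjI allI impI)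
  \<comment> \<open>Height -1/5 on the unit circle means squared cosine 2/5 and squared sine 3/5; in
    the first quadrant this fixes the angle.\<close>
  have "(sqrt (2/5))\<^sup>2 + (sqrt (3/5))\<^sup>2 = (1::real)" by simp
  then obtain t0 where t0: "0 \<le> t0" "t0 \<le> pi/2" "sqrt (2/5) = cos t0" "sqrt (3/5) = sin t0"
    using sincos_total_pi_half[of "sqrt (2/5)" "sqrt (3/5)"] by auto
  have F0: "(cos t0)\<^sup>2 - (sin t0)\<^sup>2 = - 1/5" unfolding t0(3,4)[symmetric] by simp
  have uniq: "t = t0" if t: "0 \<le> t" "t \<le> pi/2" "(cos t)\<^sup>2 - (sin t)\<^sup>2 = - 1/5" for t
  proof -
    have "(cos t)\<^sup>2 = (cos t0)\<^sup>2"
      using t(3) F0 sin_cos_squared_add[of t] sin_cos_squared_add[of t0] by linarith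
    moreover have "cos t \<ge> 0" "cos t0 \<ge> 0" using t t0 by (auto intro: cos_ge_zero)
    ultimately have "cos t = cos t0" by (simp add: power2_eq_iff_nonneg)
    then show ?thesis using cos_inj_pi[of t t0] t t0 by auto
  qed
  show "\<exists>!M. principal_orbit M \<and> minimal_submanifold G2 metric_G2 M"
    unfolding principal_minimal_iff
    by (rule ex1I[of _ "orbit_G2 (model_point t0)"]) (use t0 F0 uniq in blast)+
  fix M assume "principal_orbit M \<and> minimal_submanifold G2 metric_G2 M"
  then obtain t where "(cos t)\<^sup>2 - (sin t)\<^sup>2 = - 1/5" "M = orbit_G2 (model_point t)"
    unfolding principal_minimal_iff by blast
  then show "\<not> austere G2 metric_G2 M" "\<not> weakly_reflective G2 metric_G2 M"
    using not_austere_model not_weakly_reflective_model by auto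
qed

end
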